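(* Let $X=\operatorname{Seg}(\mathbb{P}^{2}\times\mathbb{G}(2,5))\subset\mathbb{P}(\mathbb{C}^{3}\otimes\bigwedge^{3}\mathbb{C}^{6})=\mathbb{P}^{59}$ and let $\sigma_5(X)$ be its fifth secant variety, which is a hypersurface. The prime ideal of the hypersurface $\sigma_{5}(X)$ in $\mathbb{C}[x_{i,j,k,l} : 1\le i\le 3,\ 1\le j<k<l\le 6]$ is generated by the single degree $6$ polynomial (up to scale) $F$ constructed as the image of the Young symmetrizer associated to the pair of fillings whose rows are, from top to bottom, $$\begin{matrix} a&c\\ b&e\\ d&f\end{matrix}\qquad\otimes\qquad\begin{matrix} a&b&c\\ a&b&d\\ a&d&e\\ b&d&f\\ c&e&f\\ c&e&f\end{matrix}$$ (the explicit construction of $F$ from this pair of fillings is given in the context).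
   Context: Everything is over $\mathbb{C}$. $\mathbb{G}(k,n)$ is the Grassmannian of $k$-dimensional projective subspaces of $\mathbb{P}^n$. The Segre-Grassmann variety $\operatorname{Seg}(\mathbb{P}^m\times\mathbb{G}(k,n))\subset\mathbb{P}(\mathbb{C}^{m+1}\otimes\bigwedge^{k+1}\mathbb{C}^{n+1})$ is the set of points $[v\otimes(w_0\wedge\cdots\wedge w_k)]$ with $v\neq 0$ and $w_0,\dots,w_k$ linearly independent. For a projective variety $X\subset\mathbb{P}^N$ not contained in a hyperplane, $\sigma_r(X)$ is the Zariski closure of the set of points $[p]\in\mathbb{P}^N$ such that $r$ is the minimum number for which $p=\sum_{i=1}^r x_i$ with $[x_i]\in X$. The $x_{i,j,k,l}$ ($1\le i\le3$, $1\le j<k<l\le6$) are the coordinates on $\mathbb{C}^3\otimes\bigwedge^3\mathbb{C}^6$ with respect to the basis $e_i\otimes(e_j\wedge e_k\wedge e_l)$. Construction of $F$. For each letter $z\in\{a,b,c,d,e,f\}$ introduce auxiliary variables $z_i$ ($1\le i\le3$) and $z_{r,t}$ ($1\le r\le3$, $1\le t\le6$). Write $z=(z_1,z_2,z_3)$ and $z_{r,\bullet}=(z_{r,1},\dots,z_{r,6})$ for row vectors, and let $\det[\cdot;\dots;\cdot]$ be the determinant of the matrix with the listed rows. Each column of a filling gives a determinant: $$p_V=\det[a;b;d]\cdot\det[c;e;f],$$ $$p_W=\det[a_{1,\bullet};a_{2,\bullet};a_{3,\bullet};b_{3,\bullet};c_{2,\bullet};c_{3,\bullet}]\cdot\det[b_{1,\bullet};b_{2,\bullet};d_{2,\bullet};d_{3,\bullet};e_{2,\bullet};e_{3,\bullet}]\cdot\det[c_{1,\bullet};d_{1,\bullet};e_{1,\bullet};f_{1,\bullet};f_{2,\bullet};f_{3,\bullet}].$$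 For a monomial $m$ in the variables of one letter $z$ and a polynomial $G$, let $m\lrcorner G$ be the coefficient of $m$ in $G$, where $G$ is viewed as a polynomial in the variables of letter $z$ with coefficients in the ring of the remaining variables; extend $\lrcorner$ linearly in $m$. For $j<k<l$ let $$z_{1j}\wedge z_{2k}\wedge z_{3l}:=\sum_{\sigma}\operatorname{sgn}(\sigma)\,z_{1,\sigma(j)}\,z_{2,\sigma(k)}\,z_{3,\sigma(l)},$$ the sum being over all permutations $\sigma$ of $\{j,k,l\}$. Start with $F=p_Vp_W$, and successively for $z=a,b,c,d,e,f$ replace $F$ by $$\sum_{1\le i\le3,\ 1\le j<k<l\le6}x_{i,j,k,l}\cdot\Big(\big(z_i\cdot(z_{1j}\wedge z_{2k}\wedge z_{3l})\big)\lrcorner F\Big).$$ After all six steps, $F$ is a polynomial in the $x_{i,j,k,l}$ only; this is the polynomial in the claim. *)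

theory Defs
  imports
    "HOL-Analysis.Analysis"
    "HOL-Library.Poly_Mapping"
    "HOL-Algebra.Algebraic_Closure_Type"
begin

unbundle no Formal_Power_Series.fps_syntax

section \<open>Polynomials\<close>

text \<open>
  Polynomials in variables of type \<open>'v\<close> over \<open>'a\<close>. If \<open>'a\<close> is a commutative ring with
  one, so is this type, with the convolution product of \<^theory>\<open>HOL-Library.Poly_Mapping\<close>.
\<close>
type_synonym ('v, 'a) mpoly = "('v \<Rightarrow>\<^sub>0 nat) \<Rightarrow>\<^sub>0 'a"

definition mvar :: "'v \<Rightarrow> ('v, 'a::comm_ring_1) mpoly" where
  "mvar v = Poly_Mapping.single (Poly_Mapping.single v 1) 1"

definition mconst :: "'a::comm_ring_1 \<Rightarrow> ('v, 'a) mpoly" where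
  "mconst c = Poly_Mapping.single 0 c"

definition mdegree :: "('v \<Rightarrow>\<^sub>0 nat) \<Rightarrow> nat" where
  "mdegree m = (\<Sum>v\<in>Poly_Mapping.keys m. Poly_Mapping.lookup m v)"

text \<open>The zero polynomial is homogeneous of every degree.\<close>
definition homogeneous :: "nat \<Rightarrow> ('v, 'a::comm_ring_1) mpoly \<Rightarrow> bool" where
  "homogeneous d G \<longleftrightarrow> (\<forall>m\<in>Poly_Mapping.keys G. mdegree m = d)"

definition meval :: "('v, 'a::comm_ring_1) mpoly \<Rightarrow> ('v \<Rightarrow> 'a) \<Rightarrow> 'a" where
  "meval G p = (\<Sum>m\<in>Poly_Mapping.keys G. Poly_Mapping.lookup G m *
     (\<Prod>v\<in>Poly_Mapping.keys m. p v ^ Poly_Mapping.lookup m v))"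


section \<open>Projective geometry and secant varieties\<close>

text \<open>
  A point of the projective space with homogeneous coordinates indexed by \<open>'n\<close> is a line
  through the origin of \<open>complex ^ 'n\<close>.
\<close>
definition proj_point :: "complex ^ 'n \<Rightarrow> (complex ^ 'n) set" where
  "proj_point p = {c *s p | c. True}"

definition proj_space :: "(complex ^ 'n) set set" where
  "proj_space = {proj_point p | p. p \<noteq> 0}"

definition zero_locus :: "('n, complex) mpoly \<Rightarrow> (complex ^ 'n) set set" where
  "zero_locus G = {proj_point p | p. p \<noteq> 0 \<and> meval G (\<lambda>i. p $ i) = 0}"

definition zariski_closure :: "(complex ^ 'n) set set \<Rightarrow> (complex ^ 'n) set set" where
  "zariski_closure S =
     {L \<in> proj_space. \<forall>d G. homogeneous d G \<and> S \<subseteq> zero_locus G \<longrightarrow> L \<in> zero_locus G}"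

definition vanishing_ideal :: "(complex ^ 'n) set set \<Rightarrow> ('n, complex) mpoly set" where
  "vanishing_ideal S =
     genideal ring_of_type_algebra {G. \<exists>d. homogeneous d G \<and> S \<subseteq> zero_locus G}"

definition hypersurface :: "(complex ^ 'n) set set \<Rightarrow> bool" where
  "hypersurface S \<longleftrightarrow> (\<exists>d G. d > 0 \<and> G \<noteq> 0 \<and> homogeneous d G \<and> S = zero_locus G)"

definition sum_of_points :: "(complex ^ 'n) set set \<Rightarrow> nat \<Rightarrow> complex ^ 'n \<Rightarrow> bool" where
  "sum_of_points Y r p \<longleftrightarrow>
     (\<exists>x. (\<forall>i<r. x i \<noteq> 0 \<and> proj_point (x i) \<in> Y) \<and> p = (\<Sum>i<r. x i))"

definition has_rank :: "(complex ^ 'n) set set \<Rightarrow> nat \<Rightarrow> complex ^ 'n \<Rightarrow> bool" where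
  "has_rank Y r p \<longleftrightarrow> sum_of_points Y r p \<and> (\<forall>s<r. \<not> sum_of_points Y s p)"

definition secant_variety :: "nat \<Rightarrow> (complex ^ 'n) set set \<Rightarrow> (complex ^ 'n) set set" where
  "secant_variety r Y = zariski_closure {proj_point p | p. p \<noteq> 0 \<and> has_rank Y r p}"


section \<open>The Segre-Grassmann variety\<close>

text \<open>
  The quadruple \<open>(i, j, k, l)\<close> stands for the basis vector
  \<open>e\<^sub>i \<otimes> (e\<^sub>j \<and> e\<^sub>k \<and> e\<^sub>l)\<close>, and also for the variable \<open>x\<^sub>i\<^sub>,\<^sub>j\<^sub>,\<^sub>k\<^sub>,\<^sub>l\<close>.
\<close>
typedef coord =
  "{(i, j, k, l). (1::nat) \<le> i \<and> i \<le> 3 \<and> (1::nat) \<le> j \<and> j < k \<and> k < l \<and> l \<le> 6}"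
  by (rule exI[of _ "(1, 1, 2, 3)"]) simp

instance coord :: finite
proof
  have "Rep_coord c \<in> {..3} \<times> {..6} \<times> {..6} \<times> {..6}" for c
    using Rep_coord[of c] by auto
  then have "finite (Rep_coord ` UNIV)"
    by (rule finite_subset[of _ "{..3} \<times> {..6} \<times> {..6} \<times> {..6}", OF image_subsetI]) simp_all
  then show "finite (UNIV :: coord set)"
    by (rule finite_imageD) (simp add: inj_on_def Rep_coord_inject)
qed

text \<open>
  Vectors of \<open>complex ^ 3\<close> and \<open>complex ^ 6\<close> are indexed by the finite types \<open>3\<close> and \<open>6\<close>,
  where \<open>3 = 0\<close> and \<open>6 = 0\<close>; so \<open>of_nat\<close> is a bijection from \<open>{1..3}\<close> and \<open>{1..6}\<close> onto
  the index type, and \<open>vector\<close> places the entries of a list at the indices \<open>1, 2, \<dots>\<close>. The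
  order of indices is only ever taken on natural numbers.

  The coefficient of \<open>w\<^sub>0 \<and> w\<^sub>1 \<and> w\<^sub>2\<close> at \<open>e\<^sub>j \<and> e\<^sub>k \<and> e\<^sub>l\<close> is the minor on columns \<open>j, k, l\<close> of
  the matrix with rows \<open>w\<^sub>0, w\<^sub>1, w\<^sub>2\<close>.
\<close>
definition tensor_wedge ::
  "complex ^ 3 \<Rightarrow> complex ^ 6 \<Rightarrow> complex ^ 6 \<Rightarrow> complex ^ 6 \<Rightarrow> complex ^ coord" where
  "tensor_wedge v w0 w1 w2 = (\<chi> c. case Rep_coord c of (i, j, k, l) \<Rightarrow>
     v $ of_nat i *
     det (vector [vector [w0 $ of_nat j, w0 $ of_nat k, w0 $ of_nat l],
                  vector [w1 $ of_nat j, w1 $ of_nat k, w1 $ of_nat l],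
                  vector [w2 $ of_nat j, w2 $ of_nat k, w2 $ of_nat l]] :: complex ^ 3 ^ 3))"

definition segre_grassmann :: "(complex ^ coord) set set" where
  "segre_grassmann = {proj_point (tensor_wedge v w0 w1 w2) | v w0 w1 w2.
     v \<noteq> 0 \<and> distinct [w0, w1, w2] \<and> vec.independent {w0, w1, w2}}"


section \<open>The polynomial of the pair of fillings\<close>

datatype letter = La | Lb | Lc | Ld | Le | Lf

text \<open>\<open>AuxV z i\<close> is the variable \<open>z\<^sub>i\<close> and \<open>AuxW z r t\<close> is the variable \<open>z\<^sub>r\<^sub>,\<^sub>t\<close>.\<close>
datatype aux = AuxV (letter_of: letter) "3" | AuxW (letter_of: letter) "3" "6"

text \<open>
  The auxiliary variables are adjoined to the ring of polynomials in the \<open>x\<^sub>i\<^sub>,\<^sub>j\<^sub>,\<^sub>k\<^sub>,\<^sub>l\<close>, so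
  the latter are coefficients.
\<close>
type_synonym xpoly = "(coord, complex) mpoly"
type_synonym auxpoly = "(aux, xpoly) mpoly"

definition rowV :: "letter \<Rightarrow> auxpoly ^ 3" where
  "rowV z = (\<chi> i. mvar (AuxV z i))"

definition rowW :: "letter \<Rightarrow> 3 \<Rightarrow> auxpoly ^ 6" where
  "rowW z r = (\<chi> t. mvar (AuxW z r t))"

definition pV :: auxpoly where
  "pV = det (vector [rowV La, rowV Lb, rowV Ld] :: auxpoly ^ 3 ^ 3) *
        det (vector [rowV Lc, rowV Le, rowV Lf] :: auxpoly ^ 3 ^ 3)"

definition pW :: auxpoly where
  "pW =
     det (vector [rowW La 1, rowW La 2, rowW La 3, rowW Lb 3, rowW Lc 2, rowW Lc 3]
       :: auxpoly ^ 6 ^ 6) *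
     det (vector [rowW Lb 1, rowW Lb 2, rowW Ld 2, rowW Ld 3, rowW Le 2, rowW Le 3]
       :: auxpoly ^ 6 ^ 6) *
     det (vector [rowW Lc 1, rowW Ld 1, rowW Le 1, rowW Lf 1, rowW Lf 2, rowW Lf 3]
       :: auxpoly ^ 6 ^ 6)"

text \<open>
  For a monomial \<open>m\<close> in the variables of letter \<open>z\<close>, the coefficient of \<open>m\<close> in \<open>G\<close> collects
  the terms of \<open>G\<close> whose part in the variables of \<open>z\<close> is exactly \<open>m\<close>, with \<open>m\<close> removed.
\<close>
definition letter_coeff :: "letter \<Rightarrow> (aux \<Rightarrow>\<^sub>0 nat) \<Rightarrow> auxpoly \<Rightarrow> auxpoly" where
  "letter_coeff z m G =
     (\<Sum>n \<in> {n \<in> Poly_Mapping.keys G.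
             \<forall>v. letter_of v = z \<longrightarrow> Poly_Mapping.lookup n v = Poly_Mapping.lookup m v}.
        Poly_Mapping.single (n - m) (Poly_Mapping.lookup G n))"

text \<open>Linear extension to polynomials \<open>M\<close> in the variables of letter \<open>z\<close>.\<close>
definition contract :: "letter \<Rightarrow> auxpoly \<Rightarrow> auxpoly \<Rightarrow> auxpoly" where
  "contract z M G =
     (\<Sum>m\<in>Poly_Mapping.keys M. mconst (Poly_Mapping.lookup M m) * letter_coeff z m G)"

definition wedge_var :: "letter \<Rightarrow> nat \<Rightarrow> nat \<Rightarrow> nat \<Rightarrow> auxpoly" where
  "wedge_var z j k l = (\<Sum>\<sigma> | \<sigma> permutes {j, k, l}. of_int (sign \<sigma>) *
     mvar (AuxW z 1 (of_nat (\<sigma> j))) * mvar (AuxW z 2 (of_nat (\<sigma> k))) *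
     mvar (AuxW z 3 (of_nat (\<sigma> l))))"

definition contraction_step :: "letter \<Rightarrow> auxpoly \<Rightarrow> auxpoly" where
  "contraction_step z G = (\<Sum>c\<in>UNIV. case Rep_coord c of (i, j, k, l) \<Rightarrow>
     mconst (mvar c) * contract z (mvar (AuxV z (of_nat i)) * wedge_var z j k l) G)"

definition contracted :: auxpoly where
  "contracted = fold contraction_step [La, Lb, Lc, Ld, Le, Lf] (pV * pW)"

text \<open>
  \<open>contracted\<close> is constant in the auxiliary variables (see \<open>contracted_eq\<close> below); \<open>FF\<close> is
  this constant.
\<close>
definition FF :: xpoly where
  "FF = Poly_Mapping.lookup contracted 0"

lemma contracted_eq: "contracted = mconst FF"
proof -
  define free :: "letter \<Rightarrow> auxpoly \<Rightarrow> bool" where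
    "free y G \<longleftrightarrow> (\<forall>m\<in>Poly_Mapping.keys G. \<forall>v\<in>Poly_Mapping.keys m. letter_of v \<noteq> y)" for y G
  have free_sum: "free y (\<Sum>i\<in>A. f i)" if "\<And>i. i \<in> A \<Longrightarrow> free y (f i)"
    for y A and f :: "'i \<Rightarrow> auxpoly"
    using that Poly_Mapping.keys_sum[of f A] unfolding free_def by blast
  have free_scale: "free y (mconst a * G)" if "free y G" for y a G
    using that Poly_Mapping.keys_mult[of "mconst a" G]
    by (fastforce simp: free_def mconst_def split: if_splits)
  have free_coeff: "free y (letter_coeff z m G)" if "y = z \<or> free y G" for y z m G
    unfolding letter_coeff_def
  proof (rule free_sum)
    fix n assume "n \<in> {n \<in> Poly_Mapping.keys G.
      \<forall>v. letter_of v = z \<longrightarrow> Poly_Mapping.lookup n v = Poly_Mapping.lookup m v}"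
    then show "free y (Poly_Mapping.single (n - m) (Poly_Mapping.lookup G n))"
      using that unfolding free_def
      by (fastforce simp: in_keys_iff lookup_minus)
  qed
  have free_step: "free y (contraction_step z G)" if "y = z \<or> free y G" for y z G
    unfolding contraction_step_def contract_def
    by (rule free_sum, simp only: split_beta)
      (intro free_scale free_sum free_coeff that)
  have free_all: "free y contracted" for y
    by (cases y) (simp_all add: contracted_def free_step)
  have const: "Poly_Mapping.lookup contracted m = 0" if "m \<noteq> 0" for m
  proof (rule ccontr)
    assume "Poly_Mapping.lookup contracted m \<noteq> 0"
    then have "m \<in> Poly_Mapping.keys contracted"
      by (simp add: in_keys_iff)
    then have "Poly_Mapping.keys m = {}"
      using free_all unfolding free_def by blast
    with that show False
      by simp
  qed
  show ?thesis
    unfolding mconst_def FF_def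
  proof (rule poly_mapping_eqI)
    fix m
    show "Poly_Mapping.lookup contracted m =
      Poly_Mapping.lookup (Poly_Mapping.single 0 (Poly_Mapping.lookup contracted 0)) m"
      using const[of m] by (cases "m = 0") (simp_all add: lookup_single)
  qed
qed

end

theory Submission
  imports Defs
begin

text \<open>
  Call a tensor decomposable if it is of the form \<open>tw (v, a, b, c)\<close>, the tensor product of \<open>v\<close>
  with the wedge product of \<open>a\<close>, \<open>b\<close>, \<open>c\<close>. The cone over the secant variety is the closure of
  the set of sums of five decomposable tensors.

  The polynomial vanishes on these sums. It is a sum of products of determinants, hence a relative
  invariant of pairs of invertible matrices (\<open>meval_FF_transform\<close>). Its degree in the first
  coordinate is at most one (\<open>degree_first_coord\<close>): the torus weight leaves only finitely many
  monomials divisible by the square of that coordinate, and their coefficients are computed to be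
  zero. As the invertible matrices act transitively on the nonzero decomposable tensors, the
  polynomial is affine along every decomposable direction (\<open>FF_affine_along_points\<close>). So its
  restriction to the multiples of a sum of \<open>n\<close> decomposable tensors has degree at most \<open>n\<close>; being
  homogeneous of degree six, it is zero for \<open>n \<le> 5\<close> (\<open>FF_vanishes\<close>).

  That it generates the ideal also rests on linearity in the first coordinate \<open>x\<close>. Write
  \<open>FF = x * slope + rest\<close>. The sums of five decomposable tensors, projected along the \<open>x\<close>-axis,
  satisfy no polynomial equation: their tangent spaces at suitable points span the quotient by that
  axis, so the projections contain an open set (\<open>sums_of_points_dominant\<close>). Hence a polynomial
  that vanishes on the sums is divisible by \<open>FF\<close> after multiplication by a power of \<open>slope\<close>. The
  power can be cancelled because \<open>FF\<close> and \<open>slope\<close> form a regular pair: for a suitable weight their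
  leading monomials have no variable in common (\<open>regular_slope\<close>). The same argument shows that
  \<open>FF\<close> is prime; both are carried out in the locale \<open>affine_equation\<close>.

  The secant variety is defined through tensors of rank exactly five. Sums of five decomposable
  tensors of smaller rank are sums of at most four, where \<open>slope\<close> vanishes, so that they add no
  condition (\<open>vanishes_on_rank_five_iff\<close>).
\<close>

abbreviation (input) lookup :: "('k \<Rightarrow>\<^sub>0 'b::zero) \<Rightarrow> 'k \<Rightarrow> 'b" where
  "lookup \<equiv> Poly_Mapping.lookup"

abbreviation (input) keys :: "('k \<Rightarrow>\<^sub>0 'b::zero) \<Rightarrow> 'k set" where
  "keys \<equiv> Poly_Mapping.keys"

abbreviation (input) single :: "'k \<Rightarrow> 'b \<Rightarrow> ('k \<Rightarrow>\<^sub>0 'b::zero)" where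
  "single \<equiv> Poly_Mapping.single"

section \<open>Evaluation of polynomials\<close>
definition monval :: "('v \<Rightarrow> 'b::comm_ring_1) \<Rightarrow> ('v \<Rightarrow>\<^sub>0 nat) \<Rightarrow> 'b" where
  "monval p m = (\<Prod>v\<in>keys m. p v ^ lookup m v)"

lemma monval_superset:
  assumes "finite V" "keys m \<subseteq> V"
  shows "monval p m = (\<Prod>v\<in>V. p v ^ lookup m v)"
  unfolding monval_def
  by (rule prod.mono_neutral_left) (use assms in \<open>auto simp: in_keys_iff\<close>)

lemma monval_add: "monval p (m + n) = monval p m * monval p n"
proof -
  let ?V = "keys m \<union> keys n"
  have "keys (m + n) \<subseteq> ?V"
    by (rule Poly_Mapping.keys_add)
  then show ?thesis
    by (subst (1 2 3) monval_superset[where V = ?V])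
       (auto simp: lookup_add power_add prod.distrib)
qed

lemma monval_0 [simp]: "monval p 0 = 1"
  by (simp add: monval_def)

lemma monval_single [simp]: "monval p (single v k) = p v ^ k"
  by (simp add: monval_def)

lemma mpoly_sum_monomials:
  "(\<Sum>m\<in>keys G. single m (lookup G m)) = G"
  by (rule poly_mapping_eqI)
     (simp add: lookup_sum lookup_single when_def in_keys_iff sum.delta)

text \<open>
  Polynomials whose coefficients are polynomials occur below, so evaluation also transports the
  coefficients along a ring homomorphism \<open>f\<close>.
\<close>
definition peval :: "('a::comm_ring_1 \<Rightarrow> 'b::comm_ring_1) \<Rightarrow> ('v \<Rightarrow> 'b) \<Rightarrow> ('v, 'a) mpoly \<Rightarrow> 'b" where
  "peval f p G = (\<Sum>m\<in>keys G. f (lookup G m) * monval p m)"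

lemma meval_peval: "meval G p = peval id p G"
  by (simp add: meval_def peval_def monval_def)

locale coeff_hom =
  fixes f :: "'a::comm_ring_1 \<Rightarrow> 'b::comm_ring_1"
  assumes f_add: "f (a + b) = f a + f b" and f_mult: "f (a * b) = f a * f b" and f_1: "f 1 = 1"
begin

lemma f_0 [simp]: "f 0 = 0"
  using f_add[of 0 0] by simp

lemma peval_superset:
  assumes "finite K" "keys G \<subseteq> K"
  shows "peval f p G = (\<Sum>m\<in>K. f (lookup G m) * monval p m)"
  unfolding peval_def
  by (rule sum.mono_neutral_left) (use assms in \<open>auto simp: in_keys_iff\<close>)

lemma peval_0 [simp]: "peval f p 0 = 0"
  by (simp add: peval_def)

lemma peval_single: "peval f p (single m a) = f a * monval p m"
  by (simp add: peval_def)

lemma peval_add: "peval f p (G + H) = peval f p G + peval f p H"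
proof -
  let ?K = "keys G \<union> keys H"
  have "keys (G + H) \<subseteq> ?K"
    by (rule Poly_Mapping.keys_add)
  then show ?thesis
    by (subst (1 2 3) peval_superset[where K = ?K])
       (auto simp: lookup_add f_add algebra_simps sum.distrib)
qed

lemma peval_sum: "peval f p (sum G A) = (\<Sum>i\<in>A. peval f p (G i))"
  by (induction A rule: infinite_finite_induct) (simp_all add: peval_add)

lemma peval_mult: "peval f p (G * H) = peval f p G * peval f p H"
proof -
  let ?s = "\<lambda>G m. single m (lookup G m)"
  have G: "G = (\<Sum>m\<in>keys G. ?s G m)" and H: "H = (\<Sum>m\<in>keys H. ?s H m)"
    by (simp_all add: mpoly_sum_monomials)
  have "peval f p (G * H) = (\<Sum>m\<in>keys G. \<Sum>n\<in>keys H.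
     peval f p (?s G m * ?s H n))"
    by (subst G, subst H) (simp add: sum_product peval_sum)
  also have "\<dots> = peval f p G * peval f p H"
    unfolding peval_def[of f p G] peval_def[of f p H] sum_product
    by (simp add: mult_single peval_single f_mult monval_add mult_ac)
  finally show ?thesis .
qed

lemma peval_1 [simp]: "peval f p 1 = 1"
  using peval_single[of p 0 1] by (simp add: f_1)

lemma peval_mconst [simp]: "peval f p (mconst a) = f a"
  by (simp add: mconst_def peval_single)

lemma peval_mvar [simp]: "peval f p (mvar v) = p v"
  by (simp add: mvar_def peval_single f_1)

lemma peval_uminus: "peval f p (- G) = - peval f p G"
  using peval_add[of p G "- G"] by (simp add: eq_neg_iff_add_eq_0 add.commute)

lemma peval_of_int [simp]: "peval f p (of_int k) = of_int k"
proof (cases k rule: int_cases2)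
  case (nonneg n)
  have "peval f p (of_nat n) = of_nat n" by (induction n) (simp_all add: peval_add)
  then show ?thesis using nonneg by simp
next
  case (nonpos n)
  have "peval f p (of_nat n) = of_nat n" by (induction n) (simp_all add: peval_add)
  then show ?thesis using nonpos by (simp add: peval_uminus)
qed

lemma peval_prod: "peval f p (prod G A) = (\<Prod>i\<in>A. peval f p (G i))"
  by (induction A rule: infinite_finite_induct) (simp_all add: peval_mult)

end

interpretation id_hom: coeff_hom id
  by standard simp_all

lemma meval_0 [simp]: "meval 0 p = 0"
  and meval_1 [simp]: "meval 1 p = 1"
  and meval_mconst [simp]: "meval (mconst a) p = a"
  and meval_mvar [simp]: "meval (mvar v) p = p v"
  and meval_add: "meval (G + H) p = meval G p + meval H p"
  and meval_uminus: "meval (- G) p = - meval G p"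
  and meval_mult: "meval (G * H) p = meval G p * meval H p"
  and meval_sum: "meval (sum K A) p = (\<Sum>i\<in>A. meval (K i) p)"
  and meval_prod: "meval (prod K A) p = (\<Prod>i\<in>A. meval (K i) p)"
  by (simp_all add: meval_peval id_hom.peval_add id_hom.peval_uminus id_hom.peval_mult
      id_hom.peval_sum id_hom.peval_prod)

lemma meval_diff: "meval (G - H) p = meval G p - meval H p"
  using meval_add[of G "- H" p] by (simp add: meval_uminus)

lemma meval_monval: "meval G p = (\<Sum>m\<in>keys G. lookup G m * monval p m)"
  by (simp add: meval_peval peval_def)

lemma mpoly_induct [case_names const var add mult]:
  fixes G :: "('v, 'a::comm_ring_1) mpoly"
  assumes c: "\<And>a. P (mconst a)" and v: "\<And>x. P (mvar x)"
    and a: "\<And>G H. P G \<Longrightarrow> P H \<Longrightarrow> P (G + H)" and m: "\<And>G H. P G \<Longrightarrow> P H \<Longrightarrow> P (G * H)"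
  shows "P G"
proof -
  have one: "P 1" using c[of 1] by (simp add: mconst_def)
  have zero: "P 0" using c[of 0] by (simp add: mconst_def)
  have pw: "P (mvar x ^ k)" for x k
    by (induction k) (auto intro: one v m)
  have pwk: "single (single x k) (1::'a) = mvar x ^ k" for x :: 'v and k
  proof (induction k)
    case (Suc k)
    have "mvar x * single (single x k) (1::'a) = single (single x (Suc k)) 1"
      by (simp add: mvar_def mult_single flip: single_add)
    then show ?case using Suc by simp
  qed simp
  have mon: "P (single m (1::'a))" for m :: "'v \<Rightarrow>\<^sub>0 nat"
  proof (induction m rule: update_induct)
    case const
    then show ?case using one by simp
  next
    case (update f x k)
    have "Poly_Mapping.update x k f = f + single x k"
      by (rule poly_mapping_eqI) (use update in \<open>auto simp: lookup_update lookup_add lookup_single in_keys_iff when_def\<close>)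
    then have "single (Poly_Mapping.update x k f) (1::'a) =
      single f 1 * mvar x ^ k"
      by (simp add: mult_single flip: pwk)
    then show ?case using update pw m by simp
  qed
  have "P (\<Sum>m\<in>K. single m (lookup G m))" if "finite K" for K
    using that
  proof (induction K rule: finite_induct)
    case empty
    then show ?case using zero by simp
  next
    case (insert x F)
    have "single x (lookup G x) = mconst (lookup G x) * single x 1"
      by (simp add: mconst_def mult_single)
    then show ?case using insert a c m mon by simp
  qed
  from this[OF finite_keys[of G]] show ?thesis by (simp add: mpoly_sum_monomials)
qed

text \<open>
  Restriction to a polynomially parametrised curve turns questions in several variables into
  questions about univariate polynomials.
\<close>
lemma meval_along_curve:
  fixes G :: "('v, complex) mpoly"
  shows "\<exists>h. \<forall>t. meval G (\<lambda>v. poly (q v) t) = poly h t"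
proof (induction G rule: mpoly_induct)
  case (const a)
  then show ?case by (intro exI[of _ "[:a:]"]) simp
next
  case (var x)
  then show ?case by (intro exI[of _ "q x"]) simp
next
  case (add G H)
  then obtain g h where "\<forall>t. meval G (\<lambda>v. poly (q v) t) = poly g t" "\<forall>t. meval H (\<lambda>v. poly (q v) t) = poly h t"
    by blast
  then show ?case by (intro exI[of _ "g + h"]) (simp add: meval_add)
next
  case (mult G H)
  then obtain g h where "\<forall>t. meval G (\<lambda>v. poly (q v) t) = poly g t" "\<forall>t. meval H (\<lambda>v. poly (q v) t) = poly h t"
    by blast
  then show ?case by (intro exI[of _ "g * h"]) (simp add: meval_mult)
qed

text \<open>
  Weights \<open>t ^ idx v\<close> separate finitely many monomials as soon as \<open>t\<close>
  avoids the roots of the finitely many nonzero univariate polynomials given by differences of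
  exponent vectors.
\<close>
lemma separating_weights:
  fixes K :: "('v::finite \<Rightarrow>\<^sub>0 nat) set"
  assumes "finite K"
  shows "\<exists>w::'v \<Rightarrow> nat. inj_on (\<lambda>m. \<Sum>v\<in>UNIV. w v * lookup m v) K"
proof -
  obtain idx :: "'v \<Rightarrow> nat" where idx: "inj idx"
    using finite_imp_inj_to_nat_seg[of "UNIV :: 'v set"] by auto
  define d :: "('v \<Rightarrow>\<^sub>0 nat) \<times> ('v \<Rightarrow>\<^sub>0 nat) \<Rightarrow> real poly" where
    "d = (\<lambda>(m, n). \<Sum>v\<in>UNIV. Polynomial.monom (real (lookup m v) - real (lookup n v)) (idx v))"
  have d0: "d (m, n) \<noteq> 0" if mn: "m \<noteq> n" for m n
  proof -
    obtain v where v: "lookup m v \<noteq> lookup n v"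
      proof (rule ccontr)
      assume "\<not> thesis"
      then have "m = n" using that by (intro poly_mapping_eqI) blast
      then show False using \<open>m \<noteq> n\<close> by simp
    qed
    have "Polynomial.coeff (d (m, n)) (idx v) =
        (\<Sum>u\<in>UNIV. if u = v then real (lookup m v) - real (lookup n v) else 0)"
      unfolding d_def prod.case Polynomial.coeff_sum
      by (intro sum.cong refl) (use idx in \<open>auto simp: Polynomial.coeff_monom inj_eq\<close>)
    also have "\<dots> = real (lookup m v) - real (lookup n v)"
      by simp
    finally have "Polynomial.coeff (d (m, n)) (idx v) = real (lookup m v) - real (lookup n v)" .
    then show ?thesis using v by auto
  qed
  define R where "R = (\<Union>x\<in>{x \<in> K \<times> K. fst x \<noteq> snd x}. {t. poly (d x) t = 0})"
  have "finite R"
    unfolding R_def by (rule finite_UN_I) (use assms d0 in \<open>auto simp: poly_roots_finite\<close>)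
  then have "finite {t::nat. real t \<in> R}"
    using finite_vimageI[of R real] by (simp add: vimage_def inj_def)
  then obtain t :: nat where t: "real t \<notin> R"
    using ex_new_if_finite[OF infinite_UNIV_nat] by blast
  have "inj_on (\<lambda>m. \<Sum>v\<in>UNIV. t ^ idx v * lookup m v) K"
  proof (rule inj_onI, rule ccontr)
    fix m n assume mn: "m \<in> K" "n \<in> K" "m \<noteq> n"
      and eq: "(\<Sum>v\<in>UNIV. t ^ idx v * lookup m v) = (\<Sum>v\<in>UNIV. t ^ idx v * lookup n v)"
    have "poly (d (m, n)) (real t) = real (\<Sum>v\<in>UNIV. t ^ idx v * lookup m v) -
        real (\<Sum>v\<in>UNIV. t ^ idx v * lookup n v)"
      by (simp add: d_def poly_sum poly_monom algebra_simps flip: sum_subtractf)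
    then show False using t mn eq by (auto simp: R_def)
  qed
  then show ?thesis by (rule exI[where x = "\<lambda>v. t ^ idx v"])
qed

text \<open>
  Along the curve \<open>t \<mapsto> (t ^ w v)\<close> with separating weights \<open>w\<close>,
  distinct monomials become distinct powers of \<open>t\<close>, so no cancellation can occur.
\<close>
lemma meval_inject_0:
  fixes G :: "('v::finite, complex) mpoly"
  assumes "\<And>p. meval G p = 0"
  shows "G = 0"
proof (rule ccontr)
  assume "G \<noteq> 0"
  then obtain m0 where m0: "m0 \<in> keys G"
    by (metis all_not_in_conv keys_eq_empty)
  obtain w :: "'v \<Rightarrow> nat" where
    w: "inj_on (\<lambda>m. \<Sum>v\<in>UNIV. w v * lookup m v) (keys G)"
    using separating_weights[OF finite_keys] by blast
  define wt where "wt = (\<lambda>m. \<Sum>v\<in>UNIV. w v * lookup m v)"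
  define h where "h = (\<Sum>m\<in>keys G. Polynomial.monom (lookup G m) (wt m))"
  have "poly h t = meval G (\<lambda>v. t ^ w v)" for t
    unfolding h_def wt_def meval_monval poly_sum
    by (intro sum.cong refl)
       (simp add: poly_monom monval_superset[of UNIV] power_sum power_mult)
  then have "h = 0" using assms poly_all_0_iff_0 by metis
  moreover have "Polynomial.coeff h (wt m0) = (\<Sum>m\<in>keys G. if m = m0 then lookup G m else 0)"
    unfolding h_def Polynomial.coeff_sum
    by (intro sum.cong refl) (use w m0 in \<open>auto simp: Polynomial.coeff_monom wt_def inj_on_def\<close>)
  ultimately show False using m0 by (simp add: in_keys_iff)
qed

lemma meval_inject:
  fixes G H :: "('v::finite, complex) mpoly"
  assumes "\<And>p. meval G p = meval H p"
  shows "G = H"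
  using meval_inject_0[of "G - H"] assms by (simp add: meval_diff)

lemma meval_line:
  fixes G :: "('v, complex) mpoly"
  shows "\<exists>h. \<forall>t. meval G (\<lambda>v. p v + t * u v) = poly h t"
  using meval_along_curve[of G "\<lambda>v. [:p v, u v:]"] by (simp add: mult.commute)

text \<open>
  On each line through a point where \<open>A\<close> does not vanish, the restrictions of
  \<open>A\<close> and \<open>B\<close> are univariate with product zero.
\<close>
lemma mpoly_no_zero_divisors:
  fixes A B :: "('v::finite, complex) mpoly"
  assumes "A * B = 0" "A \<noteq> 0"
  shows "B = 0"
proof (rule meval_inject_0)
  fix q
  obtain p where p: "meval A p \<noteq> 0" using assms meval_inject_0 by blast
  obtain a where a: "\<And>t. meval A (\<lambda>v. p v + t * (q v - p v)) = poly a t" using meval_line[of A p "\<lambda>v. q v - p v"] by auto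
  obtain b where b: "\<And>t. meval B (\<lambda>v. p v + t * (q v - p v)) = poly b t" using meval_line[of B p "\<lambda>v. q v - p v"] by auto
  have "poly (a * b) t = 0" for t
    using assms(1) by (simp flip: a b meval_mult)
  then have "a * b = 0" using poly_all_0_iff_0 by blast
  moreover have "a \<noteq> 0" using a[of 0] p by auto
  ultimately have "b = 0" by simp
  then show "meval B q = 0" using b[of 1] by simp
qed

lemma mpoly_mult_cancel:
  fixes A B C :: "('v::finite, complex) mpoly"
  assumes "A * B = A * C" "A \<noteq> 0"
  shows "B = C"
  using mpoly_no_zero_divisors[of A "B - C"] assms by (simp add: right_diff_distrib)

text \<open>
  The line that joins an arbitrary point to a point of the open set meets the set in infinitely
  many points.
\<close>
lemma meval_open_0:
  fixes G :: "('v::finite, complex) mpoly" and S :: "(complex ^ 'v) set"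
  assumes "open S" "S \<noteq> {}" "\<And>x. x \<in> S \<Longrightarrow> meval G (\<lambda>v. x $ v) = 0"
  shows "G = 0"
proof (rule meval_inject_0)
  fix q
  obtain p where p: "p \<in> S" using assms by blast
  define u where "u = (\<chi> v. q v) - p"
  obtain h where h: "\<And>t. meval G (\<lambda>v. p $ v + t * u $ v) = poly h t" using meval_line[of G "\<lambda>v. p $ v" "\<lambda>v. u $ v"] by auto
  have "continuous_on UNIV (\<lambda>t::real. p + t *\<^sub>R u)"
    by (intro continuous_intros)
  then have "open ((\<lambda>t::real. p + t *\<^sub>R u) -` S)"
    using assms(1) by (simp add: open_vimage)
  moreover have "0 \<in> (\<lambda>t::real. p + t *\<^sub>R u) -` S" using p by simp
  ultimately obtain e where e: "e > 0" "ball 0 e \<subseteq> (\<lambda>t::real. p + t *\<^sub>R u) -` S"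
    using open_contains_ball by blast
  have z: "poly h (complex_of_real t) = 0" if "t \<in> ball 0 e" for t
  proof -
    have "p + t *\<^sub>R u \<in> S" using e that by blast
    moreover have "(p + t *\<^sub>R u) $ v = p $ v + complex_of_real t * u $ v" for v
      by (simp add: scaleR_conv_of_real[of t "u $ v"])
    ultimately show ?thesis using assms(3)[of "p + t *\<^sub>R u"] by (simp flip: h)
  qed
  have "{0<..<e} \<subseteq> ball (0::real) e" by auto
  then have "infinite (ball (0::real) e)" by (rule infinite_super[OF _ infinite_Ioo[OF e(1)]])
  then have "infinite (complex_of_real ` ball 0 e)"
    by (simp add: finite_image_iff inj_on_def)
  moreover have "complex_of_real ` ball 0 e \<subseteq> {t. poly h t = 0}" using z by blast
  ultimately have "infinite {t. poly h t = 0}" by (rule infinite_super[rotated])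
  then have "h = 0" using poly_roots_finite by blast
  then show "meval G q = 0" using h[of 1] by (simp add: u_def)
qed

section \<open>Regular pairs from coprime leading monomials\<close>
lemma lookup_mult_keys:
  "lookup (A * R) k =
     (\<Sum>i\<in>keys A. \<Sum>j\<in>keys R.
        (lookup A i * lookup R j when i + j = k))"
proof -
  have "A * R = (\<Sum>i\<in>keys A. \<Sum>j\<in>keys R.
      single (i + j) (lookup A i * lookup R j))"
    by (subst (1) mpoly_sum_monomials[of A, symmetric], subst (1) mpoly_sum_monomials[of R, symmetric])
       (simp add: sum_product mult_single)
  then show ?thesis by (simp add: lookup_sum lookup_single)
qed

text \<open>
  Only one pair of monomials contributes: in any other pair with the same product, one factor
  would be too heavy.
\<close>
lemma lookup_mult_leading:
  fixes wt :: "('v \<Rightarrow>\<^sub>0 nat) \<Rightarrow> nat"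
  assumes wt_add: "\<And>m n. wt (m + n) = wt m + wt n"
    and A: "\<And>m. m \<in> keys A \<Longrightarrow> m \<noteq> a \<Longrightarrow> wt m < wt a"
    and R: "\<And>m. m \<in> keys R \<Longrightarrow> wt m \<le> wt r"
  shows "lookup (A * R) (a + r) = lookup A a * lookup R r"
proof -
  have *: "(lookup A i * lookup R j when i + j = a + r) =
      (if j = r then if i = a then lookup A a * lookup R r else 0 else 0)"
    if "i \<in> keys A" "j \<in> keys R" for i j
  proof (cases "i + j = a + r")
    case True
    have "wt i + wt j = wt a + wt r" using True wt_add by metis
    moreover have "wt i \<le> wt a" using A that by (cases "i = a") (auto simp: less_imp_le)
    moreover have "wt j \<le> wt r" using R that by blast
    ultimately have "i = a" using A[of i] that by fastforce
    then show ?thesis using True by simp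
  next
    case False
    then show ?thesis by auto
  qed
  have "lookup (A * R) (a + r) = (\<Sum>i\<in>keys A. \<Sum>j\<in>keys R.
     (if j = r then if i = a then lookup A a * lookup R r else 0 else 0))"
    unfolding lookup_mult_keys by (intro sum.cong refl *)
  also have "\<dots> = lookup A a * lookup R r"
    by (cases "lookup R r = 0"; cases "lookup A a = 0") (simp_all add: in_keys_iff)
  finally show ?thesis .
qed

text \<open>
  Induction on the weight of \<open>R\<close>. A heaviest monomial \<open>r\<close> of
  \<open>R\<close> gives the monomial \<open>a + r\<close> of \<open>B * S\<close>, which is too
  heavy to come from a term of \<open>B\<close> other than \<open>b\<close>; so \<open>b\<close>
  divides \<open>a + r\<close>, hence \<open>r\<close>, as \<open>a\<close> and \<open>b\<close>
  have no variable in common. Subtracting the corresponding multiple of \<open>B\<close> from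
  \<open>R\<close> removes its heaviest terms.
\<close>
lemma leading_monomials_coprime_imp_regular:
  fixes A B R S :: "('v, complex) mpoly" and wt :: "('v \<Rightarrow>\<^sub>0 nat) \<Rightarrow> nat"
  assumes wt_add: "\<And>m n. wt (m + n) = wt m + wt n"
    and a: "a \<in> keys A" "\<And>m. m \<in> keys A \<Longrightarrow> m \<noteq> a \<Longrightarrow> wt m < wt a"
    and b: "b \<in> keys B" "\<And>m. m \<in> keys B \<Longrightarrow> m \<noteq> b \<Longrightarrow> wt m < wt b"
    and ab: "\<And>v. lookup a v = 0 \<or> lookup b v = 0"
    and eq: "A * R = B * S"
  shows "\<exists>T. R = B * T"
proof -
  have "\<exists>T. R = B * T" if "A * R = B * S" "\<And>m. m \<in> keys R \<Longrightarrow> wt m < n" for n R S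
    using that
  proof (induction n arbitrary: R S)
    case 0
    then have "keys R = {}" by blast
    then show ?case by (intro exI[of _ 0]) simp
  next
    case (Suc n)
    have Rn: "wt m \<le> n" if "m \<in> keys R" for m using Suc.prems(2)[OF that] by simp
    have Am: "wt m \<le> wt a" if "m \<in> keys A" for m using a(2)[OF that] by (cases "m = a") auto
    have Bm: "wt m \<le> wt b" if "m \<in> keys B" for m using b(2)[OF that] by (cases "m = b") auto
    have Sn: "wt b + wt s \<le> wt a + n" if s: "s \<in> keys S" for s
    proof -
      have "Max (wt ` keys S) \<in> wt ` keys S"
        using s by (intro Max_in) auto
      then obtain s0 where s0: "s0 \<in> keys S" "\<And>m. m \<in> keys S \<Longrightarrow> wt m \<le> wt s0"
        by (metis Max_ge finite_imageI finite_keys imageE imageI)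
      have "lookup (B * S) (b + s0) \<noteq> 0"
        using lookup_mult_leading[of wt B b S s0, OF wt_add b(2) s0(2)] b(1) s0(1)
        by (simp add: in_keys_iff)
      then have "b + s0 \<in> keys (A * R)"
        by (simp add: in_keys_iff Suc.prems(1))
      then obtain i j where "b + s0 = i + j" "i \<in> keys A" "j \<in> keys R"
        using Poly_Mapping.keys_mult[of A R] by auto
      then have "wt b + wt s0 \<le> wt a + n"
        using Am Rn wt_add by (metis add_mono)
      then show ?thesis using s0(2)[OF s] by simp
    qed
    have div: "\<exists>q. r = b + q" if r: "r \<in> keys R" "wt r = n" for r
    proof -
      have "lookup (A * R) (a + r) \<noteq> 0"
        using lookup_mult_leading[of wt A a R r, OF wt_add a(2)] Rn a(1) r
        by (simp add: in_keys_iff)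
      then have "a + r \<in> keys (B * S)"
        by (simp add: in_keys_iff Suc.prems(1))
      then obtain i s where bs: "a + r = i + s" "i \<in> keys B" "s \<in> keys S"
        using Poly_Mapping.keys_mult[of B S] by auto
      have "wt a + n = wt i + wt s" using bs(1) wt_add r(2) by metis
      then have "i = b" using Sn[OF bs(3)] b(2)[OF bs(2)] by fastforce
      with bs have e: "a + r = b + s" by simp
      have "lookup b v \<le> lookup r v" for v
        using ab[of v] arg_cong[OF e, of "\<lambda>m. lookup m v"] by (auto simp: lookup_add)
      then have "r = b + (r - b)" by (intro poly_mapping_eqI) (simp add: lookup_add lookup_minus)
      then show ?thesis by blast
    qed
    define N where "N = {r \<in> keys R. wt r = n}"
    have finN: "finite N" by (simp add: N_def)
    define T0 where "T0 = (\<Sum>r\<in>N. single (r - b) (lookup R r / lookup B b))"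
    have bN: "b + (r - b) = r" if "r \<in> N" for r
      using div[of r] that by (auto simp: N_def)
    have T0_lookup: "lookup T0 q = (if b + q \<in> N then lookup R (b + q) / lookup B b else 0)" for q
    proof -
      have "lookup T0 q = (\<Sum>r\<in>N. if r = b + q then lookup R (b + q) / lookup B b else 0)"
        unfolding T0_def lookup_sum
      proof (intro sum.cong refl)
        fix r assume "r \<in> N"
        then have "r - b = q \<longleftrightarrow> r = b + q" using bN by (metis add_diff_cancel_left')
        then show "lookup (single (r - b) (lookup R r / lookup B b)) q =
          (if r = b + q then lookup R (b + q) / lookup B b else 0)"
          by (auto simp: lookup_single when_def)
      qed
      then show ?thesis using finN by simp
    qed
    have T0_keys: "b + q \<in> N" if "q \<in> keys T0" for q
      using that by (auto simp: in_keys_iff T0_lookup split: if_splits)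
    define R' where "R' = R - B * T0"
    have "A * R' = B * (S - A * T0)"
      by (simp add: R'_def algebra_simps Suc.prems(1))
    moreover have "wt k < n" if k: "k \<in> keys R'" for k
    proof (rule ccontr)
      assume "\<not> wt k < n"
      then have kn: "wt k \<ge> n" by simp
      have BT: "\<exists>q. k = b + q \<and> q \<in> keys T0 \<and> wt k = n" if "k \<in> keys (B * T0)"
      proof -
        obtain i q where iq: "k = i + q" "i \<in> keys B" "q \<in> keys T0"
          using Poly_Mapping.keys_mult[of B T0] \<open>k \<in> keys (B * T0)\<close> by auto
        have q: "wt b + wt q = n" using T0_keys[OF iq(3)] wt_add by (simp add: N_def)
        have "wt k = wt i + wt q" using iq(1) wt_add by simp
        then have "i = b" using kn q b(2)[OF iq(2)] by fastforce
        then show ?thesis using iq q wt_add by auto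
      qed
      have "lookup R' k = 0"
      proof (cases "\<exists>q. k = b + q \<and> wt k = n")
        case True
        then obtain q where q: "k = b + q" "wt k = n" by blast
        have "lookup (B * T0) (b + q) = lookup B b * lookup T0 q"
        proof (rule lookup_mult_leading[of wt, OF wt_add b(2)])
          fix m assume "m \<in> keys T0"
          then have "wt b + wt m = n" using T0_keys wt_add by (simp add: N_def)
          moreover have "wt b + wt q = n" using q wt_add by simp
          ultimately show "wt m \<le> wt q" by simp
        qed
        moreover have "lookup B b \<noteq> 0" using b(1) by (simp add: in_keys_iff)
        moreover have "lookup R (b + q) = 0" if "b + q \<notin> N"
          using that q by (auto simp: N_def in_keys_iff)
        ultimately show ?thesis using q by (auto simp: R'_def lookup_minus T0_lookup)
      next
        case False
        then have "k \<notin> keys (B * T0)" using BT by blast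
        moreover have "k \<notin> keys R"
          using False div[of k] Rn[of k] kn by fastforce
        ultimately show ?thesis by (simp add: R'_def lookup_minus in_keys_iff)
      qed
      then show False using k by (simp add: in_keys_iff)
    qed
    ultimately obtain T where "R' = B * T" using Suc.IH by blast
    then have "R = B * (T + T0)" by (simp add: R'_def algebra_simps)
    then show ?case by blast
  qed
  moreover obtain n where "\<And>m. m \<in> keys R \<Longrightarrow> wt m < n"
    using finite_nat_set_iff_bounded[of "wt ` keys R"] by auto
  ultimately show ?thesis using eq by blast
qed

section \<open>Equations of degree one in a variable\<close>

definition free_of :: "'v \<Rightarrow> ('v, 'a::comm_ring_1) mpoly \<Rightarrow> bool" where
  "free_of v G \<longleftrightarrow> (\<forall>m\<in>keys G. lookup m v = 0)"

lemma free_of_mconst: "free_of v (mconst a)"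
  by (simp add: free_of_def mconst_def)

lemma free_of_mvar: "u \<noteq> v \<Longrightarrow> free_of v (mvar u)"
  by (simp add: free_of_def mvar_def lookup_single)

lemma free_of_add: "free_of v G \<Longrightarrow> free_of v H \<Longrightarrow> free_of v (G + H)"
  using Poly_Mapping.keys_add[of G H] by (auto simp: free_of_def)

lemma free_of_uminus: "free_of v G \<Longrightarrow> free_of v (- G)"
  by (auto simp: free_of_def in_keys_iff)

lemma free_of_mult: "free_of v G \<Longrightarrow> free_of v H \<Longrightarrow> free_of v (G * H)"
  using Poly_Mapping.keys_mult[of G H] by (fastforce simp: free_of_def lookup_add)

lemma free_of_power: "free_of v G \<Longrightarrow> free_of v (G ^ n)"
  using free_of_mconst[of v 1] by (induction n) (auto intro: free_of_mult simp: mconst_def)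

lemma free_of_meval:
  assumes "free_of v G"
  shows "meval G (p(v := t)) = meval G p"
  unfolding meval_monval monval_def
proof (intro sum.cong refl arg_cong[of _ _ "\<lambda>x. _ * x"] prod.cong)
  fix m u assume "m \<in> keys G" "u \<in> keys m"
  then have "u \<noteq> v" using assms by (auto simp: free_of_def in_keys_iff)
  then show "(p(v := t)) u ^ lookup m u = p u ^ lookup m u" by simp
qed

definition slope_in :: "'v \<Rightarrow> ('v, 'a::comm_ring_1) mpoly \<Rightarrow> ('v, 'a) mpoly" where
  "slope_in v F = (\<Sum>m\<in>{m \<in> keys F. lookup m v = 1}.
     single (m - single v 1) (lookup F m))"

definition rest_in :: "'v \<Rightarrow> ('v, 'a::comm_ring_1) mpoly \<Rightarrow> ('v, 'a) mpoly" where
  "rest_in v F = (\<Sum>m\<in>{m \<in> keys F. lookup m v = 0}.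
     single m (lookup F m))"

lemma minus_single_add:
  fixes m :: "'v \<Rightarrow>\<^sub>0 nat"
  assumes "lookup m v = 1"
  shows "single v 1 + (m - single v 1) = m"
  by (rule poly_mapping_eqI) (use assms in \<open>auto simp: lookup_add lookup_minus lookup_single when_def\<close>)

lemma affine_split:
  assumes "\<And>m. m \<in> keys F \<Longrightarrow> lookup m v \<le> 1"
  shows "F = mvar v * slope_in v F + rest_in v F"
proof -
  have "mvar v * slope_in v F = (\<Sum>m\<in>{m \<in> keys F. lookup m v = 1}. single m (lookup F m))"
    unfolding slope_in_def sum_distrib_left mvar_def
    by (intro sum.cong refl) (simp add: mult_single minus_single_add[unfolded One_nat_def])
  moreover have "keys F = {m \<in> keys F. lookup m v = 1} \<union> {m \<in> keys F. lookup m v = 0}"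
  proof -
    have "lookup m v = 1 \<or> lookup m v = 0" if "m \<in> keys F" for m
      using assms[OF that] by linarith
    then show ?thesis by blast
  qed
  ultimately show ?thesis
    unfolding rest_in_def
    by (subst (1) mpoly_sum_monomials[of F, symmetric], subst (1) \<open>keys F = _\<close>)
       (subst sum.union_disjoint, auto)
qed

lemma lookup_slope_in:
  "lookup (slope_in v F) k =
     (if lookup k v = 0 then lookup F (single v 1 + k) else 0)"
proof -
  let ?K = "{m \<in> keys F. lookup m v = 1}"
  have "lookup (slope_in v F) k = (\<Sum>m\<in>?K. if m = single v 1 + k then lookup F m else 0)"
    unfolding slope_in_def lookup_sum
  proof (intro sum.cong refl)
    fix m assume m: "m \<in> ?K"
    then have "m - single v 1 = k \<longleftrightarrow> m = single v 1 + k"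
      using minus_single_add[of m v] by (metis (mono_tags, lifting) add_diff_cancel_left' mem_Collect_eq)
    then show "lookup (single (m - single v 1) (lookup F m)) k =
       (if m = single v 1 + k then lookup F m else 0)"
      by (simp add: lookup_single when_def)
  qed
  then show ?thesis by (auto simp: lookup_add lookup_single in_keys_iff)
qed

lemma free_of_slope_in: "free_of v (slope_in v F)"
  by (auto simp: free_of_def in_keys_iff lookup_slope_in split: if_splits)

lemma free_of_rest_in: "free_of v (rest_in v F)"
proof -
  have "keys (rest_in v F) \<subseteq> {m \<in> keys F. lookup m v = 0}"
    unfolding rest_in_def by (rule order_trans[OF Poly_Mapping.keys_sum]) auto
  then show ?thesis by (auto simp: free_of_def)
qed

text \<open>
  Modulo \<open>F\<close> the product of \<open>v\<close> and \<open>P\<close> is \<open>-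
  Q\<close>, so after multiplication by a power of \<open>P\<close> the variable
  \<open>v\<close> can be eliminated.
\<close>
lemma pseudo_division:
  assumes F: "F = mvar v * P + Q" and P: "free_of v P" and Q: "free_of v Q"
  shows "\<exists>k R H. free_of v H \<and> P ^ k * G = F * R + H"
proof (induction G rule: mpoly_induct)
  case (const a)
  show ?case by (intro exI[of _ 0] exI[of _ 0] exI[of _ "mconst a"]) (simp add: free_of_mconst)
next
  case (var x)
  show ?case
  proof (cases "x = v")
    case True
    have "P ^ 1 * mvar x = F * 1 + (- Q)" by (simp add: F True)
    then show ?thesis using free_of_uminus[OF Q]
      by (intro exI[of _ 1] exI[of _ 1] exI[of _ "- Q"]) simp
  next
    case False
    then show ?thesis by (intro exI[of _ 0] exI[of _ 0] exI[of _ "mvar x"]) (simp add: free_of_mvar)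
  qed
next
  case (add G1 G2)
  from add.IH(1) obtain k R H where 1: "free_of v H" "P ^ k * G1 = F * R + H" by blast
  from add.IH(2) obtain l S K where 2: "free_of v K" "P ^ l * G2 = F * S + K" by blast
  have "P ^ (k + l) * (G1 + G2) = P ^ l * (P ^ k * G1) + P ^ k * (P ^ l * G2)"
    by (simp add: algebra_simps power_add)
  also have "\<dots> = F * (P ^ l * R + P ^ k * S) + (P ^ l * H + P ^ k * K)"
    unfolding 1 2 by (simp add: algebra_simps)
  finally have e: "P ^ (k + l) * (G1 + G2) = F * (P ^ l * R + P ^ k * S) + (P ^ l * H + P ^ k * K)" .
  have "free_of v (P ^ l * H + P ^ k * K)"
    using 1 2 P by (intro free_of_add free_of_mult free_of_power)
  with e show ?case by blast
next
  case (mult G1 G2)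
  from mult.IH(1) obtain k R H where 1: "free_of v H" "P ^ k * G1 = F * R + H" by blast
  from mult.IH(2) obtain l S K where 2: "free_of v K" "P ^ l * G2 = F * S + K" by blast
  have "P ^ (k + l) * (G1 * G2) = (P ^ k * G1) * (P ^ l * G2)"
    by (simp add: algebra_simps power_add)
  also have "\<dots> = F * (R * (P ^ l * G2) + H * S) + H * K"
    unfolding 1 2 by (simp add: algebra_simps)
  finally show ?case using free_of_mult[OF 1(1) 2(1)] by blast
qed

text \<open>
  Over the locus \<open>P \<noteq> 0\<close> the hypersurface \<open>F = 0\<close> is the graph
  of \<open>- Q / P\<close>, and the points of \<open>Z\<close> are dense in it because their
  projections along the \<open>v\<close>-axis satisfy no equation. Regularity of the pair
  \<open>F\<close>, \<open>P\<close> excludes components of the hypersurface inside \<open>P =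
  0\<close>. Therefore \<open>F\<close> generates the ideal of \<open>Z\<close>, and this ideal
  is prime.
\<close>
locale affine_equation =
  fixes v :: "'v::finite" and F P Q :: "('v, complex) mpoly" and Z :: "('v \<Rightarrow> complex) set"
  assumes split: "F = mvar v * P + Q" and P_free: "free_of v P" and Q_free: "free_of v Q"
    and P_nonzero: "P \<noteq> 0"
    and regular: "\<And>R S. F * R = P * S \<Longrightarrow> \<exists>T. R = P * T"
    and vanishes: "\<And>z. z \<in> Z \<Longrightarrow> meval F z = 0"
    and dominant: "\<And>H. free_of v H \<Longrightarrow> (\<And>z. z \<in> Z \<Longrightarrow> meval H z = 0) \<Longrightarrow> H = 0"
begin

lemma cancel_slope:
  assumes "F dvd P ^ k * G"
  shows "F dvd G"
  using assms
proof (induction k)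
  case (Suc k)
  then obtain R where R: "F * R = P * (P ^ k * G)" by (auto simp: dvd_def mult.assoc)
  then obtain T where "R = P * T" using regular by blast
  with R have "P * (F * T) = P * (P ^ k * G)" by (simp add: algebra_simps)
  then have "P ^ k * G = F * T" using P_nonzero mpoly_mult_cancel by metis
  then show ?case using Suc.IH by simp
qed simp

text \<open>
  The remainder of pseudo-division is free of \<open>v\<close> and vanishes on \<open>Z\<close>,
  so it is zero; the power of \<open>P\<close> is then cancelled.
\<close>
lemma vanishes_iff_dvd: "(\<forall>z\<in>Z. meval G z = 0) \<longleftrightarrow> F dvd G"
proof
  assume G: "\<forall>z\<in>Z. meval G z = 0"
  obtain k R H where H: "free_of v H" "P ^ k * G = F * R + H"
    using pseudo_division[OF split P_free Q_free] by blast
  have "H = P ^ k * G - F * R" using H by simp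
  then have "H = 0" using G vanishes H(1)
    by (intro dominant) (auto simp: meval_diff meval_mult)
  then show "F dvd G" using H(2) cancel_slope by (metis add.right_neutral dvd_triv_left)
qed (use vanishes in \<open>auto simp: dvd_def meval_mult\<close>)

text \<open>
  The product of the two remainders of pseudo-division is divisible by \<open>F\<close> and free
  of \<open>v\<close>, so it vanishes on \<open>Z\<close> and is zero.
\<close>
lemma prime_equation:
  assumes "F dvd A * B"
  shows "F dvd A \<or> F dvd B"
proof -
  obtain k R H where H: "free_of v H" "P ^ k * A = F * R + H"
    using pseudo_division[OF split P_free Q_free] by blast
  obtain l S K where K: "free_of v K" "P ^ l * B = F * S + K"
    using pseudo_division[OF split P_free Q_free] by blast
  have "H * K = P ^ (k + l) * (A * B) - F * (R * (P ^ l * B) + H * S)"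
  proof -
    have "P ^ (k + l) * (A * B) = (P ^ k * A) * (P ^ l * B)"
      by (simp add: power_add algebra_simps)
    also have "\<dots> = F * (R * (P ^ l * B) + H * S) + H * K"
      unfolding H K by (simp add: algebra_simps)
    finally show ?thesis by simp
  qed
  then have "F dvd H * K" using assms by simp
  then have "H * K = 0" using vanishes_iff_dvd H(1) K(1)
    by (intro dominant free_of_mult) auto
  then have "H = 0 \<or> K = 0" using mpoly_no_zero_divisors by blast
  then show ?thesis using H(2) K(2) cancel_slope by (metis add.right_neutral dvd_triv_left)
qed

end

section \<open>Multilinearity in the auxiliary variables\<close>
lemma UNIV_3': "(UNIV :: 3 set) = {1, 2, 3}"
  using UNIV_3 by auto

lemma UNIV_6: "(UNIV :: 6 set) = {1, 2, 3, 4, 5, 6}"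
proof -
  have "card {1, 2, 3, 4, 5, 6 :: 6} = CARD(6)" by simp
  then show ?thesis by (metis card_subset_eq finite subset_UNIV)
qed

lemma vector_6 [simp]:
  "(vector [a, b, c, d, e, f] :: 'a::zero ^ 6) $ 1 = a"
  "(vector [a, b, c, d, e, f] :: 'a::zero ^ 6) $ 2 = b"
  "(vector [a, b, c, d, e, f] :: 'a::zero ^ 6) $ 3 = c"
  "(vector [a, b, c, d, e, f] :: 'a::zero ^ 6) $ 4 = d"
  "(vector [a, b, c, d, e, f] :: 'a::zero ^ 6) $ 5 = e"
  "(vector [a, b, c, d, e, f] :: 'a::zero ^ 6) $ 6 = f"
  unfolding vector_def by simp_all

lemma sum_6: "(\<Sum>i\<in>(UNIV :: 6 set). f i) = f 1 + f 2 + f 3 + f 4 + f 5 + f 6"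
  unfolding UNIV_6 by (simp add: add.assoc)

text \<open>
  The variables of a letter form four blocks: the \<open>AuxV z i\<close> form the block
  \<open>None\<close> and, for each \<open>r\<close>, the \<open>AuxW z r t\<close> form the
  block \<open>Some r\<close>. The product \<open>pV * pW\<close> has degree one in every block,
  and this is why contraction with a decomposable tensor amounts to a substitution.
\<close>
fun block_degree :: "letter \<Rightarrow> 3 option \<Rightarrow> (aux \<Rightarrow>\<^sub>0 nat) \<Rightarrow> nat" where
  "block_degree z None m = (\<Sum>i\<in>UNIV. lookup m (AuxV z i))"
| "block_degree z (Some r) m = (\<Sum>t\<in>UNIV. lookup m (AuxW z r t))"

lemma block_degree_0 [simp]: "block_degree z b 0 = 0"
  by (cases b) simp_all

lemma block_degree_add: "block_degree z b (m + n) = block_degree z b m + block_degree z b n"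
  by (cases b) (simp_all add: lookup_add sum.distrib)

lemma block_degree_AuxV:
  "block_degree z b (single (AuxV y i) k) = (if b = None \<and> y = z then k else 0)"
  by (cases b) (auto simp: lookup_single when_def)

lemma block_degree_AuxW:
  "block_degree z b (single (AuxW y r t) k) = (if b = Some r \<and> y = z then k else 0)"
  by (cases b) (auto simp: lookup_single when_def)

definition block_hom :: "letter \<Rightarrow> 3 option \<Rightarrow> nat \<Rightarrow> auxpoly \<Rightarrow> bool" where
  "block_hom z b d G \<longleftrightarrow> (\<forall>m\<in>keys G. block_degree z b m = d)"

lemma block_hom_sum: "(\<And>i. i \<in> A \<Longrightarrow> block_hom z b d (f i)) \<Longrightarrow> block_hom z b d (sum f A)"
  using Poly_Mapping.keys_sum[of f A] by (fastforce simp: block_hom_def)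

lemma block_hom_mult: "block_hom z b d G \<Longrightarrow> block_hom z b e H \<Longrightarrow> block_hom z b (d + e) (G * H)"
  using Poly_Mapping.keys_mult[of G H] by (fastforce simp: block_hom_def block_degree_add)

lemma block_hom_mconst: "block_hom z b 0 (mconst a)"
  by (simp add: block_hom_def mconst_def)

lemma block_hom_of_int: "block_hom z b 0 (of_int k)"
  using block_hom_mconst[of z b "of_int k"] by (simp add: mconst_def)

lemma block_hom_prod:
  "finite A \<Longrightarrow> (\<And>i. i \<in> A \<Longrightarrow> block_hom z b (d i) (f i)) \<Longrightarrow> block_hom z b (sum d A) (prod f A)"
proof (induction A rule: finite_induct)
  case empty
  then show ?case using block_hom_mconst[of z b 1] by (simp add: mconst_def)
next
  case (insert x F)
  then show ?case by (simp add: block_hom_mult)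
qed

lemma block_hom_det:
  fixes M :: "auxpoly ^ 'n ^ 'n"
  assumes "\<And>i j. block_hom z b (d i) (M $ i $ j)"
  shows "block_hom z b (sum d UNIV) (det M)"
  unfolding det_def
proof (rule block_hom_sum)
  fix p assume "p \<in> {p. p permutes (UNIV :: 'n set)}"
  have "block_hom z b (0 + sum d UNIV) (of_int (sign p) * (\<Prod>i\<in>UNIV. M $ i $ p i))"
    by (intro block_hom_mult block_hom_of_int block_hom_prod assms) simp
  then show "block_hom z b (sum d UNIV) (of_int (sign p) * (\<Prod>i\<in>UNIV. M $ i $ p i))" by simp
qed

lemma block_hom_rowV: "block_hom z b (if b = None \<and> y = z then 1 else 0) (rowV y $ i)"
  by (simp add: rowV_def block_hom_def mvar_def block_degree_AuxV del: block_degree.simps)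

lemma block_hom_rowW: "block_hom z b (if b = Some r \<and> y = z then 1 else 0) (rowW y r $ t)"
  by (simp add: rowW_def block_hom_def mvar_def block_degree_AuxW del: block_degree.simps)

lemma block_hom_det_3:
  assumes "\<And>j. block_hom z b d1 (r1 $ j)" "\<And>j. block_hom z b d2 (r2 $ j)" "\<And>j. block_hom z b d3 (r3 $ j)"
  shows "block_hom z b (d1 + d2 + d3) (det (vector [r1, r2, r3] :: auxpoly ^ 3 ^ 3))"
proof -
  have "block_hom z b (sum (($) (vector [d1, d2, d3] :: nat ^ 3)) UNIV) (det (vector [r1, r2, r3] :: auxpoly ^ 3 ^ 3))"
  proof (rule block_hom_det)
    fix i j :: 3
    have "i \<in> {1, 2, 3}" using UNIV_3' by auto
    then show "block_hom z b ((vector [d1, d2, d3] :: nat ^ 3) $ i) ((vector [r1, r2, r3] :: auxpoly ^ 3 ^ 3) $ i $ j)"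
      using assms by (auto simp: vector_3)
  qed
  then show ?thesis by (simp add: sum_3 vector_3)
qed

lemma block_hom_det_6:
  assumes "\<And>j. block_hom z b d1 (r1 $ j)" "\<And>j. block_hom z b d2 (r2 $ j)" "\<And>j. block_hom z b d3 (r3 $ j)"
    "\<And>j. block_hom z b d4 (r4 $ j)" "\<And>j. block_hom z b d5 (r5 $ j)" "\<And>j. block_hom z b d6 (r6 $ j)"
  shows "block_hom z b (d1 + d2 + d3 + d4 + d5 + d6) (det (vector [r1, r2, r3, r4, r5, r6] :: auxpoly ^ 6 ^ 6))"
proof -
  have "block_hom z b (sum (($) (vector [d1, d2, d3, d4, d5, d6] :: nat ^ 6)) UNIV)
    (det (vector [r1, r2, r3, r4, r5, r6] :: auxpoly ^ 6 ^ 6))"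
  proof (rule block_hom_det)
    fix i j :: 6
    have "i \<in> {1, 2, 3, 4, 5, 6}" using UNIV_6 by auto
    then show "block_hom z b ((vector [d1, d2, d3, d4, d5, d6] :: nat ^ 6) $ i)
       ((vector [r1, r2, r3, r4, r5, r6] :: auxpoly ^ 6 ^ 6) $ i $ j)"
      using assms by auto
  qed
  then show ?thesis by (simp add: sum_6)
qed

lemma exhaust_3_option: "b = None \<or> b = Some 1 \<or> b = Some 2 \<or> b = Some (3::3)"
  using UNIV_3' by (cases b) auto

lemma block_hom_pV_pW: "block_hom z b 1 (pV * pW)"
proof -
  note R = block_hom_rowV[of z b] block_hom_rowW[of z b]
  have "block_hom z b
    (((if b = None \<and> La = z then 1 else 0) + (if b = None \<and> Lb = z then 1 else 0) + (if b = None \<and> Ld = z then 1 else 0) +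
      ((if b = None \<and> Lc = z then 1 else 0) + (if b = None \<and> Le = z then 1 else 0) + (if b = None \<and> Lf = z then 1 else 0))) +
     (((if b = Some 1 \<and> La = z then 1 else 0) + (if b = Some 2 \<and> La = z then 1 else 0) + (if b = Some 3 \<and> La = z then 1 else 0) +
       (if b = Some 3 \<and> Lb = z then 1 else 0) + (if b = Some 2 \<and> Lc = z then 1 else 0) + (if b = Some 3 \<and> Lc = z then 1 else 0)) +
      ((if b = Some 1 \<and> Lb = z then 1 else 0) + (if b = Some 2 \<and> Lb = z then 1 else 0) + (if b = Some 2 \<and> Ld = z then 1 else 0) +
       (if b = Some 3 \<and> Ld = z then 1 else 0) + (if b = Some 2 \<and> Le = z then 1 else 0) + (if b = Some 3 \<and> Le = z then 1 else 0)) +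
      ((if b = Some 1 \<and> Lc = z then 1 else 0) + (if b = Some 1 \<and> Ld = z then 1 else 0) + (if b = Some 1 \<and> Le = z then 1 else 0) +
       (if b = Some 1 \<and> Lf = z then 1 else 0) + (if b = Some 2 \<and> Lf = z then 1 else 0) + (if b = Some 3 \<and> Lf = z then 1 else 0))))
    (pV * pW)"
    unfolding pV_def pW_def by (intro block_hom_mult block_hom_det_3 block_hom_det_6 R)
  then show ?thesis
    using exhaust_3_option[of b] by (cases z) auto
qed

type_synonym point = "(complex ^ 3) \<times> (complex ^ 6) \<times> (complex ^ 6) \<times> (complex ^ 6)"

fun aux_val :: "(letter \<Rightarrow> point) \<Rightarrow> aux \<Rightarrow> complex" where
  "aux_val \<Phi> (AuxV z i) = fst (\<Phi> z) $ i"
| "aux_val \<Phi> (AuxW z r t) = (case snd (\<Phi> z) of (a, b, c) \<Rightarrow> (if r = 1 then a else if r = 2 then b else c) $ t)"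

definition aux_eval :: "(coord \<Rightarrow> complex) \<Rightarrow> (letter \<Rightarrow> point) \<Rightarrow> auxpoly \<Rightarrow> complex" where
  "aux_eval x \<Phi> G = peval (\<lambda>H. meval H x) (aux_val \<Phi>) G"

lemma coeff_hom_meval: "coeff_hom (\<lambda>H. meval H x)"
  by standard (simp_all add: meval_add meval_mult)

interpretation meval_hom: coeff_hom "\<lambda>H. meval H x" for x
  by (rule coeff_hom_meval)

definition letter_mon :: "letter \<Rightarrow> 3 \<times> 6 \<times> 6 \<times> 6 \<Rightarrow> (aux \<Rightarrow>\<^sub>0 nat)" where
  "letter_mon z = (\<lambda>(i, p, q, r). single (AuxV z i) 1 + single (AuxW z 1 p) 1 +
     single (AuxW z 2 q) 1 + single (AuxW z 3 r) 1)"

lemma lookup_letter_mon_V: "lookup (letter_mon z (i, p, q, r)) (AuxV y i') = (if y = z \<and> i' = i then 1 else 0)"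
  by (auto simp: letter_mon_def lookup_add lookup_single when_def)

lemma lookup_letter_mon_W:
  "lookup (letter_mon z (i, p, q, r)) (AuxW y s t) =
     (if y = z \<and> t = (if s = 1 then p else if s = 2 then q else r) then 1 else 0)"
proof -
  have "s \<in> {1, 2, 3}" using UNIV_3' by auto
  then show ?thesis by (auto simp: letter_mon_def lookup_add lookup_single when_def)
qed

lemma letter_mon_eq_iff:
  "(\<forall>v. letter_of v = z \<longrightarrow> lookup (letter_mon z s) v = lookup (letter_mon z t) v) \<longleftrightarrow> s = t"
proof
  obtain i p q r i' p' q' r' where st: "s = (i, p, q, r)" "t = (i', p', q', r')"
    using prod_cases4 by metis
  assume *: "\<forall>v. letter_of v = z \<longrightarrow> lookup (letter_mon z s) v = lookup (letter_mon z t) v"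
  have "i = i'"
    using *[rule_format, of "AuxV z i"] unfolding st lookup_letter_mon_V by (cases "i = i'") simp_all
  moreover have "p = p'"
    using *[rule_format, of "AuxW z 1 p"] unfolding st lookup_letter_mon_W by (cases "p = p'") simp_all
  moreover have "q = q'"
    using *[rule_format, of "AuxW z 2 q"] unfolding st lookup_letter_mon_W by (cases "q = q'") simp_all
  moreover have "r = r'"
    using *[rule_format, of "AuxW z 3 r"] unfolding st lookup_letter_mon_W by (cases "r = r'") simp_all
  ultimately show "s = t" by (simp add: st)
qed simp

lemma split_letter_mon:
  assumes "\<And>b. block_degree z b m = 1"
  shows "\<exists>t n. m = letter_mon z t + n \<and> (\<forall>v. letter_of v = z \<longrightarrow> lookup n v = 0)"
proof -
  have one: "\<exists>i. f i = 1 \<and> (\<forall>j. j \<noteq> i \<longrightarrow> f j = 0)" if "sum f (UNIV :: 'x::finite set) = (1::nat)" for f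
    using that by (subst (asm) sum_eq_1_iff) auto
  obtain i where i: "lookup m (AuxV z i) = 1" "\<And>j. j \<noteq> i \<Longrightarrow> lookup m (AuxV z j) = 0"
    using one[of "\<lambda>i. lookup m (AuxV z i)"] assms[of None] by auto
  have "\<exists>t. lookup m (AuxW z s t) = 1 \<and> (\<forall>j. j \<noteq> t \<longrightarrow> lookup m (AuxW z s j) = 0)" for s
    using one[of "\<lambda>i. lookup m (AuxW z s i)"] assms[of "Some s"] by auto
  then obtain t where t: "\<And>s. lookup m (AuxW z s (t s)) = 1"
    "\<And>s j. j \<noteq> t s \<Longrightarrow> lookup m (AuxW z s j) = 0"
    by metis
  have s: "s = 1 \<or> s = 2 \<or> s = 3" for s :: 3 using UNIV_3' by auto
  let ?t = "(i, t 1, t 2, t 3)"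
  have eq: "lookup m v = lookup (letter_mon z ?t) v" if "letter_of v = z" for v
  proof (cases v)
    case (AuxV y j)
    then show ?thesis using i that by (auto simp: lookup_letter_mon_V)
  next
    case (AuxW y u j)
    have "lookup m (AuxW z u j) = (if j = t u then 1 else 0)" using t by simp
    then show ?thesis using AuxW that s[of u] by (auto simp: lookup_letter_mon_W)
  qed
  have 0: "lookup (letter_mon z ?t) v = 0" if "letter_of v \<noteq> z" for v
    using that by (cases v) (auto simp: lookup_letter_mon_V lookup_letter_mon_W)
  have "m = letter_mon z ?t + (m - letter_mon z ?t)"
  proof (rule poly_mapping_eqI)
    fix v show "lookup m v = lookup (letter_mon z ?t + (m - letter_mon z ?t)) v"
      using eq[of v] 0[of v] by (cases "letter_of v = z") (simp_all add: lookup_add lookup_minus)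
  qed
  moreover have "\<forall>v. letter_of v = z \<longrightarrow> lookup (m - letter_mon z ?t) v = 0"
    using eq by (simp add: lookup_minus)
  ultimately show ?thesis by blast
qed

lemma monval_cong: "(\<And>v. lookup m v \<noteq> 0 \<Longrightarrow> p v = q v) \<Longrightarrow> monval p m = monval q m"
  unfolding monval_def by (intro prod.cong refl) (simp add: in_keys_iff)

lemma monval_letter_mon:
  "monval (aux_val (\<Phi>(z := (v, a, b, c)))) (letter_mon z (i, p, q, r)) = v $ i * a $ p * b $ q * c $ r"
  by (simp add: letter_mon_def monval_add)

lemma monval_free:
  assumes "\<forall>v. letter_of v = z \<longrightarrow> lookup n v = 0"
  shows "monval (aux_val (\<Phi>(z := y))) n = monval (aux_val \<Phi>) n"
proof (rule monval_cong)
  fix v assume "lookup n v \<noteq> 0"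
  then have "letter_of v \<noteq> z" using assms by metis
  then show "aux_val (\<Phi>(z := y)) v = aux_val \<Phi> v" by (cases v) auto
qed

lemma aux_eval_letter_coeff:
  "aux_eval x \<Phi> (letter_coeff z (letter_mon z t) G) =
    (\<Sum>m\<in>keys G. if (\<forall>v. letter_of v = z \<longrightarrow> lookup m v = lookup (letter_mon z t) v)
       then meval (lookup G m) x * monval (aux_val \<Phi>) (m - letter_mon z t) else 0)"
  unfolding letter_coeff_def aux_eval_def sum.inter_filter[OF finite_keys] meval_hom.peval_sum
  by (intro sum.cong refl) (auto simp: meval_hom.peval_single)

text \<open>
  Degree one in every block of \<open>z\<close> makes the value linear in each of the four
  vectors that are substituted for \<open>z\<close>.
\<close>
lemma aux_eval_multilinear:
  assumes G: "\<And>b. block_hom z b 1 G"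
  shows "aux_eval x (\<Phi>(z := (v, a, b, c))) G =
    (\<Sum>(i, p, q, r)\<in>UNIV. v $ i * a $ p * b $ q * c $ r * aux_eval x \<Phi> (letter_coeff z (letter_mon z (i, p, q, r)) G))"
proof -
  let ?match = "\<lambda>m t. \<forall>v. letter_of v = z \<longrightarrow> lookup m v = lookup (letter_mon z t) v"
  let ?w = "\<lambda>(i, p, q, r). v $ i * a $ p * b $ q * c $ r"
  have key: "meval (lookup G m) x * monval (aux_val (\<Phi>(z := (v, a, b, c)))) m =
     (\<Sum>t\<in>UNIV. ?w t * (if ?match m t then meval (lookup G m) x * monval (aux_val \<Phi>) (m - letter_mon z t) else 0))"
    if m: "m \<in> keys G" for m
  proof -
    obtain t0 n where t0: "m = letter_mon z t0 + n" and n: "\<forall>v. letter_of v = z \<longrightarrow> lookup n v = 0"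
      using split_letter_mon[of z m] G m by (auto simp: block_hom_def)
    have match: "?match m t \<longleftrightarrow> t = t0" for t
      using letter_mon_eq_iff[of z t0 t] n by (auto simp: t0 lookup_add)
    have "monval (aux_val (\<Phi>(z := (v, a, b, c)))) m = ?w t0 * monval (aux_val \<Phi>) n"
      by (cases t0) (simp add: t0 monval_add monval_letter_mon monval_free[OF n])
    moreover have "m - letter_mon z t0 = n" by (simp add: t0)
    moreover have "(\<Sum>t\<in>UNIV. ?w t * (if ?match m t then meval (lookup G m) x * monval (aux_val \<Phi>) (m - letter_mon z t) else 0)) =
        (\<Sum>t\<in>UNIV. if t = t0 then ?w t0 * (meval (lookup G m) x * monval (aux_val \<Phi>) (m - letter_mon z t0)) else 0)"
      by (intro sum.cong refl) (simp add: match)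
    ultimately show ?thesis by simp
  qed
  have "aux_eval x (\<Phi>(z := (v, a, b, c))) G =
      (\<Sum>m\<in>keys G. \<Sum>t\<in>UNIV. ?w t * (if ?match m t then meval (lookup G m) x * monval (aux_val \<Phi>) (m - letter_mon z t) else 0))"
    unfolding aux_eval_def peval_def by (intro sum.cong refl key)
  also have "\<dots> = (\<Sum>t\<in>UNIV. ?w t * aux_eval x \<Phi> (letter_coeff z (letter_mon z t) G))"
    unfolding aux_eval_letter_coeff by (subst sum.swap) (simp only: sum_distrib_left)
  finally show ?thesis by (simp add: case_prod_unfold)
qed

lemma contract_sum_single:
  assumes "finite A"
  shows "contract z (\<Sum>s\<in>A. single (m s) (a s)) G = (\<Sum>s\<in>A. mconst (a s) * letter_coeff z (m s) G)"
proof -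
  let ?M = "\<Sum>s\<in>A. single (m s) (a s)"
  have keys: "keys ?M \<subseteq> m ` A"
    by (rule order_trans[OF Poly_Mapping.keys_sum]) auto
  have mc: "mconst (\<Sum>s\<in>A. f s) = (\<Sum>s\<in>A. mconst (f s) :: auxpoly)" for f
    by (induction A rule: infinite_finite_induct) (simp_all add: mconst_def single_add)
  have "contract z ?M G = (\<Sum>k\<in>m ` A. mconst (lookup ?M k) * letter_coeff z k G)"
    unfolding contract_def
    by (rule sum.mono_neutral_left) (use assms keys in \<open>auto simp: in_keys_iff mconst_def\<close>)
  also have "\<dots> = (\<Sum>k\<in>m ` A. \<Sum>s\<in>A. if m s = k then mconst (a s) * letter_coeff z (m s) G else 0)"
    unfolding lookup_sum mc sum_distrib_right
    by (intro sum.cong refl) (auto simp: lookup_single mconst_def)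
  also have "\<dots> = (\<Sum>s\<in>A. \<Sum>k\<in>m ` A. if m s = k then mconst (a s) * letter_coeff z (m s) G else 0)"
    by (rule sum.swap)
  also have "\<dots> = (\<Sum>s\<in>A. mconst (a s) * letter_coeff z (m s) G)"
    using assms by (intro sum.cong refl) (simp add: sum.delta)
  finally show ?thesis .
qed

lemma letter_times_wedge:
  "mvar (AuxV z i) * wedge_var z j k l =
    (\<Sum>\<sigma> | \<sigma> permutes {j, k, l}. single (letter_mon z (i, of_nat (\<sigma> j), of_nat (\<sigma> k), of_nat (\<sigma> l))) (of_int (sign \<sigma>)))"
proof -
  have "(of_int s :: auxpoly) = single 0 (of_int s)" for s by simp
  then show ?thesis
    unfolding wedge_var_def sum_distrib_left mvar_def letter_mon_def
    by (intro sum.cong refl) (simp only: mult_single, simp add: add_ac)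
qed

lemma meval_of_int [simp]: "meval (of_int k) x = of_int k"
  by (simp add: meval_peval)

lemma aux_eval_contraction_step:
  "aux_eval x \<Phi> (contraction_step z G) =
    (\<Sum>t\<in>UNIV. case Rep_coord t of (i, j, k, l) \<Rightarrow> x t *
       (\<Sum>\<sigma> | \<sigma> permutes {j, k, l}. of_int (sign \<sigma>) *
          aux_eval x \<Phi> (letter_coeff z (letter_mon z (of_nat i, of_nat (\<sigma> j), of_nat (\<sigma> k), of_nat (\<sigma> l))) G)))"
  unfolding contraction_step_def aux_eval_def meval_hom.peval_sum
proof (intro sum.cong refl)
  fix t :: coord
  obtain i j k l where t: "Rep_coord t = (i, j, k, l)" using prod_cases4 by blast
  have fin: "finite {\<sigma>. \<sigma> permutes {j, k, l}}" by (simp add: finite_permutations)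
  show "peval (\<lambda>H. meval H x) (aux_val \<Phi>)
     (case Rep_coord t of (i, j, k, l) \<Rightarrow> mconst (mvar t) * contract z (mvar (AuxV z (of_nat i)) * wedge_var z j k l) G) =
    (case Rep_coord t of (i, j, k, l) \<Rightarrow> x t *
       (\<Sum>\<sigma> | \<sigma> permutes {j, k, l}. of_int (sign \<sigma>) *
          peval (\<lambda>H. meval H x) (aux_val \<Phi>) (letter_coeff z (letter_mon z (of_nat i, of_nat (\<sigma> j), of_nat (\<sigma> k), of_nat (\<sigma> l))) G)))"
    unfolding t prod.case letter_times_wedge contract_sum_single[OF fin]
    by (simp add: meval_hom.peval_mult meval_hom.peval_sum)
qed

section \<open>The polynomial at sums of decomposable tensors\<close>
definition alt3 :: "('a \<Rightarrow> 'a \<Rightarrow> 'a \<Rightarrow> 'b::ab_group_add) \<Rightarrow> 'a \<Rightarrow> 'a \<Rightarrow> 'a \<Rightarrow> 'b" where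
  "alt3 f a b c = f a b c + f b c a + f c a b - f b a c - f a c b - f c b a"

lemma alt3_permutations:
  fixes g :: "nat \<Rightarrow> nat \<Rightarrow> nat \<Rightarrow> 'b::comm_ring_1"
  assumes "j < k" "k < l"
  shows "(\<Sum>\<sigma> | \<sigma> permutes {j, k, l}. of_int (sign \<sigma>) * g (\<sigma> j) (\<sigma> k) (\<sigma> l)) = alt3 g j k l"
proof -
  have d: "j \<notin> {k, l}" "k \<notin> {l}" and d': "j \<noteq> k" "k \<noteq> l" "j \<noteq> l" using assms by auto
  show ?thesis
    unfolding sum_over_permutations_insert[OF finite.insertI[OF finite.insertI[OF finite.emptyI]] d(1)]
    unfolding sum_over_permutations_insert[OF finite.insertI[OF finite.emptyI] d(2)]
    unfolding permutes_sing
    using d' by (simp add: alt3_def sign_swap_id permutation_swap_id permutation_compose sign_compose sign_id)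
qed

lemma sum_distinct_triples:
  fixes F :: "nat \<Rightarrow> nat \<Rightarrow> nat \<Rightarrow> 'b::comm_monoid_add"
  assumes "finite I" "\<And>p q r. p = q \<or> q = r \<or> p = r \<Longrightarrow> F p q r = 0"
  shows "(\<Sum>(p, q, r)\<in>I \<times> I \<times> I. F p q r) =
    (\<Sum>(j, k, l)\<in>I \<times> I \<times> I. if j < k \<and> k < l then F j k l + F k l j + F l j k + F k j l + F j l k + F l k j else 0)"
proof -
  let ?T = "I \<times> I \<times> I"
  have split: "F p q r = (if p < q \<and> q < r then F p q r else 0) + (if r < p \<and> p < q then F p q r else 0) +
     (if q < r \<and> r < p then F p q r else 0) + (if q < p \<and> p < r then F p q r else 0) +
     (if p < r \<and> r < q then F p q r else 0) + (if r < q \<and> q < p then F p q r else 0)" for p q r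
  proof (cases "p = q \<or> q = r \<or> p = r")
    case True
    then show ?thesis using assms(2)[of p q r] by simp
  next
    case False
    then consider "p < q \<and> q < r" | "r < p \<and> p < q" | "q < r \<and> r < p" | "q < p \<and> p < r" | "p < r \<and> r < q" | "r < q \<and> q < p"
      by linarith
    then show ?thesis by cases auto
  qed
  have 1: "(\<Sum>(p, q, r)\<in>?T. if r < p \<and> p < q then F p q r else 0) = (\<Sum>(j, k, l)\<in>?T. if j < k \<and> k < l then F k l j else 0)"
    by (rule sum.reindex_bij_witness[of _ "\<lambda>(j, k, l). (k, l, j)" "\<lambda>(p, q, r). (r, p, q)"]) auto
  have 2: "(\<Sum>(p, q, r)\<in>?T. if q < r \<and> r < p then F p q r else 0) = (\<Sum>(j, k, l)\<in>?T. if j < k \<and> k < l then F l j k else 0)"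
    by (rule sum.reindex_bij_witness[of _ "\<lambda>(j, k, l). (l, j, k)" "\<lambda>(p, q, r). (q, r, p)"]) auto
  have 3: "(\<Sum>(p, q, r)\<in>?T. if q < p \<and> p < r then F p q r else 0) = (\<Sum>(j, k, l)\<in>?T. if j < k \<and> k < l then F k j l else 0)"
    by (rule sum.reindex_bij_witness[of _ "\<lambda>(j, k, l). (k, j, l)" "\<lambda>(p, q, r). (q, p, r)"]) auto
  have 4: "(\<Sum>(p, q, r)\<in>?T. if p < r \<and> r < q then F p q r else 0) = (\<Sum>(j, k, l)\<in>?T. if j < k \<and> k < l then F j l k else 0)"
    by (rule sum.reindex_bij_witness[of _ "\<lambda>(j, k, l). (j, l, k)" "\<lambda>(p, q, r). (p, r, q)"]) auto
  have 5: "(\<Sum>(p, q, r)\<in>?T. if r < q \<and> q < p then F p q r else 0) = (\<Sum>(j, k, l)\<in>?T. if j < k \<and> k < l then F l k j else 0)"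
    by (rule sum.reindex_bij_witness[of _ "\<lambda>(j, k, l). (l, k, j)" "\<lambda>(p, q, r). (r, q, p)"]) auto
  have "(\<Sum>(p, q, r)\<in>?T. F p q r) = (\<Sum>(p, q, r)\<in>?T. if p < q \<and> q < r then F p q r else 0) +
      (\<Sum>(p, q, r)\<in>?T. if r < p \<and> p < q then F p q r else 0) + (\<Sum>(p, q, r)\<in>?T. if q < r \<and> r < p then F p q r else 0) +
      (\<Sum>(p, q, r)\<in>?T. if q < p \<and> p < r then F p q r else 0) + (\<Sum>(p, q, r)\<in>?T. if p < r \<and> r < q then F p q r else 0) +
      (\<Sum>(p, q, r)\<in>?T. if r < q \<and> q < p then F p q r else 0)"
    unfolding case_prod_unfold sum.distrib[symmetric] by (intro sum.cong refl) (rule split)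
  also have "\<dots> = (\<Sum>(j, k, l)\<in>?T. if j < k \<and> k < l then F j k l + F k l j + F l j k + F k j l + F j l k + F l k j else 0)"
    unfolding 1 2 3 4 5 unfolding case_prod_unfold sum.distrib[symmetric] by (intro sum.cong refl) auto
  finally show ?thesis .
qed

lemma sum_coord:
  "(\<Sum>t\<in>UNIV. case Rep_coord t of (i, j, k, l) \<Rightarrow> h i j k l) =
   (\<Sum>i\<in>{1..3}. \<Sum>(j, k, l)\<in>{1..6} \<times> {1..6} \<times> {1..6}. if j < k \<and> k < l then h i j k l else (0::'b::comm_monoid_add))"
proof -
  let ?C = "{(i, j, k, l). (1::nat) \<le> i \<and> i \<le> 3 \<and> (1::nat) \<le> j \<and> j < k \<and> k < l \<and> l \<le> 6}"
  have "(\<Sum>t\<in>UNIV. case Rep_coord t of (i, j, k, l) \<Rightarrow> h i j k l) = (\<Sum>(i, j, k, l)\<in>range Rep_coord. h i j k l)"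
    by (subst sum.reindex) (simp_all add: inj_on_def Rep_coord_inject)
  also have "range Rep_coord = ?C"
    by (rule type_definition.Rep_range[OF type_definition_coord])
  also have "(\<Sum>(i, j, k, l)\<in>?C. h i j k l) =
      (\<Sum>(i, j, k, l)\<in>{1..3} \<times> {1..6} \<times> {1..6} \<times> {1..6}. if j < k \<and> k < l then h i j k l else 0)"
    by (rule sum.mono_neutral_cong_left) (auto split: if_splits)
  finally show ?thesis by (simp add: sum.cartesian_product case_prod_unfold)
qed

lemma sum_3_nat: "(\<Sum>i\<in>{1..3::nat}. f (of_nat i :: 3)) = (\<Sum>i\<in>UNIV. f i)"
proof -
  have "{1..3::nat} = {1, 2, 3}" by auto
  then show ?thesis by (simp add: sum_3 add.assoc)
qed

lemma sum_6_nat: "(\<Sum>i\<in>{1..6::nat}. f (of_nat i :: 6)) = (\<Sum>i\<in>UNIV. f i)"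
proof -
  have "{1..6::nat} = {1, 2, 3, 4, 5, 6}" by auto
  then show ?thesis by (simp add: sum_6 add.assoc)
qed

fun tw :: "point \<Rightarrow> complex ^ coord" where
  "tw (v, a, b, c) = tensor_wedge v a b c"

lemma tensor_wedge_nth:
  assumes "Rep_coord t = (i, j, k, l)"
  shows "tensor_wedge v a b c $ t =
    v $ of_nat i * alt3 (\<lambda>p q r. a $ of_nat p * b $ of_nat q * c $ of_nat r) j k l"
  by (simp add: tensor_wedge_def assms det_3 vector_3 alt3_def algebra_simps)

fun expand_at :: "letter \<Rightarrow> ((letter \<Rightarrow> point) \<Rightarrow> complex) \<Rightarrow> (letter \<Rightarrow> point) \<Rightarrow> point \<Rightarrow> complex" where
  "expand_at z K \<Phi> (v, a, b, c) = alt3 (\<lambda>a b c. K (\<Phi>(z := (v, a, b, c)))) a b c"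

lemma aux_eval_contraction_step_points:
  assumes G: "\<And>b. block_hom z b 1 G"
    and x: "\<And>t. x t = (\<Sum>s\<in>S. tw (P s) $ t)"
  shows "aux_eval x \<Phi> (contraction_step z G) = (\<Sum>s\<in>S. expand_at z (\<lambda>\<Phi>. aux_eval x \<Phi> G) \<Phi> (P s))"
proof -
  define D where "D = (\<lambda>i p q r. aux_eval x \<Phi> (letter_coeff z (letter_mon z (i, p, q, r)) G))"
  let ?I = "{1..6::nat}"
  have point: "(\<Sum>t\<in>UNIV. case Rep_coord t of (i, j, k, l) \<Rightarrow> tw (v, a, b, c) $ t *
       (\<Sum>\<sigma> | \<sigma> permutes {j, k, l}. of_int (sign \<sigma>) * D (of_nat i) (of_nat (\<sigma> j)) (of_nat (\<sigma> k)) (of_nat (\<sigma> l)))) =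
     expand_at z (\<lambda>\<Phi>. aux_eval x \<Phi> G) \<Phi> (v, a, b, c)" for v a b c
  proof -
    define m where "m = (\<lambda>p q r. alt3 (\<lambda>a b c. a $ of_nat p * b $ of_nat q * c $ of_nat r) a b c)"
    define D' where "D' = (\<lambda>i p q r. D (of_nat i) (of_nat p) (of_nat q) (of_nat r))"
    have m0: "m p q r = 0" if "p = q \<or> q = r \<or> p = r" for p q r
      using that by (auto simp: m_def alt3_def algebra_simps)
    have "(\<Sum>t\<in>UNIV. case Rep_coord t of (i, j, k, l) \<Rightarrow> tw (v, a, b, c) $ t *
       (\<Sum>\<sigma> | \<sigma> permutes {j, k, l}. of_int (sign \<sigma>) * D (of_nat i) (of_nat (\<sigma> j)) (of_nat (\<sigma> k)) (of_nat (\<sigma> l)))) =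
      (\<Sum>t\<in>UNIV. case Rep_coord t of (i, j, k, l) \<Rightarrow> v $ of_nat i * m j k l * alt3 (D' i) j k l)"
    proof (intro sum.cong refl)
      fix t :: coord
      obtain i j k l where t: "Rep_coord t = (i, j, k, l)" using prod_cases4 by blast
      then have "j < k" "k < l" using Rep_coord[of t] by auto
      from alt3_permutations[OF this, of "D' i"]
      show "(case Rep_coord t of (i, j, k, l) \<Rightarrow> tw (v, a, b, c) $ t *
         (\<Sum>\<sigma> | \<sigma> permutes {j, k, l}. of_int (sign \<sigma>) * D (of_nat i) (of_nat (\<sigma> j)) (of_nat (\<sigma> k)) (of_nat (\<sigma> l)))) =
        (case Rep_coord t of (i, j, k, l) \<Rightarrow> v $ of_nat i * m j k l * alt3 (D' i) j k l)"
        by (simp add: t tensor_wedge_nth[OF t] D'_def) (simp add: m_def alt3_def algebra_simps)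
    qed
    also have "\<dots> = (\<Sum>i\<in>{1..3}. v $ of_nat i * (\<Sum>(j, k, l)\<in>?I \<times> ?I \<times> ?I. if j < k \<and> k < l then m j k l * alt3 (D' i) j k l else 0))"
      unfolding sum_coord sum_distrib_left
      by (intro sum.cong refl) (auto split: if_splits)
    also have "\<dots> = (\<Sum>i\<in>{1..3}. v $ of_nat i * (\<Sum>(p, q, r)\<in>?I \<times> ?I \<times> ?I. m p q r * D' i p q r))"
    proof (rule sum.cong[OF refl])
      fix i :: nat
      have "(\<Sum>(p, q, r)\<in>?I \<times> ?I \<times> ?I. m p q r * D' i p q r) =
        (\<Sum>(j, k, l)\<in>?I \<times> ?I \<times> ?I. if j < k \<and> k < l then m j k l * D' i j k l + m k l j * D' i k l j + m l j k * D' i l j k +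
           m k j l * D' i k j l + m j l k * D' i j l k + m l k j * D' i l k j else 0)"
        by (rule sum_distinct_triples) (auto simp: m0)
      also have "\<dots> = (\<Sum>(j, k, l)\<in>?I \<times> ?I \<times> ?I. if j < k \<and> k < l then m j k l * alt3 (D' i) j k l else 0)"
        by (intro sum.cong refl) (auto simp: m_def alt3_def algebra_simps)
      finally show "v $ of_nat i * (\<Sum>(j, k, l)\<in>?I \<times> ?I \<times> ?I. if j < k \<and> k < l then m j k l * alt3 (D' i) j k l else 0) =
        v $ of_nat i * (\<Sum>(p, q, r)\<in>?I \<times> ?I \<times> ?I. m p q r * D' i p q r)" by simp
    qed
    also have "\<dots> = (\<Sum>i\<in>{1..3}. \<Sum>p\<in>?I. \<Sum>q\<in>?I. \<Sum>r\<in>?I. v $ of_nat i * (m p q r * D' i p q r))"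
      by (simp add: sum.cartesian_product[symmetric] sum_distrib_left)
    also have "\<dots> = (\<Sum>i\<in>UNIV. \<Sum>p\<in>UNIV. \<Sum>q\<in>UNIV. \<Sum>r\<in>UNIV. v $ i * (alt3 (\<lambda>a b c. a $ p * b $ q * c $ r) a b c * D i p q r))"
      unfolding m_def D'_def sum_6_nat[symmetric] sum_3_nat[symmetric] ..
    also have "\<dots> = alt3 (\<lambda>a b c. \<Sum>i\<in>UNIV. \<Sum>p\<in>UNIV. \<Sum>q\<in>UNIV. \<Sum>r\<in>UNIV. v $ i * a $ p * b $ q * c $ r * D i p q r) a b c"
      unfolding alt3_def sum.distrib[symmetric] sum_subtractf[symmetric]
      by (intro sum.cong refl) (simp add: algebra_simps)
    also have "\<dots> = expand_at z (\<lambda>\<Phi>. aux_eval x \<Phi> G) \<Phi> (v, a, b, c)"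
      unfolding expand_at.simps aux_eval_multilinear[OF G] D_def UNIV_Times_UNIV[symmetric] sum.cartesian_product[symmetric]
      by (simp add: case_prod_unfold)
    finally show ?thesis .
  qed
  have "aux_eval x \<Phi> (contraction_step z G) =
    (\<Sum>t\<in>UNIV. \<Sum>s\<in>S. case Rep_coord t of (i, j, k, l) \<Rightarrow> tw (P s) $ t *
       (\<Sum>\<sigma> | \<sigma> permutes {j, k, l}. of_int (sign \<sigma>) * D (of_nat i) (of_nat (\<sigma> j)) (of_nat (\<sigma> k)) (of_nat (\<sigma> l))))"
    unfolding aux_eval_contraction_step D_def x
    by (intro sum.cong refl) (auto simp: sum_distrib_right split: prod.splits)
  also have "\<dots> = (\<Sum>s\<in>S. \<Sum>t\<in>UNIV. case Rep_coord t of (i, j, k, l) \<Rightarrow> tw (P s) $ t *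
       (\<Sum>\<sigma> | \<sigma> permutes {j, k, l}. of_int (sign \<sigma>) * D (of_nat i) (of_nat (\<sigma> j)) (of_nat (\<sigma> k)) (of_nat (\<sigma> l))))"
    by (rule sum.swap)
  also have "\<dots> = (\<Sum>s\<in>S. expand_at z (\<lambda>\<Phi>. aux_eval x \<Phi> G) \<Phi> (P s))"
  proof (intro sum.cong refl)
    fix s
    obtain v a b c where "P s = (v, a, b, c)" using prod_cases4 by blast
    then show "(\<Sum>t\<in>UNIV. case Rep_coord t of (i, j, k, l) \<Rightarrow> tw (P s) $ t *
       (\<Sum>\<sigma> | \<sigma> permutes {j, k, l}. of_int (sign \<sigma>) * D (of_nat i) (of_nat (\<sigma> j)) (of_nat (\<sigma> k)) (of_nat (\<sigma> l)))) =
       expand_at z (\<lambda>\<Phi>. aux_eval x \<Phi> G) \<Phi> (P s)"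
      using point by simp
  qed
  finally show ?thesis .
qed

lemma block_degree_minus:
  assumes "y \<noteq> z"
  shows "block_degree y b (n - letter_mon z t) = block_degree y b n"
proof -
  have "lookup (letter_mon z t) v = 0" if "letter_of v = y" for v
    using that assms by (cases t; cases v) (auto simp: lookup_letter_mon_V lookup_letter_mon_W)
  then show ?thesis by (cases b) (simp_all add: lookup_minus)
qed

lemma block_hom_contraction_step:
  assumes "y \<noteq> z" "block_hom y b d G"
  shows "block_hom y b d (contraction_step z G)"
  unfolding contraction_step_def
proof (rule block_hom_sum)
  fix t :: coord
  obtain i j k l where t: "Rep_coord t = (i, j, k, l)" using prod_cases4 by blast
  have fin: "finite {\<sigma>. \<sigma> permutes {j, k, l}}" by (simp add: finite_permutations)
  have lc: "block_hom y b d (letter_coeff z (letter_mon z s) G)" for s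
    unfolding letter_coeff_def
    by (rule block_hom_sum)
       (use assms in \<open>auto simp: block_hom_def block_degree_minus split: if_splits\<close>)
  have "block_hom y b (0 + (0 + d)) (mconst (mvar t) * (mconst a * letter_coeff z (letter_mon z s) G))" for a s
    by (intro block_hom_mult block_hom_mconst lc)
  then have "block_hom y b d (\<Sum>\<sigma> | \<sigma> permutes {j, k, l}. mconst (mvar t) *
     (mconst (of_int (sign \<sigma>)) * letter_coeff z (letter_mon z (of_nat i, of_nat (\<sigma> j), of_nat (\<sigma> k), of_nat (\<sigma> l))) G))"
    by (intro block_hom_sum) simp
  then show "block_hom y b d (case Rep_coord t of (i, j, k, l) \<Rightarrow>
     mconst (mvar t) * contract z (mvar (AuxV z (of_nat i)) * wedge_var z j k l) G)"
    unfolding t prod.case letter_times_wedge contract_sum_single[OF fin] sum_distrib_left .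
qed

fun row_of :: "point \<Rightarrow> 3 \<Rightarrow> complex ^ 6" where
  "row_of (v, a, b, c) r = (if r = 1 then a else if r = 2 then b else c)"

definition filling_dets :: "(letter \<Rightarrow> point) \<Rightarrow> complex" where
  "filling_dets \<Phi> =
     det (vector [fst (\<Phi> La), fst (\<Phi> Lb), fst (\<Phi> Ld)] :: complex ^ 3 ^ 3) *
     det (vector [fst (\<Phi> Lc), fst (\<Phi> Le), fst (\<Phi> Lf)] :: complex ^ 3 ^ 3) *
    (det (vector [row_of (\<Phi> La) 1, row_of (\<Phi> La) 2, row_of (\<Phi> La) 3, row_of (\<Phi> Lb) 3, row_of (\<Phi> Lc) 2, row_of (\<Phi> Lc) 3] :: complex ^ 6 ^ 6) *
     det (vector [row_of (\<Phi> Lb) 1, row_of (\<Phi> Lb) 2, row_of (\<Phi> Ld) 2, row_of (\<Phi> Ld) 3, row_of (\<Phi> Le) 2, row_of (\<Phi> Le) 3] :: complex ^ 6 ^ 6) *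
     det (vector [row_of (\<Phi> Lc) 1, row_of (\<Phi> Ld) 1, row_of (\<Phi> Le) 1, row_of (\<Phi> Lf) 1, row_of (\<Phi> Lf) 2, row_of (\<Phi> Lf) 3] :: complex ^ 6 ^ 6))"

lemma aux_val_W: "aux_val \<Phi> (AuxW z r t) = row_of (\<Phi> z) r $ t"
  by (cases "\<Phi> z") simp

lemma aux_eval_det: "aux_eval x \<Phi> (det M) = det (\<chi> i j. aux_eval x \<Phi> (M $ i $ j))"
  unfolding det_def aux_eval_def
  by (simp add: meval_hom.peval_sum meval_hom.peval_mult meval_hom.peval_prod)

lemma aux_eval_rowV: "aux_eval x \<Phi> (rowV z $ i) = fst (\<Phi> z) $ i"
  by (simp add: aux_eval_def rowV_def)

lemma aux_eval_rowW: "aux_eval x \<Phi> (rowW z r $ t) = row_of (\<Phi> z) r $ t"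
  by (simp add: aux_eval_def rowW_def aux_val_W del: aux_val.simps)

lemma forall_6: "(\<forall>i::6. P i) \<longleftrightarrow> P 1 \<and> P 2 \<and> P 3 \<and> P 4 \<and> P 5 \<and> P 6"
  using UNIV_6 by (metis UNIV_I empty_iff insert_iff)

lemma aux_eval_pV_pW: "aux_eval x \<Phi> (pV * pW) = filling_dets \<Phi>"
proof -
  have 3: "(\<chi> i j. aux_eval x \<Phi> ((vector [r1, r2, r3] :: auxpoly ^ 3 ^ 3) $ i $ j)) =
     (vector [\<chi> j. aux_eval x \<Phi> (r1 $ j), \<chi> j. aux_eval x \<Phi> (r2 $ j), \<chi> j. aux_eval x \<Phi> (r3 $ j)] :: complex ^ 3 ^ 3)" for r1 r2 r3
    by (simp add: vec_eq_iff forall_3 vector_3)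
  have 6: "(\<chi> i j. aux_eval x \<Phi> ((vector [r1, r2, r3, r4, r5, r6] :: auxpoly ^ 6 ^ 6) $ i $ j)) =
     (vector [\<chi> j. aux_eval x \<Phi> (r1 $ j), \<chi> j. aux_eval x \<Phi> (r2 $ j), \<chi> j. aux_eval x \<Phi> (r3 $ j),
       \<chi> j. aux_eval x \<Phi> (r4 $ j), \<chi> j. aux_eval x \<Phi> (r5 $ j), \<chi> j. aux_eval x \<Phi> (r6 $ j)] :: complex ^ 6 ^ 6)" for r1 r2 r3 r4 r5 r6
    unfolding vec_eq_iff[of _ "vector [_, _, _, _, _, _]"] forall_6 by simp
  have mult: "aux_eval x \<Phi> (G * H) = aux_eval x \<Phi> G * aux_eval x \<Phi> H" for G H
    by (simp add: aux_eval_def meval_hom.peval_mult)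
  show ?thesis
    unfolding pV_def pW_def filling_dets_def mult aux_eval_det 3 6 aux_eval_rowV aux_eval_rowW
    by simp
qed

definition expand_sum :: "('s \<Rightarrow> point) \<Rightarrow> 's set \<Rightarrow> letter \<Rightarrow> ((letter \<Rightarrow> point) \<Rightarrow> complex) \<Rightarrow> (letter \<Rightarrow> point) \<Rightarrow> complex" where
  "expand_sum P S z K \<Phi> = (\<Sum>s\<in>S. expand_at z K \<Phi> (P s))"

text \<open>
  Contraction with a decomposable tensor substitutes its four vectors for the variables of the
  letter and antisymmetrises in the three vectors of the wedge product. So at a sum of
  decomposable tensors the polynomial is the sum, over all assignments of summands to the six
  letters, of antisymmetrised products of determinants.
\<close>
theorem meval_FF_points:
  "meval FF (\<lambda>t. (\<Sum>s\<in>S. tw (P s)) $ t) =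
     fold (expand_sum P S) [La, Lb, Lc, Ld, Le, Lf] filling_dets \<Phi>"
proof -
  define x where "x = (\<lambda>t. (\<Sum>s\<in>S. tw (P s)) $ t)"
  have x: "\<And>t. x t = (\<Sum>s\<in>S. tw (P s) $ t)" by (simp add: x_def)
  have step: "(\<lambda>\<Phi>. aux_eval x \<Phi> (contraction_step z G)) = expand_sum P S z (\<lambda>\<Phi>. aux_eval x \<Phi> G)"
    if "\<And>b. block_hom z b 1 G" for z G
    unfolding expand_sum_def using aux_eval_contraction_step_points[OF that x] by blast
  note bh = block_hom_contraction_step block_hom_pV_pW
  have "meval FF x = aux_eval x \<Phi> contracted"
    by (simp add: contracted_eq aux_eval_def)
  moreover have "(\<lambda>\<Phi>. aux_eval x \<Phi> contracted) =
      fold (expand_sum P S) [La, Lb, Lc, Ld, Le, Lf] (\<lambda>\<Phi>. aux_eval x \<Phi> (pV * pW))"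
    unfolding contracted_def fold.simps o_def id_def
    by (subst step, (intro bh; simp))+ simp
  ultimately show ?thesis unfolding x_def aux_eval_pV_pW by metis
qed

section \<open>Symmetries\<close>
lemma det_swap:
  fixes A B :: "'a::comm_ring_1 ^ 'n ^ 'n"
  assumes "i \<noteq> j" "\<And>k. B $ k = A $ Transposition.transpose i j k"
  shows "det B = - det A"
proof -
  have "B = (\<chi> k. A $ Transposition.transpose i j k)" by (simp add: vec_eq_iff assms(2))
  then show ?thesis
    using det_permute_rows[of "Transposition.transpose i j" A] assms(1)
    by (simp add: permutes_swap_id sign_swap_id)
qed

lemma det_swap_6:
  fixes a b c d e f :: "complex ^ 6"
  shows "det (vector [b, a, c, d, e, f] :: complex ^ 6 ^ 6) = - det (vector [a, b, c, d, e, f] :: complex ^ 6 ^ 6)"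
    and "det (vector [a, c, b, d, e, f] :: complex ^ 6 ^ 6) = - det (vector [a, b, c, d, e, f] :: complex ^ 6 ^ 6)"
    and "det (vector [a, b, d, c, e, f] :: complex ^ 6 ^ 6) = - det (vector [a, b, c, d, e, f] :: complex ^ 6 ^ 6)"
    and "det (vector [a, b, c, e, d, f] :: complex ^ 6 ^ 6) = - det (vector [a, b, c, d, e, f] :: complex ^ 6 ^ 6)"
    and "det (vector [a, b, c, d, f, e] :: complex ^ 6 ^ 6) = - det (vector [a, b, c, d, e, f] :: complex ^ 6 ^ 6)"
proof -
  have all: "\<And>k. P k" if "P 1 \<and> P 2 \<and> P 3 \<and> P 4 \<and> P 5 \<and> P (6::6)" for P
    using that forall_6 by blast
  show "det (vector [b, a, c, d, e, f] :: complex ^ 6 ^ 6) = - det (vector [a, b, c, d, e, f] :: complex ^ 6 ^ 6)"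
    by (rule det_swap[of 1 2], simp, rule all) (simp add: Transposition.transpose_def)
  show "det (vector [a, c, b, d, e, f] :: complex ^ 6 ^ 6) = - det (vector [a, b, c, d, e, f] :: complex ^ 6 ^ 6)"
    by (rule det_swap[of 2 3], simp, rule all) (simp add: Transposition.transpose_def)
  show "det (vector [a, b, d, c, e, f] :: complex ^ 6 ^ 6) = - det (vector [a, b, c, d, e, f] :: complex ^ 6 ^ 6)"
    by (rule det_swap[of 3 4], simp, rule all) (simp add: Transposition.transpose_def)
  show "det (vector [a, b, c, e, d, f] :: complex ^ 6 ^ 6) = - det (vector [a, b, c, d, e, f] :: complex ^ 6 ^ 6)"
    by (rule det_swap[of 4 5], simp, rule all) (simp add: Transposition.transpose_def)
  show "det (vector [a, b, c, d, f, e] :: complex ^ 6 ^ 6) = - det (vector [a, b, c, d, e, f] :: complex ^ 6 ^ 6)"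
    by (rule det_swap[of 5 6], simp, rule all) (simp add: Transposition.transpose_def)
qed

fun swap12 :: "point \<Rightarrow> point" where "swap12 (v, a, b, c) = (v, b, a, c)"
fun swap23 :: "point \<Rightarrow> point" where "swap23 (v, a, b, c) = (v, a, c, b)"

text \<open>
  The product of determinants is already alternating in some of the three vectors of a letter
  \<open>z\<close>, namely in those that are rows of the same determinant: all three for
  \<open>a\<close> and \<open>f\<close>, the first two for \<open>b\<close>, the last two for
  \<open>c\<close>, \<open>d\<close> and \<open>e\<close>.
\<close>
definition alternating_at :: "letter \<Rightarrow> ((letter \<Rightarrow> point) \<Rightarrow> complex) \<Rightarrow> bool" where
  "alternating_at z K \<longleftrightarrow>
     (z \<in> {La, Lb, Lf} \<longrightarrow> (\<forall>\<Phi> y. K (\<Phi>(z := swap12 y)) = - K (\<Phi>(z := y)))) \<and>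
     (z \<noteq> Lb \<longrightarrow> (\<forall>\<Phi> y. K (\<Phi>(z := swap23 y)) = - K (\<Phi>(z := y))))"

lemma alternating_filling_dets: "alternating_at z filling_dets"
  unfolding alternating_at_def
proof (intro conjI impI allI)
  fix \<Phi> and y :: point assume z: "z \<in> {La, Lb, Lf}"
  obtain v a b c where y: "y = (v, a, b, c)" using prod_cases4 by blast
  show "filling_dets (\<Phi>(z := swap12 y)) = - filling_dets (\<Phi>(z := y))"
    using z by (auto simp: y filling_dets_def det_swap_6(1)[of b a] det_swap_6(4)[of _ _ _ b a])
next
  fix \<Phi> and y :: point assume z: "z \<noteq> Lb"
  obtain v a b c where y: "y = (v, a, b, c)" using prod_cases4 by blast
  show "filling_dets (\<Phi>(z := swap23 y)) = - filling_dets (\<Phi>(z := y))"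
    using z by (cases z) (auto simp: y filling_dets_def det_swap_6(2)[of _ c b] det_swap_6(3)[of _ _ c b] det_swap_6(5)[of _ _ _ _ c b])
qed

text \<open>
  Representatives of the orders of the three vectors, up to the swaps that only change the sign.
\<close>
definition rotations :: "letter \<Rightarrow> point \<Rightarrow> point list" where
  "rotations z = (\<lambda>(v, a, b, c). if z = La \<or> z = Lf then [(v, a, b, c)] else [(v, a, b, c), (v, b, c, a), (v, c, a, b)])"

definition rotation_sum :: "('s \<Rightarrow> point) \<Rightarrow> 's set \<Rightarrow> letter \<Rightarrow> ((letter \<Rightarrow> point) \<Rightarrow> complex) \<Rightarrow> (letter \<Rightarrow> point) \<Rightarrow> complex" where
  "rotation_sum P S z K \<Phi> = (\<Sum>s\<in>S. \<Sum>y\<leftarrow>rotations z (P s). K (\<Phi>(z := y)))"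

lemma expand_sum_alternating:
  assumes "alternating_at z K"
  shows "expand_sum P S z K \<Phi> = (if z = La \<or> z = Lf then 6 else 2) * rotation_sum P S z K \<Phi>"
  unfolding expand_sum_def rotation_sum_def sum_distrib_left
proof (intro sum.cong refl)
  fix s
  obtain v a b c where y: "P s = (v, a, b, c)" using prod_cases4 by blast
  define k where "k = (\<lambda>a b c. K (\<Phi>(z := (v, a, b, c))))"
  have 1: "k b a c = - k a b c" if "z = La \<or> z = Lb \<or> z = Lf" for a b c
    using assms that unfolding alternating_at_def k_def by (metis insertCI swap12.simps)
  have 2: "k a c b = - k a b c" if "z \<noteq> Lb" for a b c
    using assms that unfolding alternating_at_def k_def by (metis swap23.simps)
  have "alt3 k a b c = (if z = La \<or> z = Lf then 6 * k a b c else 2 * (k a b c + k b c a + k c a b))"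
  proof (cases "z = La \<or> z = Lf")
    case True
    then have "k b c a = k a b c" "k c a b = k a b c" "k b a c = - k a b c" "k a c b = - k a b c" "k c b a = - k a b c"
      using 1[of a b c] 1[of c b a] 1[of a c b] 2[of a b c] 2[of b a c] 2[of c a b] by auto
    then show ?thesis using True by (simp add: alt3_def)
  next
    case F: False
    show ?thesis
    proof (cases "z = Lb")
      case True
      then show ?thesis using 1[of a b c] 1[of c a b] 1[of b c a] by (simp add: alt3_def)
    next
      case False
      then show ?thesis using F 2[of a b c] 2[of b c a] 2[of c a b] by (simp add: alt3_def)
    qed
  qed
  moreover have "expand_at z K \<Phi> (P s) = alt3 k a b c" by (simp add: y k_def)
  ultimately show "expand_at z K \<Phi> (P s) = (if z = La \<or> z = Lf then 6 else 2) * (\<Sum>y\<leftarrow>rotations z (P s). K (\<Phi>(z := y)))"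
    by (simp add: y rotations_def k_def)
qed

lemma alternating_rotation_sum:
  assumes "alternating_at y K" "y \<noteq> z"
  shows "alternating_at y (rotation_sum P S z K)"
proof -
  have *: "rotation_sum P S z K (\<Phi>(y := f p)) = - rotation_sum P S z K (\<Phi>(y := p))"
    if K: "\<And>\<Phi> p. K (\<Phi>(y := f p)) = - K (\<Phi>(y := p))" for f p \<Phi>
    unfolding rotation_sum_def sum_negf[symmetric] fun_upd_twist[OF assms(2)] K
    by (simp add: uminus_sum_list_map o_def)
  show ?thesis
    using assms(1) * unfolding alternating_at_def by blast
qed

lemma expand_sum_scale: "expand_sum P S z (\<lambda>\<Phi>. k * K \<Phi>) \<Phi> = k * expand_sum P S z K \<Phi>"
  unfolding expand_sum_def sum_distrib_left
proof (intro sum.cong refl)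
  fix s
  show "expand_at z (\<lambda>\<Phi>. k * K \<Phi>) \<Phi> (P s) = k * expand_at z K \<Phi> (P s)"
    by (cases "P s") (simp add: alt3_def algebra_simps)
qed

text \<open>
  For \<open>a\<close> and \<open>f\<close> all six orders contribute equally, and for the other
  four letters the orders come in equal pairs. Together this gives the factor \<open>6 ^ 2 * 2 ^
  4 = 576\<close>.
\<close>
theorem meval_FF_rotations:
  "meval FF (\<lambda>t. (\<Sum>s\<in>S. tw (P s)) $ t) =
     576 * fold (rotation_sum P S) [La, Lb, Lc, Ld, Le, Lf] filling_dets \<Phi>"
proof -
  define R where "R = rotation_sum P S"
  have E: "expand_sum P S z (\<lambda>\<Phi>. k * K \<Phi>) = (\<lambda>\<Phi>. (k * (if z = La \<or> z = Lf then 6 else 2)) * R z K \<Phi>)"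
    if "alternating_at z K" for z k K
    unfolding R_def using expand_sum_alternating[OF that, of P S] expand_sum_scale[of P S z k K] by (simp add: fun_eq_iff)
  have alt: "alternating_at y (R z K)" if "alternating_at y K" "y \<noteq> z" for y z K
    unfolding R_def using that by (rule alternating_rotation_sum)
  note A = alt alternating_filling_dets
  have "fold (expand_sum P S) [La, Lb, Lc, Ld, Le, Lf] (\<lambda>\<Phi>. 1 * filling_dets \<Phi>) =
     (\<lambda>\<Phi>. 576 * fold R [La, Lb, Lc, Ld, Le, Lf] filling_dets \<Phi>)"
    unfolding fold.simps o_def id_def
    by (subst E, (intro A; simp))+ simp
  then have "fold (expand_sum P S) [La, Lb, Lc, Ld, Le, Lf] filling_dets \<Phi> = 576 * fold R [La, Lb, Lc, Ld, Le, Lf] filling_dets \<Phi>"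
    by (simp add: fun_eq_iff)
  then show ?thesis unfolding meval_FF_points[of P S \<Phi>] R_def .
qed

fun transform :: "complex ^ 3 ^ 3 \<Rightarrow> complex ^ 6 ^ 6 \<Rightarrow> point \<Rightarrow> point" where
  "transform g h (v, a, b, c) = (g *v v, h *v a, h *v b, h *v c)"

lemma det_transform_rows:
  fixes A B :: "complex ^ 'n ^ 'n"
  assumes "\<And>i. B $ i = g *v (A $ i)"
  shows "det B = det g * det A"
proof -
  have "B = A ** transpose g"
    by (simp add: vec_eq_iff assms matrix_vector_mult_def matrix_matrix_mult_def transpose_def mult.commute)
  then show ?thesis by (simp add: det_mul det_transpose)
qed

lemma filling_dets_transform:
  "filling_dets (transform g h \<circ> \<Phi>) = det g ^ 2 * det h ^ 3 * filling_dets \<Phi>"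
proof -
  have 3: "det (vector [g *v a, g *v b, g *v c] :: complex ^ 3 ^ 3) = det g * det (vector [a, b, c] :: complex ^ 3 ^ 3)" for a b c
  proof (rule det_transform_rows)
    fix i :: 3
    consider "i = 1" | "i = 2" | "i = 3" using exhaust_3 by blast
    then show "(vector [g *v a, g *v b, g *v c] :: complex ^ 3 ^ 3) $ i = g *v ((vector [a, b, c] :: complex ^ 3 ^ 3) $ i)"
      by cases (simp_all only: vector_3)
  qed
  have 6: "det (vector [h *v a, h *v b, h *v c, h *v d, h *v e, h *v f] :: complex ^ 6 ^ 6) =
      det h * det (vector [a, b, c, d, e, f] :: complex ^ 6 ^ 6)" for a b c d e f
  proof (rule det_transform_rows)
    fix i :: 6
    consider "i = 1" | "i = 2" | "i = 3" | "i = 4" | "i = 5" | "i = 6" using UNIV_6 by blast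
    then show "(vector [h *v a, h *v b, h *v c, h *v d, h *v e, h *v f] :: complex ^ 6 ^ 6) $ i =
       h *v ((vector [a, b, c, d, e, f] :: complex ^ 6 ^ 6) $ i)"
      by cases (simp_all only: vector_6)
  qed
  have v: "fst (transform g h y) = g *v fst y" for y
    by (cases y) simp
  have r: "row_of (transform g h y) s = h *v row_of y s" for y s
    by (cases y) auto
  show ?thesis
    unfolding filling_dets_def o_def v r 3 6 by (simp add: power2_eq_square power3_eq_cube)
qed

lemma fold_Cons_apply: "fold f (z # zs) k x = fold f zs (f z k) x"
  by simp

text \<open>
  Transforming all vectors multiplies each of the two determinants of size three by \<open>det
  g\<close> and each of the three of size six by \<open>det h\<close>.
\<close>
theorem meval_FF_transform:
  "meval FF (\<lambda>t. (\<Sum>s\<in>S. tw (transform g h (P s))) $ t) =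
     det g ^ 2 * det h ^ 3 * meval FF (\<lambda>t. (\<Sum>s\<in>S. tw (P s)) $ t)"
proof -
  let ?k = "det g ^ 2 * det h ^ 3"
  have step: "expand_sum (transform g h \<circ> P) S z K' (transform g h \<circ> \<Phi>) = ?k * expand_sum P S z K \<Phi>"
    if K: "\<And>\<Phi>. K' (transform g h \<circ> \<Phi>) = ?k * K \<Phi>" for z K K' \<Phi>
    unfolding expand_sum_def sum_distrib_left
  proof (intro sum.cong refl)
    fix s
    obtain v a b c where y: "P s = (v, a, b, c)" using prod_cases4 by blast
    have "K' ((transform g h \<circ> \<Phi>)(z := (g *v v, h *v a, h *v b, h *v c))) = ?k * K (\<Phi>(z := (v, a, b, c)))" for a b c
      unfolding K[symmetric] by (rule arg_cong[of _ _ K']) auto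
    then show "expand_at z K' (transform g h \<circ> \<Phi>) ((transform g h \<circ> P) s) = ?k * expand_at z K \<Phi> (P s)"
      by (simp add: y alt3_def algebra_simps)
  qed
  fix \<Phi> :: "letter \<Rightarrow> point"
  have gen: "fold (expand_sum (transform g h \<circ> P) S) zs K' (transform g h \<circ> \<Phi>) = ?k * fold (expand_sum P S) zs K \<Phi>"
    if "\<And>\<Phi>. K' (transform g h \<circ> \<Phi>) = ?k * K \<Phi>" for zs K K' \<Phi>
    using that
  proof (induction zs arbitrary: K K')
    case (Cons z zs)
    show ?case unfolding fold_Cons_apply
    proof (rule Cons.IH)
      fix \<Phi>
      show "expand_sum (transform g h \<circ> P) S z K' (transform g h \<circ> \<Phi>) = ?k * expand_sum P S z K \<Phi>"
        by (rule step) (rule Cons.prems)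
    qed
  qed simp
  have "meval FF (\<lambda>t. (\<Sum>s\<in>S. tw ((transform g h \<circ> P) s)) $ t) =
      fold (expand_sum (transform g h \<circ> P) S) [La, Lb, Lc, Ld, Le, Lf] filling_dets (transform g h \<circ> \<Phi>)"
    by (rule meval_FF_points)
  also have "\<dots> = ?k * fold (expand_sum P S) [La, Lb, Lc, Ld, Le, Lf] filling_dets \<Phi>"
    by (rule gen) (rule filling_dets_transform)
  also have "\<dots> = ?k * meval FF (\<lambda>t. (\<Sum>s\<in>S. tw (P s)) $ t)"
    by (simp only: meval_FF_points[of P S \<Phi>])
  finally show ?thesis by (simp only: o_apply)
qed

section \<open>Computing coefficients\<close>
text \<open>
  Indices form an enumeration type, and all functions below recurse on constructors, so that the
  sums can be evaluated by rewriting.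
\<close>
datatype digit = D1 | D2 | D3 | D4 | D5 | D6

fun number :: "digit \<Rightarrow> nat" where
  "number D1 = 1" | "number D2 = 2" | "number D3 = 3" | "number D4 = 4" | "number D5 = 5" | "number D6 = 6"

fun before :: "digit \<Rightarrow> digit \<Rightarrow> bool" where
  "before D1 D1 = False" | "before D1 y = True"
| "before D2 D1 = False" | "before D2 D2 = False" | "before D2 y = True"
| "before D3 D4 = True" | "before D3 D5 = True" | "before D3 D6 = True" | "before D3 y = False"
| "before D4 D5 = True" | "before D4 D6 = True" | "before D4 y = False"
| "before D5 D6 = True" | "before D5 y = False"
| "before D6 y = False"

lemma number_eq_iff: "number x = number y \<longleftrightarrow> x = y"
  by (cases x; cases y) simp_all

lemma before_iff: "before x y \<longleftrightarrow> number x < number y"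
  by (cases x; cases y) simp_all

instantiation digit :: linorder
begin

definition "x \<le> y \<longleftrightarrow> number x \<le> number y" for x y :: digit
definition "x < y \<longleftrightarrow> number x < number y" for x y :: digit

instance
  by standard (auto simp: less_eq_digit_def less_digit_def number_eq_iff)

end

type_synonym item = "digit \<times> digit \<times> digit \<times> digit"
type_synonym columns = "digit list \<times> digit list \<times> digit list \<times> digit list \<times> digit list"

text \<open>
  An item \<open>(i, p, q, r)\<close> stands for the tensor of \<open>e\<^sub>i\<close> and the
  wedge product of \<open>e\<^sub>p\<close>, \<open>e\<^sub>q\<close>, \<open>e\<^sub>r\<close>.
  The five lists are the rows of the two determinants of \<open>pV\<close> and of the three
  determinants of \<open>pW\<close>, filled from the last letter to the first.
\<close>
fun place :: "letter \<Rightarrow> item \<Rightarrow> columns \<Rightarrow> columns" where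
  "place La (i, p, q, r) (v1, v2, w1, w2, w3) = (i # v1, v2, p # q # r # w1, w2, w3)"
| "place Lb (i, p, q, r) (v1, v2, w1, w2, w3) = (i # v1, v2, r # w1, p # q # w2, w3)"
| "place Lc (i, p, q, r) (v1, v2, w1, w2, w3) = (v1, i # v2, q # r # w1, w2, p # w3)"
| "place Ld (i, p, q, r) (v1, v2, w1, w2, w3) = (i # v1, v2, w1, q # r # w2, p # w3)"
| "place Le (i, p, q, r) (v1, v2, w1, w2, w3) = (v1, i # v2, w1, q # r # w2, p # w3)"
| "place Lf (i, p, q, r) (v1, v2, w1, w2, w3) = (v1, i # v2, w1, w2, p # q # r # w3)"

fun rots :: "letter \<Rightarrow> item \<Rightarrow> item list" where
  "rots La y = [y]"
| "rots Lf y = [y]"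
| "rots Lb (i, p, q, r) = [(i, p, q, r), (i, q, r, p), (i, r, p, q)]"
| "rots Lc (i, p, q, r) = [(i, p, q, r), (i, q, r, p), (i, r, p, q)]"
| "rots Ld (i, p, q, r) = [(i, p, q, r), (i, q, r, p), (i, r, p, q)]"
| "rots Le (i, p, q, r) = [(i, p, q, r), (i, q, r, p), (i, r, p, q)]"

fun ins_sign :: "digit \<Rightarrow> digit list \<Rightarrow> int" where
  "ins_sign x [] = 1"
| "ins_sign x (y # ys) = (if x = y then 0 else if before x y then 1 else - 1) * ins_sign x ys"

text \<open>
  The sign of the permutation that sorts the list, and zero if an entry is repeated.
\<close>
fun eps :: "digit list \<Rightarrow> int" where
  "eps [] = 1"
| "eps (x # xs) = ins_sign x xs * eps xs"

fun columns_sign :: "columns \<Rightarrow> int" where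
  "columns_sign (v1, v2, w1, w2, w3) = eps v1 * eps v2 * (eps w1 * eps w2 * eps w3)"

fun fresh :: "letter \<Rightarrow> item \<Rightarrow> columns \<Rightarrow> bool" where
  "fresh La (i, p, q, r) (v1, v2, w1, w2, w3) = (i \<notin> set v1 \<and> p \<notin> set w1 \<and> q \<notin> set w1 \<and> r \<notin> set w1)"
| "fresh Lb (i, p, q, r) (v1, v2, w1, w2, w3) = (i \<notin> set v1 \<and> r \<notin> set w1 \<and> p \<notin> set w2 \<and> q \<notin> set w2)"
| "fresh Lc (i, p, q, r) (v1, v2, w1, w2, w3) = (i \<notin> set v2 \<and> q \<notin> set w1 \<and> r \<notin> set w1 \<and> p \<notin> set w3)"
| "fresh Ld (i, p, q, r) (v1, v2, w1, w2, w3) = (i \<notin> set v1 \<and> q \<notin> set w2 \<and> r \<notin> set w2 \<and> p \<notin> set w3)"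
| "fresh Le (i, p, q, r) (v1, v2, w1, w2, w3) = (i \<notin> set v2 \<and> q \<notin> set w2 \<and> r \<notin> set w2 \<and> p \<notin> set w3)"
| "fresh Lf (i, p, q, r) (v1, v2, w1, w2, w3) = (i \<notin> set v2 \<and> p \<notin> set w3 \<and> q \<notin> set w3 \<and> r \<notin> set w3)"

text \<open>
  The sum of the signs over all distinct ways to distribute the items over the letters and to
  rotate them. An item that equals an earlier one is not tried again at the same letter, and a
  branch is cut as soon as a determinant has two equal rows.
\<close>
function (sequential) arrange :: "letter list \<Rightarrow> columns \<Rightarrow> item list \<Rightarrow> item list \<Rightarrow> int"
  and arrange_all :: "letter list \<Rightarrow> columns list \<Rightarrow> item list \<Rightarrow> int" where
  "arrange [] c seen todo = columns_sign c"
| "arrange (z # zs) c seen [] = 0"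
| "arrange (z # zs) c seen (x # xs) =
     arrange_all zs (map (\<lambda>y. place z y c) (filter (\<lambda>y. x \<notin> set seen \<and> fresh z y c) (rots z x))) (seen @ xs) + arrange (z # zs) c (seen @ [x]) xs"
| "arrange_all zs [] r = 0"
| "arrange_all zs (c # cs) r = arrange zs c [] r + arrange_all zs cs r"
  by pat_completeness auto
termination
  by (relation "measures [case_sum (\<lambda>(zs, _). 2 * length zs) (\<lambda>(zs, _). 2 * length zs + 1),
      case_sum (\<lambda>(_, _, _, xs). length xs) (\<lambda>(_, cs, _). length cs)]") auto

definition letters :: "letter list" where
  "letters = [Lf, Le, Ld, Lc, Lb, La]"

definition arrangement_sum :: "item list \<Rightarrow> int" where
  "arrangement_sum xs = arrange letters ([], [], [], [], []) [] xs"

fun fits :: "digit \<times> digit \<times> digit \<Rightarrow> digit list \<Rightarrow> bool" where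
  "fits (p, q, r) u = (p \<in> set u \<and> q \<in> set u \<and> r \<in> set u)"

fun use_up :: "digit \<times> digit \<times> digit \<Rightarrow> digit list \<Rightarrow> digit list" where
  "use_up (p, q, r) u = remove1 r (remove1 q (remove1 p u))"

text \<open>
  The choices of \<open>n\<close> triples, with repetition and listed in the order of
  \<open>js\<close>, whose entries together can be taken from \<open>u\<close>.
\<close>
function (sequential) pick :: "nat \<Rightarrow> (digit \<times> digit \<times> digit) list \<Rightarrow> digit list \<Rightarrow> (digit \<times> digit \<times> digit) list list"
  and pick_if :: "bool \<Rightarrow> nat \<Rightarrow> digit \<times> digit \<times> digit \<Rightarrow> (digit \<times> digit \<times> digit) list \<Rightarrow> digit list \<Rightarrow> (digit \<times> digit \<times> digit) list list" where
  "pick 0 js u = [[]]"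
| "pick (Suc n) [] u = []"
| "pick (Suc n) (j # js) u = pick_if (fits j u) n j js u @ pick (Suc n) js u"
| "pick_if True n j js u = map ((#) j) (pick n (j # js) (use_up j u))"
| "pick_if False n j js u = []"
  by pat_completeness auto
termination
  by (relation "measures [case_sum (\<lambda>(n, _). 2 * n) (\<lambda>(_, n, _). 2 * n + 1), case_sum (\<lambda>(_, js, _). length js) (\<lambda>_. 0)]") auto

definition triples :: "(digit \<times> digit \<times> digit) list" where
  "triples = [(D1,D2,D3),(D1,D2,D4),(D1,D2,D5),(D1,D2,D6),(D1,D3,D4),(D1,D3,D5),(D1,D3,D6),(D1,D4,D5),(D1,D4,D6),(D1,D5,D6),
     (D2,D3,D4),(D2,D3,D5),(D2,D3,D6),(D2,D4,D5),(D2,D4,D6),(D2,D5,D6),(D3,D4,D5),(D3,D4,D6),(D3,D5,D6),(D4,D5,D6)]"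

text \<open>
  The two equal items at the front stand for the square of the first coordinate.
\<close>
fun all_arrangement_sums_zero :: "(digit \<times> digit \<times> digit) list \<Rightarrow> digit list list \<Rightarrow> bool" where
  "all_arrangement_sums_zero js [] = True"
| "all_arrangement_sums_zero js (is # iss) =
     (arrangement_sum ((D1,D1,D2,D3) # (D1,D1,D2,D3) # zip is js) = 0 \<and> all_arrangement_sums_zero js iss)"

definition halves :: "digit list list" where
  "halves = [[D2,D2,D3,D3],[D2,D3,D2,D3],[D2,D3,D3,D2],[D3,D2,D2,D3],[D3,D2,D3,D2],[D3,D3,D2,D2]]"

fun all_zero :: "(digit \<times> digit \<times> digit) list list \<Rightarrow> bool" where
  "all_zero [] = True"
| "all_zero (js # jss) = (all_arrangement_sums_zero js halves \<and> all_zero jss)"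

section \<open>Signs\<close>

lemma before_less: "before x y \<longleftrightarrow> x < y"
  by (simp add: before_iff less_digit_def)

lemma ins_sign_mset: "mset xs = mset ys \<Longrightarrow> ins_sign x xs = ins_sign x ys"
proof -
  have "ins_sign x xs = prod_mset (image_mset (\<lambda>y. if x = y then 0 else if before x y then 1 else - 1) (mset xs))" for xs
    by (induction xs) simp_all
  then show "mset xs = mset ys \<Longrightarrow> ins_sign x xs = ins_sign x ys" by simp
qed

lemma ins_sign_0: "x \<in> set ys \<Longrightarrow> ins_sign x ys = 0"
  by (induction ys) auto

lemma eps_not_distinct: "\<not> distinct xs \<Longrightarrow> eps xs = 0"
  by (induction xs) (auto simp: ins_sign_0)

lemma alternating_insort:
  fixes f :: "digit list \<Rightarrow> complex"
  assumes alt: "\<And>ys a b zs. length (ys @ a # b # zs) = n \<Longrightarrow> f (ys @ a # b # zs) = - f (ys @ b # a # zs)"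
  shows "length (ys @ x # zs) = n \<Longrightarrow> sorted zs \<Longrightarrow> x \<notin> set zs \<Longrightarrow>
    f (ys @ x # zs) = of_int (ins_sign x zs) * f (ys @ insort x zs)"
proof (induction zs arbitrary: ys)
  case Nil
  then show ?case by simp
next
  case (Cons y zs)
  show ?case
  proof (cases "x < y")
    case True
    have "ins_sign x zs = 1" if "\<forall>z\<in>set zs. x < z" for zs
      using that by (induction zs) (auto simp: before_less)
    then have "ins_sign x zs = 1" using True Cons.prems by fastforce
    then show ?thesis using True by (auto simp: before_less)
  next
    case False
    have "f (ys @ x # y # zs) = - f ((ys @ [y]) @ x # zs)"
      using alt[of ys x y zs] Cons.prems(1) by simp
    also have "\<dots> = - (of_int (ins_sign x zs) * f ((ys @ [y]) @ insort x zs))"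
      using Cons.IH[of "ys @ [y]"] Cons.prems by simp
    finally show ?thesis using False Cons.prems by (auto simp: before_less)
  qed
qed

lemma alternating_sort:
  fixes f :: "digit list \<Rightarrow> complex"
  assumes alt: "\<And>ys a b zs. length (ys @ a # b # zs) = n \<Longrightarrow> f (ys @ a # b # zs) = - f (ys @ b # a # zs)"
  shows "length (ys @ xs) = n \<Longrightarrow> distinct xs \<Longrightarrow> f (ys @ xs) = of_int (eps xs) * f (ys @ sort xs)"
proof (induction xs arbitrary: ys)
  case Nil
  then show ?case by simp
next
  case (Cons x xs)
  have "f (ys @ x # xs) = f ((ys @ [x]) @ xs)" by simp
  also have "\<dots> = of_int (eps xs) * f ((ys @ [x]) @ sort xs)"
    using Cons by (intro Cons.IH) auto
  also have "f ((ys @ [x]) @ sort xs) = of_int (ins_sign x (sort xs)) * f (ys @ insort x (sort xs))"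
  proof -
    have "f (ys @ x # sort xs) = of_int (ins_sign x (sort xs)) * f (ys @ insort x (sort xs))"
      by (rule alternating_insort[where n = n and f = f], erule alt) (use Cons.prems in simp_all)
    then show ?thesis by simp
  qed
  also have "ins_sign x (sort xs) = ins_sign x xs" by (rule ins_sign_mset) simp
  finally show ?case by simp
qed

definition unit_vec :: "digit \<Rightarrow> complex ^ ('n::{finite, semiring_1})" where
  "unit_vec k = axis (of_nat (number k)) 1"

lemma of_nat_3_eq_iff:
  assumes "a \<in> {1..3}" "b \<in> {1..3}"
  shows "(of_nat a :: 3) = of_nat b \<longleftrightarrow> a = b"
proof -
  have "a \<in> {1, 2, 3}" "b \<in> {1, 2, 3}" using assms by auto
  then show ?thesis by auto
qed

lemma of_nat_6_eq_iff:
  assumes "a \<in> {1..6}" "b \<in> {1..6}"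
  shows "(of_nat a :: 6) = of_nat b \<longleftrightarrow> a = b"
proof -
  have "a \<in> {1, 2, 3, 4, 5, 6}" "b \<in> {1, 2, 3, 4, 5, 6}" using assms by auto
  then show ?thesis by auto
qed

lemma list_length_6:
  assumes "length xs = 6"
  obtains a b c d e f where "xs = [a, b, c, d, e, f]"
proof -
  have "length xs = Suc (Suc (Suc (Suc (Suc (Suc 0)))))" using assms by simp
  then show ?thesis using that by (auto simp: length_Suc_conv)
qed

lemma vector_6_nth:
  assumes "length xs = 6" "i < 6"
  shows "(vector xs :: 'a::zero ^ 6) $ of_nat (Suc i) = xs ! i"
proof -
  obtain a b c d e f where xs: "xs = [a, b, c, d, e, f]" using list_length_6[OF assms(1)] by blast
  have "i = 0 \<or> i = 1 \<or> i = 2 \<or> i = 3 \<or> i = 4 \<or> i = 5" using assms(2) by linarith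
  then show ?thesis by (elim disjE) (simp_all add: xs)
qed

definition unit_rows_det :: "digit list \<Rightarrow> complex" where
  "unit_rows_det xs = det (vector (map unit_vec xs) :: complex ^ 6 ^ 6)"

lemma unit_rows_det_swap:
  assumes "length (ys @ a # b # zs) = 6"
  shows "unit_rows_det (ys @ a # b # zs) = - unit_rows_det (ys @ b # a # zs)"
proof -
  obtain x1 x2 x3 x4 x5 x6 where xs: "ys @ a # b # zs = [x1, x2, x3, x4, x5, x6]"
    using list_length_6[OF assms] by blast
  have "length ys = 0 \<or> length ys = 1 \<or> length ys = 2 \<or> length ys = 3 \<or> length ys = 4"
  proof -
    have "length ys \<le> 4" using assms by simp
    then show ?thesis by linarith
  qed
  then show ?thesis
  proof (elim disjE)
    assume "length ys = 0"
    then show ?thesis using xs by (auto simp: unit_rows_det_def det_swap_6(1)[of "unit_vec x1" "unit_vec x2"])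
  next
    assume "length ys = 1"
    then show ?thesis using xs
      by (auto simp: length_Suc_conv unit_rows_det_def det_swap_6(2)[of _ "unit_vec x2" "unit_vec x3"])
  next
    assume "length ys = 2"
    then show ?thesis using xs
      by (auto simp: length_Suc_conv numeral_eq_Suc unit_rows_det_def det_swap_6(3)[of _ _ "unit_vec x3" "unit_vec x4"])
  next
    assume "length ys = 3"
    then show ?thesis using xs
      by (auto simp: length_Suc_conv numeral_eq_Suc unit_rows_det_def det_swap_6(4)[of _ _ _ "unit_vec x4" "unit_vec x5"])
  next
    assume "length ys = 4"
    then show ?thesis using xs
      by (auto simp: length_Suc_conv numeral_eq_Suc unit_rows_det_def det_swap_6(5)[of _ _ _ _ "unit_vec x5" "unit_vec x6"])
  qed
qed

lemma unit_rows_det_eq_eps: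
  assumes len: "length xs = 6"
  shows "unit_rows_det xs = of_int (eps xs)"
proof (cases "distinct xs")
  case True
  have U: "(UNIV :: digit set) = {D1, D2, D3, D4, D5, D6}"
    using digit.exhaust by auto
  have "card (set xs) = card (UNIV :: digit set)" using True len by (simp add: distinct_card U)
  then have "set xs = UNIV" by (metis U card_subset_eq finite.emptyI finite.insertI subset_UNIV)
  then have "set (sort xs) = set [D1, D2, D3, D4, D5, D6]" by (simp add: U)
  then have sort: "sort xs = [D1, D2, D3, D4, D5, D6]"
    by (intro sorted_distinct_set_unique) (use True in \<open>auto simp: less_eq_digit_def\<close>)
  have "unit_rows_det [D1, D2, D3, D4, D5, D6] = 1"
  proof -
    have "(vector (map unit_vec [D1, D2, D3, D4, D5, D6]) :: complex ^ 6 ^ 6) = mat 1"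
      unfolding vec_eq_iff forall_6 by (simp add: mat_def axis_def unit_vec_def)
    then show ?thesis by (simp add: unit_rows_det_def del: list.map)
  qed
  then show ?thesis
  proof -
    have "unit_rows_det ([] @ xs) = of_int (eps xs) * unit_rows_det ([] @ sort xs)"
      by (rule alternating_sort[where n = 6 and f = unit_rows_det], erule unit_rows_det_swap) (use len True in simp_all)
    then show ?thesis using \<open>unit_rows_det [D1, D2, D3, D4, D5, D6] = 1\<close> by (simp add: sort)
  qed
next
  case False
  then obtain i j where ij: "i < 6" "j < 6" "i \<noteq> j" "xs ! i = xs ! j"
    using len by (auto simp: distinct_conv_nth)
  have "(of_nat (Suc i) :: 6) \<noteq> of_nat (Suc j)"
    using of_nat_6_eq_iff[of "Suc i" "Suc j"] ij by simp
  moreover have "(vector (map unit_vec xs) :: complex ^ 6 ^ 6) $ of_nat (Suc i) = (vector (map unit_vec xs) :: complex ^ 6 ^ 6) $ of_nat (Suc j)"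
    using vector_6_nth[of "map unit_vec xs :: (complex ^ 6) list" i] vector_6_nth[of "map unit_vec xs :: (complex ^ 6) list" j] ij len by (simp del: of_nat_Suc)
  ultimately have "unit_rows_det xs = 0"
    unfolding unit_rows_det_def by (intro det_identical_rows) (auto simp: row_def vec_eq_iff)
  then show ?thesis using eps_not_distinct[OF False] by simp
qed

lemma det_unit_rows_3:
  assumes "i \<in> {D1, D2, D3}" "j \<in> {D1, D2, D3}" "k \<in> {D1, D2, D3}"
  shows "det (vector [a *s unit_vec i, b *s unit_vec j, c *s unit_vec k] :: complex ^ 3 ^ 3) = a * b * c * of_int (eps [i, j, k])"
  using assms by (elim insertE emptyE) (simp_all add: det_3 vector_3 axis_def unit_vec_def)

section \<open>Coordinates as points\<close>

fun item_point :: "complex \<Rightarrow> item \<Rightarrow> point" where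
  "item_point c (i, p, q, r) = (c *s unit_vec i, unit_vec p, unit_vec q, unit_vec r)"

definition to_digit :: "nat \<Rightarrow> digit" where
  "to_digit n = (if n = 1 then D1 else if n = 2 then D2 else if n = 3 then D3 else if n = 4 then D4 else if n = 5 then D5 else D6)"

lemma number_to_digit: "1 \<le> n \<Longrightarrow> n \<le> 6 \<Longrightarrow> number (to_digit n) = n"
  unfolding to_digit_def by auto

definition coord_item :: "coord \<Rightarrow> item" where
  "coord_item t = (case Rep_coord t of (i, j, k, l) \<Rightarrow> (to_digit i, to_digit j, to_digit k, to_digit l))"

definition valid_item :: "item \<Rightarrow> bool" where
  "valid_item y \<longleftrightarrow> fst y \<in> {D1, D2, D3}"

lemma valid_coord_item: "valid_item (coord_item t)"
proof -
  obtain i j k l where t: "Rep_coord t = (i, j, k, l)" using prod_cases4 by blast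
  then have "i = 1 \<or> i = 2 \<or> i = 3" using Rep_coord[of t] by auto
  then show ?thesis by (auto simp: valid_item_def coord_item_def t to_digit_def)
qed

lemma valid_rots: "valid_item x \<Longrightarrow> y \<in> set (rots z x) \<Longrightarrow> valid_item y"
  by (cases x; cases z) (auto simp: valid_item_def)

lemma rotations_item_point: "rotations z (item_point c y) = map (item_point c) (rots z y)"
  by (cases y; cases z) (simp_all add: rotations_def)

lemma tw_item_point: "tw (item_point c (coord_item t)) = c *s axis t 1"
proof (rule vec_eq_iff[THEN iffD2], rule allI)
  fix u :: coord
  obtain i j k l where t: "Rep_coord t = (i, j, k, l)" using prod_cases4 by blast
  obtain i' j' k' l' where u: "Rep_coord u = (i', j', k', l')" using prod_cases4 by blast
  have ut: "u = t \<longleftrightarrow> i' = i \<and> j' = j \<and> k' = k \<and> l' = l"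
    using Rep_coord_inject[of u t] by (simp add: t u)
  have "1 \<le> i" "i \<le> 3" "1 \<le> j" "j < k" "k < l" "l \<le> 6" "1 \<le> i'" "i' \<le> 3" "1 \<le> j'" "j' < k'" "k' < l'" "l' \<le> 6"
    using Rep_coord[of t] Rep_coord[of u] by (auto simp: t u)
  then show "tw (item_point c (coord_item t)) $ u = (c *s axis t 1) $ u"
    unfolding coord_item_def t prod.case item_point.simps tw.simps tensor_wedge_nth[OF u]
    by (auto simp: alt3_def axis_def unit_vec_def ut of_nat_3_eq_iff of_nat_6_eq_iff number_to_digit)
qed

definition place_all :: "letter list \<Rightarrow> (letter \<Rightarrow> item) \<Rightarrow> columns" where
  "place_all zs it = foldl (\<lambda>c z. place z (it z) c) ([], [], [], [], []) zs"

lemma filling_dets_items: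
  assumes "\<And>z. \<Phi> z = item_point (c z) (it z)" "\<And>z. valid_item (it z)"
  shows "filling_dets \<Phi> = (\<Prod>z\<in>set letters. c z) * of_int (columns_sign (place_all letters it))"
proof -
  define I p q r where "I = (\<lambda>z. fst (it z))" and "p = (\<lambda>z. fst (snd (it z)))"
    and "q = (\<lambda>z. fst (snd (snd (it z))))" and "r = (\<lambda>z. snd (snd (snd (it z))))"
  have it: "it z = (I z, p z, q z, r z)" for z
    by (simp add: I_def p_def q_def r_def)
  have v: "I z \<in> {D1, D2, D3}" for z
    using assms(2)[of z] by (simp add: it valid_item_def)
  have 6: "det (vector [unit_vec a, unit_vec b, unit_vec c, unit_vec d, unit_vec e, unit_vec f] :: complex ^ 6 ^ 6) = of_int (eps [a, b, c, d, e, f])" for a b c d e f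
    using unit_rows_det_eq_eps[of "[a, b, c, d, e, f]"] by (simp add: unit_rows_det_def del: eps.simps)
  show ?thesis
    unfolding filling_dets_def assms(1) it place_all_def letters_def
    by (simp add: det_unit_rows_3[OF v v v] 6 del: eps.simps)
qed

section \<open>Expansion\<close>

fun placement_sum :: "letter list \<Rightarrow> columns \<Rightarrow> item list \<Rightarrow> int" where
  "placement_sum [] c l = columns_sign c"
| "placement_sum (z # zs) c [] = 0"
| "placement_sum (z # zs) c (x # l) = (\<Sum>y\<leftarrow>rots z x. placement_sum zs (place z y c) l)"

lemma finite_lists: "finite {l :: 'a::finite list. length l = n}"
  using finite_lists_length_eq[of "UNIV :: 'a set" n] by simp

lemma sum_lists_Suc:
  fixes f :: "'a::finite list \<Rightarrow> 'b::comm_monoid_add"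
  shows "(\<Sum>l\<in>{l. length l = Suc n}. f l) = (\<Sum>t\<in>UNIV. \<Sum>l\<in>{l. length l = n}. f (t # l))"
  unfolding sum.cartesian_product
  by (rule sum.reindex_bij_witness[of _ "\<lambda>(t, l). t # l" "\<lambda>l. (hd l, tl l)"]) (auto simp: length_Suc_conv)

lemma foldr_rotation_sum_items:
  fixes x :: "coord \<Rightarrow> complex"
  defines "P \<equiv> \<lambda>t. item_point (x t) (coord_item t)"
  assumes "ds @ zs = letters" "\<And>z. z \<in> set ds \<Longrightarrow> \<Phi> z = item_point (c z) (it z)"
    "\<And>z. z \<in> set ds \<Longrightarrow> valid_item (it z)"
  shows "foldr (rotation_sum P UNIV) zs filling_dets \<Phi> = (\<Prod>z\<in>set ds. c z) *
     (\<Sum>l\<in>{l. length l = length zs}. (\<Prod>t\<leftarrow>l. x t) * of_int (placement_sum zs (place_all ds it) (map coord_item l)))"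
  using assms(2-)
proof (induction zs arbitrary: ds \<Phi> c it)
  case Nil
  have all: "z \<in> set ds" for z using Nil(1) by (cases z) (auto simp: letters_def)
  have "filling_dets \<Phi> = (\<Prod>z\<in>set letters. c z) * of_int (columns_sign (place_all letters it))"
    by (rule filling_dets_items) (use Nil all in auto)
  then show ?case using Nil(1) by simp
next
  case (Cons z zs)
  have "distinct letters" by (simp add: letters_def)
  then have z: "z \<notin> set ds" using Cons.prems(1) by (metis distinct_append disjoint_iff list.set_intros(1))
  let ?L = "{l :: coord list. length l = length zs}"
  have "foldr (rotation_sum P UNIV) zs filling_dets (\<Phi>(z := item_point (x t) y)) =
     (\<Prod>z\<in>set ds. c z) * x t * (\<Sum>l\<in>?L. (\<Prod>t\<leftarrow>l. x t) * of_int (placement_sum zs (place z y (place_all ds it)) (map coord_item l)))"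
    if "y \<in> set (rots z (coord_item t))" for t y
  proof -
    have vy: "valid_item y" using valid_rots[OF valid_coord_item that] .
    have pa: "foldl (\<lambda>c u. place u (if u = z then y else it u) c) c0 ds = foldl (\<lambda>c u. place u (it u) c) c0 ds" for c0
      using z by (intro foldl_cong refl) auto
    have "foldr (rotation_sum P UNIV) zs filling_dets (\<Phi>(z := item_point (x t) y)) =
      (\<Prod>u\<in>set (ds @ [z]). (c(z := x t)) u) * (\<Sum>l\<in>?L. (\<Prod>t\<leftarrow>l. x t) *
        of_int (placement_sum zs (place_all (ds @ [z]) (it(z := y))) (map coord_item l)))"
      by (rule Cons.IH) (use Cons.prems z vy in auto)
    moreover have "place_all (ds @ [z]) (it(z := y)) = place z y (place_all ds it)"
      by (simp add: place_all_def fun_upd_def pa)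
    moreover have "(\<Prod>u\<in>set (ds @ [z]). (c(z := x t)) u) = (\<Prod>u\<in>set ds. c u) * x t"
    proof -
      have "(\<Prod>u\<in>set ds. (c(z := x t)) u) = (\<Prod>u\<in>set ds. c u)"
        by (intro prod.cong refl) (use z in auto)
      then show ?thesis using z by (simp add: mult.commute)
    qed
    ultimately show ?thesis by simp
  qed
  then have "foldr (rotation_sum P UNIV) (z # zs) filling_dets \<Phi> =
    (\<Sum>t\<in>UNIV. \<Sum>y\<leftarrow>rots z (coord_item t). (\<Prod>z\<in>set ds. c z) * x t *
       (\<Sum>l\<in>?L. (\<Prod>t\<leftarrow>l. x t) * of_int (placement_sum zs (place z y (place_all ds it)) (map coord_item l))))"
    unfolding foldr.simps o_apply rotation_sum_def P_def rotations_item_point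
    by (intro sum.cong refl arg_cong[where f = sum_list]) (simp add: o_def)
  also have "\<dots> = (\<Prod>z\<in>set ds. c z) * (\<Sum>t\<in>UNIV. \<Sum>l\<in>?L. (\<Prod>t\<leftarrow>t # l. x t) *
       of_int (placement_sum (z # zs) (place_all ds it) (map coord_item (t # l))))"
    unfolding sum_distrib_left
  proof (rule sum.cong[OF refl])
    fix t
    have "(\<Sum>y\<leftarrow>ys. \<Sum>l\<in>?L. (\<Prod>z\<in>set ds. c z) * x t * ((\<Prod>t\<leftarrow>l. x t) * of_int (g y l))) =
       (\<Sum>l\<in>?L. (\<Prod>z\<in>set ds. c z) * ((\<Prod>t\<leftarrow>t # l. x t) * of_int (\<Sum>y\<leftarrow>ys. g y l)))" for ys and g :: "item \<Rightarrow> coord list \<Rightarrow> int"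
      by (induction ys) (simp_all add: sum.distrib[symmetric] algebra_simps)
    then show "(\<Sum>y\<leftarrow>rots z (coord_item t). \<Sum>l\<in>?L. (\<Prod>z\<in>set ds. c z) * x t * ((\<Prod>t\<leftarrow>l. x t) * of_int (placement_sum zs (place z y (place_all ds it)) (map coord_item l)))) =
        (\<Sum>l\<in>?L. (\<Prod>z\<in>set ds. c z) * ((\<Prod>t\<leftarrow>t # l. x t) * of_int (placement_sum (z # zs) (place_all ds it) (map coord_item (t # l)))))"
      by simp
  qed
  also have "\<dots> = (\<Prod>z\<in>set ds. c z) * (\<Sum>l\<in>{l. length l = length (z # zs)}. (\<Prod>t\<leftarrow>l. x t) *
       of_int (placement_sum (z # zs) (place_all ds it) (map coord_item l)))"
    by (simp only: list.size sum_lists_Suc add_0_right add_Suc_right)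
  finally show ?case .
qed

abbreviation no_columns :: columns where "no_columns \<equiv> ([], [], [], [], [])"

text \<open>
  Every tensor is the sum of its sixty coordinate tensors, which are decomposable.
\<close>
lemma meval_FF_placements:
  "meval FF x = 576 * (\<Sum>l\<in>{l. length l = 6}. (\<Prod>t\<leftarrow>l. x t) * of_int (placement_sum letters no_columns (map coord_item l)))"
proof -
  let ?P = "\<lambda>t. item_point (x t) (coord_item t)"
  have len: "length letters = 6" by (simp add: letters_def)
  have "(\<Sum>s\<in>UNIV. tw (?P s)) $ t = x t" for t
    by (simp add: tw_item_point axis_def if_distrib cong: if_cong)
  then have "meval FF x = meval FF (\<lambda>t. (\<Sum>s\<in>UNIV. tw (?P s)) $ t)" by simp
  also have "\<dots> = 576 * foldr (rotation_sum ?P UNIV) letters filling_dets undefined"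
    unfolding meval_FF_rotations[of ?P UNIV undefined] foldr_conv_fold letters_def by simp
  also have "foldr (rotation_sum ?P UNIV) letters filling_dets undefined =
     (\<Sum>l\<in>{l. length l = 6}. (\<Prod>t\<leftarrow>l. x t) * of_int (placement_sum letters no_columns (map coord_item l)))"
    using foldr_rotation_sum_items[of "[]" letters undefined undefined undefined x]
    by (simp add: place_all_def len)
  finally show ?thesis .
qed

definition list_mon :: "'v list \<Rightarrow> ('v \<Rightarrow>\<^sub>0 nat)" where
  "list_mon l = (\<Sum>t\<leftarrow>l. single t 1)"

lemma lookup_list_mon: "lookup (list_mon l) t = count (mset l) t"
  by (induction l) (auto simp: list_mon_def lookup_add lookup_single when_def)

lemma list_mon_eq_iff: "list_mon l = list_mon l' \<longleftrightarrow> mset l = mset l'"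
proof
  assume "list_mon l = list_mon l'"
  then show "mset l = mset l'" by (intro multiset_eqI) (metis lookup_list_mon)
next
  assume "mset l = mset l'"
  then show "list_mon l = list_mon l'" by (intro poly_mapping_eqI) (simp add: lookup_list_mon)
qed

lemma FF_expansion:
  "FF = (\<Sum>l\<in>{l. length l = 6}. single (list_mon l) (576 * of_int (placement_sum letters no_columns (map coord_item l))))"
proof (rule meval_inject)
  fix x :: "coord \<Rightarrow> complex"
  have "monval x (list_mon l) = (\<Prod>t\<leftarrow>l. x t)" for l
    by (induction l) (simp_all add: list_mon_def monval_add)
  then show "meval FF x = meval (\<Sum>l\<in>{l. length l = 6}. single (list_mon l) (576 * of_int (placement_sum letters no_columns (map coord_item l)))) x"
    unfolding meval_FF_placements meval_sum sum_distrib_left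
    by (intro sum.cong refl) (simp add: meval_peval id_hom.peval_single)
qed

lemma lookup_FF:
  "lookup FF (list_mon l0) =
     (if length l0 = 6 then 576 * of_int (\<Sum>l\<in>{l. mset l = mset l0}. placement_sum letters no_columns (map coord_item l)) else 0)"
proof -
  have "lookup FF (list_mon l0) = (\<Sum>l\<in>{l. length l = 6}. if mset l = mset l0 then
      576 * of_int (placement_sum letters no_columns (map coord_item l)) else 0)"
    by (subst FF_expansion) (auto simp: lookup_sum lookup_single list_mon_eq_iff when_def intro!: sum.cong)
  also have "\<dots> = (\<Sum>l\<in>{l. length l = 6 \<and> mset l = mset l0}. 576 * of_int (placement_sum letters no_columns (map coord_item l)))"
    by (rule sum.mono_neutral_cong_right) (auto intro: finite_lists)
  also have "{l. length l = 6 \<and> mset l = mset l0} = (if length l0 = 6 then {l. mset l = mset l0} else {})"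
    by (auto dest: mset_eq_length)
  finally show ?thesis by (simp add: sum_distrib_left)
qed

lemma keys_FF:
  assumes "m \<in> keys FF"
  obtains l where "m = list_mon l" "length l = 6" "placement_sum letters no_columns (map coord_item l) \<noteq> 0"
proof -
  have "keys FF \<subseteq> (\<Union>l\<in>{l. length l = 6}. keys (single (list_mon l) (576 * complex_of_int (placement_sum letters no_columns (map coord_item l)))))"
    by (subst FF_expansion) (rule Poly_Mapping.keys_sum)
  then show ?thesis using assms that by (auto split: if_splits)
qed

section \<open>Arrangements\<close>

fun distinct_columns :: "columns \<Rightarrow> bool" where
  "distinct_columns (v1, v2, w1, w2, w3) \<longleftrightarrow> distinct v1 \<and> distinct v2 \<and> distinct w1 \<and> distinct w2 \<and> distinct w3"

lemma columns_sign_0: "\<not> distinct_columns c \<Longrightarrow> columns_sign c = 0"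
  by (cases c) (auto simp: eps_not_distinct)

lemma distinct_columns_place: "distinct_columns (place z y c) \<Longrightarrow> distinct_columns c"
  by (cases c; cases y; cases z) auto

lemma not_fresh: "\<not> fresh z y c \<Longrightarrow> \<not> distinct_columns (place z y c)"
  by (cases c; cases y; cases z) auto

lemma placement_sum_0: "\<not> distinct_columns c \<Longrightarrow> placement_sum zs c l = 0"
proof (induction zs arbitrary: c l)
  case Nil
  then show ?case by (simp add: columns_sign_0)
next
  case (Cons z zs)
  have "(\<Sum>y\<leftarrow>rots z x. placement_sum zs (place z y c) l) = (\<Sum>y\<leftarrow>rots z x. 0)" for x l
    by (intro arg_cong[where f = sum_list] map_cong refl Cons.IH) (use Cons.prems distinct_columns_place in blast)
  then show ?case by (cases l) simp_all
qed

lemma finite_mset_eq: "finite {l. mset l = M}"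
proof (rule finite_subset)
  show "{l. mset l = M} \<subseteq> {l. set l \<subseteq> set_mset M \<and> length l = size M}" by auto
  show "finite {l. set l \<subseteq> set_mset M \<and> length l = size M}" by (rule finite_lists_length_eq) simp
qed

lemma sum_mset_eq_Cons:
  fixes f :: "'a list \<Rightarrow> int"
  assumes "M \<noteq> {#}"
  shows "(\<Sum>l\<in>{l. mset l = M}. f l) = (\<Sum>x\<in>set_mset M. \<Sum>l\<in>{l. mset l = M - {#x#}}. f (x # l))"
proof -
  have fin: "finite {l. mset l = M - {#x#}}" for x by (rule finite_mset_eq)
  have "(\<Sum>x\<in>set_mset M. \<Sum>l\<in>{l. mset l = M - {#x#}}. f (x # l)) =
    (\<Sum>(x, l)\<in>(SIGMA x:set_mset M. {l. mset l = M - {#x#}}). f (x # l))"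
    by (subst sum.Sigma) (auto simp: fin)
  also have "\<dots> = (\<Sum>l\<in>{l. mset l = M}. f l)"
  proof (rule sum.reindex_bij_witness[of _ "\<lambda>l. (hd l, tl l)" "\<lambda>(x, l). x # l"])
    fix l assume l: "l \<in> {l. mset l = M}"
    then obtain x l' where "l = x # l'" using assms by (cases l) auto
    with l show "(case (hd l, tl l) of (x, l) \<Rightarrow> x # l) = l" "(hd l, tl l) \<in> (SIGMA x:set_mset M. {l. mset l = M - {#x#}})"
      using l by auto
  qed auto
  finally show ?thesis by simp
qed

lemma arrange_all_eq: "arrange_all zs cs r = (\<Sum>c\<leftarrow>cs. arrange zs c [] r)"
  by (induction cs) simp_all

lemma sum_list_filter_0:
  fixes f :: "'a \<Rightarrow> int"
  assumes "\<And>x. x \<in> set xs \<Longrightarrow> \<not> Q x \<Longrightarrow> f x = 0"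
  shows "(\<Sum>x\<leftarrow>filter Q xs. f x) = (\<Sum>x\<leftarrow>xs. f x)"
  using assms by (induction xs) auto

lemma sum_list_sum_swap:
  fixes f :: "'a \<Rightarrow> 'b \<Rightarrow> int"
  shows "(\<Sum>y\<leftarrow>ys. \<Sum>l\<in>L. f y l) = (\<Sum>l\<in>L. \<Sum>y\<leftarrow>ys. f y l)"
  by (induction ys) (simp_all add: sum.distrib)

text \<open>
  At each letter \<open>arrange\<close> runs once through the distinct items of the remaining
  multiset, so it enumerates every list with the given multiset exactly once; the pruned
  branches contribute zero.
\<close>
lemma arrange_eq:
  "length xs = length zs \<Longrightarrow> arrange zs c [] xs = (\<Sum>l\<in>{l. mset l = mset xs}. placement_sum zs c l)"
proof (induction zs arbitrary: c xs)
  case Nil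
  then show ?case by simp
next
  case (Cons z zs)
  have all: "arrange_all zs (map (\<lambda>y. place z y c) (filter (\<lambda>y. fresh z y c) (rots z x))) r =
     (\<Sum>l\<in>{l. mset l = mset r}. placement_sum (z # zs) c (x # l))"
    if r: "length r = length zs" for x r
  proof -
    have "arrange_all zs (map (\<lambda>y. place z y c) (filter (\<lambda>y. fresh z y c) (rots z x))) r =
      (\<Sum>y\<leftarrow>filter (\<lambda>y. fresh z y c) (rots z x). arrange zs (place z y c) [] r)"
      by (simp add: arrange_all_eq o_def)
    also have "\<dots> = (\<Sum>y\<leftarrow>rots z x. arrange zs (place z y c) [] r)"
      by (rule sum_list_filter_0) (simp add: Cons.IH[OF r] placement_sum_0 not_fresh)
    also have "\<dots> = (\<Sum>y\<leftarrow>rots z x. \<Sum>l\<in>{l. mset l = mset r}. placement_sum zs (place z y c) l)"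
      by (simp add: Cons.IH[OF r])
    finally show ?thesis by (simp add: sum_list_sum_swap)
  qed
  have split: "arrange (z # zs) c seen todo = (\<Sum>x\<in>set todo - set seen.
      \<Sum>l\<in>{l. mset l = mset (seen @ todo) - {#x#}}. placement_sum (z # zs) c (x # l))"
    if "length (seen @ todo) = Suc (length zs)" for seen todo
    using that
  proof (induction todo arbitrary: seen)
    case Nil
    then show ?case by simp
  next
    case (Cons x xs)
    have len: "length (seen @ xs) = length zs" using Cons.prems by simp
    have IH: "arrange (z # zs) c (seen @ [x]) xs = (\<Sum>y\<in>set xs - set (seen @ [x]).
        \<Sum>l\<in>{l. mset l = mset (seen @ x # xs) - {#y#}}. placement_sum (z # zs) c (y # l))"
      using Cons.IH[of "seen @ [x]"] Cons.prems by simp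
    have step: "arrange (z # zs) c seen (x # xs) =
        arrange_all zs (map (\<lambda>y. place z y c) (filter (\<lambda>y. x \<notin> set seen \<and> fresh z y c) (rots z x))) (seen @ xs) +
        arrange (z # zs) c (seen @ [x]) xs"
      by (rule arrange.simps)
    show ?case
    proof (cases "x \<in> set seen")
      case True
      then have "filter (\<lambda>y. x \<notin> set seen \<and> fresh z y c) (rots z x) = []"
        by (simp add: filter_empty_conv)
      moreover have "set (x # xs) - set seen = set xs - set (seen @ [x])" using True by auto
      ultimately show ?thesis unfolding step IH by (simp only: list.map arrange_all.simps add_0)
    next
      case False
      then have 1: "(\<lambda>y. x \<notin> set seen \<and> fresh z y c) = (\<lambda>y. fresh z y c)" by simp
      have 2: "mset (seen @ x # xs) - {#x#} = mset (seen @ xs)" by simp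
      have 3: "set (x # xs) - set seen = insert x (set xs - set (seen @ [x]))" using False by auto
      have 4: "finite (set xs - set (seen @ [x]))" "x \<notin> set xs - set (seen @ [x])" by auto
      show ?thesis unfolding step IH 3 sum.insert[OF 4] 1 all[OF len] 2 by (rule refl)
    qed
  qed
  have "arrange (z # zs) c [] xs = (\<Sum>l\<in>{l. mset l = mset xs}. placement_sum (z # zs) c l)"
    using split[of "[]" xs] Cons.prems by (subst sum_mset_eq_Cons) auto
  then show ?case .
qed

lemma to_digit_inj:
  assumes "to_digit m = to_digit n" "1 \<le> m" "m \<le> 6" "1 \<le> n" "n \<le> 6"
  shows "m = n"
  using number_to_digit[OF assms(2,3)] number_to_digit[OF assms(4,5)] assms(1) by metis

lemma inj_coord_item: "inj coord_item"
proof (rule injI)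
  fix t u assume *: "coord_item t = coord_item u"
  obtain i j k l where t: "Rep_coord t = (i, j, k, l)" using prod_cases4 by blast
  obtain i' j' k' l' where u: "Rep_coord u = (i', j', k', l')" using prod_cases4 by blast
  have r: "1 \<le> i" "i \<le> 3" "1 \<le> j" "j < k" "k < l" "l \<le> 6" "1 \<le> i'" "i' \<le> 3" "1 \<le> j'" "j' < k'" "k' < l'" "l' \<le> 6"
    using Rep_coord[of t] Rep_coord[of u] by (auto simp: t u)
  have e: "to_digit i = to_digit i'" "to_digit j = to_digit j'" "to_digit k = to_digit k'" "to_digit l = to_digit l'"
    using * by (simp_all add: coord_item_def t u)
  have "i = i'" by (rule to_digit_inj[OF e(1)]) (use r in linarith)+
  moreover have "j = j'" by (rule to_digit_inj[OF e(2)]) (use r in linarith)+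
  moreover have "k = k'" by (rule to_digit_inj[OF e(3)]) (use r in linarith)+
  moreover have "l = l'" by (rule to_digit_inj[OF e(4)]) (use r in linarith)+
  ultimately show "t = u" using t u Rep_coord_inject[of t u] by simp
qed

theorem lookup_FF_arrangement:
  assumes "length l0 = 6"
  shows "lookup FF (list_mon l0) = 576 * of_int (arrangement_sum (map coord_item l0))"
proof -
  have "(\<Sum>l\<in>{l. mset l = mset l0}. placement_sum letters no_columns (map coord_item l)) =
     (\<Sum>l\<in>{l. mset l = mset (map coord_item l0)}. placement_sum letters no_columns l)"
  proof (rule sum.reindex_bij_witness[of _ "map (inv_into UNIV coord_item)" "map coord_item"])
    fix l assume "l \<in> {l. mset l = mset (map coord_item l0)}"
    then have l: "mset l = image_mset coord_item (mset l0)" by simp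
    then have "set l \<subseteq> range coord_item" by (metis image_subset_iff rangeI set_image_mset set_mset_mset subsetI)
    then show "map coord_item (map (inv_into UNIV coord_item) l) = l"
      by (auto simp: f_inv_into_f intro!: map_idI)
    have "mset (map (inv_into UNIV coord_item) l) = image_mset (inv_into UNIV coord_item) (image_mset coord_item (mset l0))" by (simp add: l)
    also have "\<dots> = mset l0" using inj_coord_item by (simp add: multiset.map_comp)
    finally show "map (inv_into UNIV coord_item) l \<in> {l. mset l = mset l0}" by simp
  qed (use inj_coord_item in auto)
  then show ?thesis
    using arrange_eq[of "map coord_item l0" letters no_columns] assms
    by (simp add: lookup_FF arrangement_sum_def letters_def)
qed

section \<open>Weights\<close>

fun digits_of :: "item \<Rightarrow> digit multiset" where
  "digits_of (i, p, q, r) = {#p, q, r#}"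

lemma rots_same: "y \<in> set (rots z x) \<Longrightarrow> fst y = fst x \<and> digits_of y = digits_of x"
  by (cases x; cases z) auto

lemma placement_sum_nonzero:
  "placement_sum zs c l \<noteq> 0 \<Longrightarrow> length l = length zs \<Longrightarrow>
    \<exists>ys. map fst ys = map fst l \<and> map digits_of ys = map digits_of l \<and>
      columns_sign (foldl (\<lambda>c (z, y). place z y c) c (zip zs ys)) \<noteq> 0"
proof (induction zs arbitrary: c l)
  case Nil
  then show ?case by simp
next
  case (Cons z zs)
  then obtain x l' where l: "l = x # l'" by (cases l) auto
  have "\<exists>y\<in>set (rots z x). placement_sum zs (place z y c) l' \<noteq> 0"
  proof (rule ccontr)
    assume "\<not> ?thesis"
    then have "(\<Sum>y\<leftarrow>rots z x. placement_sum zs (place z y c) l') = (\<Sum>y\<leftarrow>rots z x. 0)"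
      by (intro arg_cong[where f = sum_list] map_cong) auto
    then show False using Cons.prems by (simp add: l)
  qed
  then obtain y where y: "y \<in> set (rots z x)" "placement_sum zs (place z y c) l' \<noteq> 0" by blast
  from Cons.IH[OF y(2)] Cons.prems l obtain ys where
    "map fst ys = map fst l'" "map digits_of ys = map digits_of l'"
    "columns_sign (foldl (\<lambda>c (z, y). place z y c) (place z y c) (zip zs ys)) \<noteq> 0" by auto
  then show ?case using rots_same[OF y(1)] l by (intro exI[of _ "y # ys"]) simp
qed

lemma mset_distinct_6:
  assumes "distinct xs" "length xs = 6"
  shows "mset xs = {#D1, D2, D3, D4, D5, D6#}"
proof -
  have U: "(UNIV :: digit set) = {D1, D2, D3, D4, D5, D6}" using digit.exhaust by auto
  have "card (set xs) = card (UNIV :: digit set)" using assms by (simp add: distinct_card U)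
  then have "set xs = UNIV" by (metis U card_subset_eq finite.emptyI finite.insertI subset_UNIV)
  then have "set xs = set [D1, D2, D3, D4, D5, D6]" by (simp add: U)
  then have "mset xs = mset [D1, D2, D3, D4, D5, D6]"
    using assms by (subst (asm) set_eq_iff_mset_eq_distinct) auto
  then show ?thesis by simp
qed

lemma mset_distinct_3:
  assumes "distinct xs" "length xs = 3" "set xs \<subseteq> {D1, D2, D3}"
  shows "mset xs = {#D1, D2, D3#}"
proof -
  have "card (set xs) = card {D1, D2, D3}" using assms by (simp add: distinct_card)
  then have "set xs = set [D1, D2, D3]" using assms(3) by (simp add: card_subset_eq)
  then have "mset xs = mset [D1, D2, D3]"
    using assms by (subst (asm) set_eq_iff_mset_eq_distinct) auto
  then show ?thesis by simp
qed

text \<open>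
  In a nonzero term each determinant of size three has the rows \<open>e\<^sub>1, e\<^sub>2,
  e\<^sub>3\<close> in some order and each determinant of size six the rows \<open>e\<^sub>1,
  \<dots>, e\<^sub>6\<close>. So every monomial has the weight of an invariant under diagonal
  matrices of determinant one.
\<close>
theorem balanced:
  assumes "length l = 6" "placement_sum letters no_columns (map coord_item l) \<noteq> 0"
  shows "image_mset (fst \<circ> coord_item) (mset l) = {#D1, D2, D3, D1, D2, D3#}"
    and "(\<Sum>t\<in>#mset l. digits_of (coord_item t)) = mset [D1, D1, D1, D2, D2, D2, D3, D3, D3, D4, D4, D4, D5, D5, D5, D6, D6, D6]"
proof -
  obtain ys where ys: "map fst ys = map fst (map coord_item l)" "map digits_of ys = map digits_of (map coord_item l)"
    "columns_sign (foldl (\<lambda>c (z, y). place z y c) no_columns (zip letters ys)) \<noteq> 0"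
    using placement_sum_nonzero[OF assms(2)] assms(1) by (auto simp: letters_def)
  have "length ys = 6" using ys(1) assms(1) by (metis length_map)
  then obtain f e d c b a where y6: "ys = [f, e, d, c, b, a]" by (rule list_length_6)
  have valid: "fst y \<in> {D1, D2, D3}" if "y \<in> set ys" for y
  proof -
    have "fst y \<in> fst ` set (map coord_item l)" using that ys(1) by (metis image_eqI set_map)
    then obtain t where "fst y = fst (coord_item t)" by auto
    then show ?thesis using valid_coord_item[of t] by (simp add: valid_item_def)
  qed
  obtain ai ap aq ar where a: "a = (ai, ap, aq, ar)" using prod_cases4 by blast
  obtain bi bp bq br where b: "b = (bi, bp, bq, br)" using prod_cases4 by blast
  obtain ci cp cq cr where c: "c = (ci, cp, cq, cr)" using prod_cases4 by blast
  obtain di dp dq dr where d: "d = (di, dp, dq, dr)" using prod_cases4 by blast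
  obtain ei ep eq er where e: "e = (ei, ep, eq, er)" using prod_cases4 by blast
  obtain fi fp fq fr where f: "f = (fi, fp, fq, fr)" using prod_cases4 by blast
  note y = a b c d e f
  have "eps [ai, bi, di] \<noteq> 0" "eps [ci, ei, fi] \<noteq> 0" "eps [ap, aq, ar, br, cq, cr] \<noteq> 0"
    "eps [bp, bq, dq, dr, eq, er] \<noteq> 0" "eps [cp, dp, ep, fp, fq, fr] \<noteq> 0"
    using ys(3) by (simp_all add: y6 y letters_def del: eps.simps)
  then have "distinct [ai, bi, di]" "distinct [ci, ei, fi]" "distinct [ap, aq, ar, br, cq, cr]"
    "distinct [bp, bq, dq, dr, eq, er]" "distinct [cp, dp, ep, fp, fq, fr]"
    using eps_not_distinct by metis+
  note dist = this
  have v: "ai \<in> {D1, D2, D3}" "bi \<in> {D1, D2, D3}" "di \<in> {D1, D2, D3}" "ci \<in> {D1, D2, D3}" "ei \<in> {D1, D2, D3}" "fi \<in> {D1, D2, D3}"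
    using valid[of a] valid[of b] valid[of d] valid[of c] valid[of e] valid[of f] by (simp_all add: y6 y)
  have m: "mset [ai, bi, di] = {#D1, D2, D3#}" "mset [ci, ei, fi] = {#D1, D2, D3#}"
    by (rule mset_distinct_3[OF dist(1)], simp, use v in simp) (rule mset_distinct_3[OF dist(2)], simp, use v in simp)
  have m6: "mset [ap, aq, ar, br, cq, cr] = {#D1, D2, D3, D4, D5, D6#}"
    "mset [bp, bq, dq, dr, eq, er] = {#D1, D2, D3, D4, D5, D6#}" "mset [cp, dp, ep, fp, fq, fr] = {#D1, D2, D3, D4, D5, D6#}"
    by (rule mset_distinct_6[OF dist(3)], simp) (rule mset_distinct_6[OF dist(4)], simp, rule mset_distinct_6[OF dist(5)], simp)
  have "image_mset (fst \<circ> coord_item) (mset l) = mset (map fst (map coord_item l))"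
    by (simp add: multiset.map_comp)
  also have "\<dots> = mset [ai, bi, di] + mset [ci, ei, fi]"
    unfolding ys(1)[symmetric] by (simp add: y6 y)
  finally show "image_mset (fst \<circ> coord_item) (mset l) = {#D1, D2, D3, D1, D2, D3#}"
    unfolding m by simp
  have "(\<Sum>t\<in>#mset l. digits_of (coord_item t)) = sum_list (map digits_of (map coord_item l))"
    by (simp add: o_def sum_mset_sum_list flip: mset_map)
  also have "\<dots> = mset [ap, aq, ar, br, cq, cr] + mset [bp, bq, dq, dr, eq, er] + mset [cp, dp, ep, fp, fq, fr]"
    unfolding ys(2)[symmetric] by (simp add: y6 y)
  finally show "(\<Sum>t\<in>#mset l. digits_of (coord_item t)) = mset [D1, D1, D1, D2, D2, D2, D3, D3, D3, D4, D4, D4, D5, D5, D5, D6, D6, D6]"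
    unfolding m6 by simp
qed

section \<open>Computed coefficients\<close>
text \<open>
  The enumerated lists are the only ones that can complete the square of the first coordinate to
  a balanced monomial.
\<close>
lemma arrangement_sums_zero:
  "all_zero (pick 4 triples [D1, D2, D3, D4, D4, D4, D5, D5, D5, D6, D6, D6])"
  by code_simp

text \<open>
  This value and the next one are, up to the factor 576, coefficients of the polynomial. They
  make the two monomials available as leading monomials.
\<close>
lemma arrangement_sum_Q:
  "arrangement_sum [(D1,D1,D2,D4),(D1,D4,D5,D6),(D2,D1,D3,D5),(D2,D2,D5,D6),(D3,D1,D2,D3),(D3,D3,D4,D6)] = 72"
  by code_simp

lemma arrangement_sum_P:
  "arrangement_sum [(D1,D1,D2,D3),(D1,D3,D5,D6),(D2,D1,D2,D4),(D2,D3,D4,D6),(D3,D1,D5,D6),(D3,D2,D4,D5)] = -72"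
  by code_simp

section \<open>Tangent spaces\<close>

lemma tensor_wedge_eqI:
  fixes x y :: "'a ^ coord"
  assumes "\<And>t i j k l. Rep_coord t = (i, j, k, l) \<Longrightarrow> x $ t = y $ t"
  shows "x = y"
  using assms by (metis vec_eq_iff prod_cases4)

lemma tensor_wedge_add:
  "tensor_wedge (v + v') a b c = tensor_wedge v a b c + tensor_wedge v' a b c"
  "tensor_wedge v (a + a') b c = tensor_wedge v a b c + tensor_wedge v a' b c"
  "tensor_wedge v a (b + b') c = tensor_wedge v a b c + tensor_wedge v a b' c"
  "tensor_wedge v a b (c + c') = tensor_wedge v a b c + tensor_wedge v a b c'"
  by (rule tensor_wedge_eqI, simp add: tensor_wedge_nth alt3_def algebra_simps)+

lemma tensor_wedge_scale:
  "tensor_wedge (r *s v) a b c = r *s tensor_wedge v a b c"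
  "tensor_wedge v (r *s a) b c = r *s tensor_wedge v a b c"
  "tensor_wedge v a (r *s b) c = r *s tensor_wedge v a b c"
  "tensor_wedge v a b (r *s c) = r *s tensor_wedge v a b c"
  by (rule tensor_wedge_eqI, simp add: tensor_wedge_nth alt3_def algebra_simps)+

lemma tensor_wedge_swap:
  "tensor_wedge v b a c = - tensor_wedge v a b c"
  "tensor_wedge v a c b = - tensor_wedge v a b c"
  by (rule tensor_wedge_eqI, simp add: tensor_wedge_nth alt3_def algebra_simps)+

lemma tensor_wedge_repeated:
  "tensor_wedge v a a c = 0" "tensor_wedge v a c c = 0" "tensor_wedge v a c a = 0"
  by (rule tensor_wedge_eqI, simp add: tensor_wedge_nth alt3_def algebra_simps)+

lemma tensor_wedge_0:
  "tensor_wedge 0 a b c = 0" "tensor_wedge v 0 b c = 0" "tensor_wedge v a 0 c = 0" "tensor_wedge v a b 0 = 0"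
  by (rule tensor_wedge_eqI, simp add: tensor_wedge_nth alt3_def)+

fun tangent :: "point \<Rightarrow> point \<Rightarrow> complex ^ coord" where
  "tangent (v, a, b, c) (v', a', b', c') =
     tensor_wedge v' a b c + tensor_wedge v a' b c + tensor_wedge v a b' c + tensor_wedge v a b c'"

fun scale_point :: "complex \<Rightarrow> point \<Rightarrow> point" where
  "scale_point r (v, a, b, c) = (r *s v, r *s a, r *s b, r *s c)"

lemma tangent_scale: "tangent y (scale_point r h) = r *s tangent y h"
  by (cases y; cases h) (simp add: tensor_wedge_scale vector_add_ldistrib)

lemma tangent_0: "tangent y 0 = 0"
  by (cases y) (simp add: tensor_wedge_0 zero_prod_def)

lemma bounded_linear_scale_axis: "bounded_linear (\<lambda>z::complex. z *s (axis t 1 :: complex ^ 'n))"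
  by (intro linear_conv_bounded_linear[THEN iffD1] linearI) (simp_all add: vec_eq_iff axis_def)

lemma has_derivative_tw: "(tw has_derivative tangent y) (at y)"
proof -
  have coordinate: "((\<lambda>y. tw y $ t) has_derivative (\<lambda>h. tangent y h $ t)) (at y)" for t
  proof -
    obtain i j k l where t: "Rep_coord t = (i, j, k, l)" using prod_cases4 by blast
    have tw: "(\<lambda>y. tw y $ t) = (\<lambda>y. fst y $ of_nat i * alt3 (\<lambda>p q r. fst (snd y) $ of_nat p *
        fst (snd (snd y)) $ of_nat q * snd (snd (snd y)) $ of_nat r) j k l)"
      by (auto simp: fun_eq_iff tensor_wedge_nth[OF t])
    have 0: "((\<lambda>y::point. fst y $ m) has_derivative (\<lambda>h. fst h $ m)) (at y)" for m
      by (intro bounded_linear_imp_has_derivative bounded_linear_compose[OF bounded_linear_vec_nth] bounded_linear_fst)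
    have 1: "((\<lambda>y::point. fst (snd y) $ m) has_derivative (\<lambda>h. fst (snd h) $ m)) (at y)" for m
      by (intro bounded_linear_imp_has_derivative bounded_linear_compose[OF bounded_linear_vec_nth]
          bounded_linear_compose[OF bounded_linear_fst] bounded_linear_snd)
    have 2: "((\<lambda>y::point. fst (snd (snd y)) $ m) has_derivative (\<lambda>h. fst (snd (snd h)) $ m)) (at y)" for m
      by (intro bounded_linear_imp_has_derivative bounded_linear_compose[OF bounded_linear_vec_nth]
          bounded_linear_compose[OF bounded_linear_fst] bounded_linear_compose[OF bounded_linear_snd] bounded_linear_snd)
    have 3: "((\<lambda>y::point. snd (snd (snd y)) $ m) has_derivative (\<lambda>h. snd (snd (snd h)) $ m)) (at y)" for m
      by (intro bounded_linear_imp_has_derivative bounded_linear_compose[OF bounded_linear_vec_nth]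
          bounded_linear_compose[OF bounded_linear_snd] bounded_linear_snd)
    obtain v a b c where y: "y = (v, a, b, c)" using prod_cases4 by blast
    show ?thesis
      unfolding tw alt3_def
      by (rule has_derivative_eq_rhs, (rule 0 1 2 3 has_derivative_mult has_derivative_add has_derivative_diff)+)
         (auto simp: fun_eq_iff y tensor_wedge_nth[OF t] alt3_def algebra_simps)
  qed
  have "((\<lambda>y. \<Sum>t\<in>UNIV. tw y $ t *s axis t 1) has_derivative (\<lambda>h. \<Sum>t\<in>UNIV. tangent y h $ t *s axis t 1)) (at y)"
    by (intro has_derivative_sum bounded_linear.has_derivative[OF bounded_linear_scale_axis] coordinate)
  then show ?thesis by (simp add: basis_expansion)
qed

text \<open>
  A nonzero vector orthogonal to a proper subspace yields, after complex conjugation, a nonzero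
  linear form that vanishes on it.
\<close>
lemma complex_subspace_UNIV:
  fixes R :: "(complex ^ 'n) set"
  assumes "0 \<in> R" "\<And>x y. x \<in> R \<Longrightarrow> y \<in> R \<Longrightarrow> x + y \<in> R" "\<And>r x. x \<in> R \<Longrightarrow> r *s x \<in> R"
    and dual: "\<And>f. (\<And>x. x \<in> R \<Longrightarrow> (\<Sum>t\<in>UNIV. f t * x $ t) = 0) \<Longrightarrow> f = (\<lambda>t. 0)"
  shows "R = UNIV"
proof (rule ccontr)
  assume "R \<noteq> UNIV"
  have "r *\<^sub>R x = complex_of_real r *s x" for r and x :: "complex ^ 'n"
    by (simp add: vec_eq_iff scaleR_conv_of_real[where 'a = complex])
  then have "subspace R"
    using assms by (simp add: subspace_def)
  then have "span R = R" by (simp add: span_eq_iff)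
  then have "span R \<subset> span UNIV" using \<open>R \<noteq> UNIV\<close> by (metis span_UNIV psubsetI subset_UNIV)
  then obtain z where z: "z \<noteq> 0" "\<And>y. y \<in> span R \<Longrightarrow> orthogonal z y"
    using orthogonal_to_subspace_exists_gen by blast
  have Re: "Re (\<Sum>t\<in>UNIV. cnj (z $ t) * y $ t) = 0" if "y \<in> R" for y
  proof -
    have "Re (\<Sum>t\<in>UNIV. cnj (z $ t) * y $ t) = inner z y"
      by (simp add: inner_vec_def inner_complex_def)
    then show ?thesis using z(2)[of y] that \<open>span R = R\<close> by (simp add: orthogonal_def)
  qed
  have "(\<lambda>t. cnj (z $ t)) = (\<lambda>t. 0)"
  proof (rule dual)
    fix y assume y: "y \<in> R"
    have "(\<Sum>t\<in>UNIV. cnj (z $ t) * (\<i> *s y) $ t) = \<i> * (\<Sum>t\<in>UNIV. cnj (z $ t) * y $ t)"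
      by (simp add: sum_distrib_left mult_ac)
    then have "Im (\<Sum>t\<in>UNIV. cnj (z $ t) * y $ t) = 0"
      using Re[OF assms(3)[OF y, of \<i>]] by simp
    then show "(\<Sum>t\<in>UNIV. cnj (z $ t) * y $ t) = 0"
      using Re[OF y] by (simp add: complex_eq_iff)
  qed
  then show False using z(1) by (simp add: vec_eq_iff fun_eq_iff)
qed

lemma coord_item_triples: "snd (coord_item t) \<in> set triples"
proof -
  obtain i j k l where t: "Rep_coord t = (i, j, k, l)" using prod_cases4 by blast
  then have r: "1 \<le> j" "j < k" "k < l" "l \<le> 6" using Rep_coord[of t] by auto
  have "j \<in> {1, 2, 3, 4}" "k \<in> {2, 3, 4, 5}" "l \<in> {3, 4, 5, 6}" using r by auto
  then show ?thesis using r
    by (elim insertE emptyE) (simp_all add: coord_item_def t to_digit_def triples_def)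
qed

lemma tensor_wedge_unit:
  assumes "coord_item t = (i, j, k, l)"
  shows "tensor_wedge (unit_vec i) (unit_vec j) (unit_vec k) (unit_vec l) = axis t 1"
  using tw_item_point[of 1 t] assms by simp

abbreviation (input) u3 :: "digit \<Rightarrow> complex ^ 3" where "u3 \<equiv> unit_vec"
abbreviation (input) u6 :: "digit \<Rightarrow> complex ^ 6" where "u6 \<equiv> unit_vec"

text \<open>
  Five points whose tangent spaces span, together with the first coordinate axis, the whole
  space. They are sparse, so that the equations for a linear form vanishing on the tangent
  spaces have few terms.
\<close>
definition base_point :: "5 \<Rightarrow> point" where
  "base_point s =
    (if s = 1 then (u3 D1 + u3 D2 + u3 D3, u6 D2 + u6 D4, u6 D1, u6 D3 + u6 D6)
     else if s = 2 then (u3 D2, u6 D4, u6 D1 + u6 D5, u6 D3)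
     else if s = 3 then (u3 D1 + 2 *s u3 D2 + 3 *s u3 D3, u6 D6, u6 D5, u6 D3)
     else if s = 4 then (u3 D3, u6 D5, u6 D2, u6 D1)
     else (u3 D1, u6 D2, u6 D4, u6 D6))"

lemma linear_pair_zero:
  fixes p q :: complex
  assumes "a * p + b * q = 0" "c * p + d * q = 0" "a * d - b * c \<noteq> 0"
  shows "p = 0" "q = 0"
proof -
  have "(a * d - b * c) * p = d * (a * p + b * q) - b * (c * p + d * q)" by (simp add: algebra_simps)
  then show "p = 0" using assms by simp
  have "(a * d - b * c) * q = a * (c * p + d * q) - c * (a * p + b * q)" by (simp add: algebra_simps)
  then show "q = 0" using assms by simp
qed

text \<open>
  \<open>T i j k l\<close> is the coefficient of the linear form at the basis tensor with
  indices \<open>i, j, k, l\<close>. The equations \<open>A\<close>, \<open>B\<close>,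
  \<open>C\<close>, \<open>D\<close> with number \<open>s\<close> say that the form vanishes
  when the first, second, third or fourth factor of the point \<open>s\<close> is replaced by a
  basis vector. In the order below nearly every equation contains a single coefficient that is
  not yet known to vanish; the three remaining pairs of coefficients take two equations each.
\<close>
lemma tangents_dual_trivial:
  fixes f :: "coord \<Rightarrow> complex"
  assumes tangents: "\<And>s h. (\<Sum>t\<in>UNIV. f t * tangent (base_point s) h $ t) = 0"
    and first: "\<And>t. coord_item t = (D1, D1, D2, D3) \<Longrightarrow> f t = 0"
  shows "f = (\<lambda>t. 0)"
proof -
  define B where "B = (\<lambda>v a b c. \<Sum>t\<in>UNIV. f t * tensor_wedge v a b c $ t)"
  have add: "B (v + v') a b c = B v a b c + B v' a b c" "B v (a + a') b c = B v a b c + B v a' b c"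
     "B v a (b + b') c = B v a b c + B v a b' c" "B v a b (c + c') = B v a b c + B v a b c'"
     "B (r *s v) a b c = r * B v a b c" for v v' a a' b b' c c' r
    by (simp_all add: B_def tensor_wedge_add tensor_wedge_scale algebra_simps sum.distrib sum_distrib_left)
  have swap: "B v b a c = - B v a b c" "B v a c b = - B v a b c" for v a b c
    by (simp_all only: B_def tensor_wedge_swap(1)[of v b] tensor_wedge_swap(2)[of v a c] vector_uminus_component mult_minus_right sum_negf)
  have rep: "B v a a c = 0" "B v a c c = 0" "B v a c a = 0" for v a c
    by (simp_all add: B_def tensor_wedge_repeated)
  define T where "T = (\<lambda>i j k l. B (unit_vec i) (unit_vec j) (unit_vec k) (unit_vec l))"
  have fold: "B (unit_vec i) (unit_vec j) (unit_vec k) (unit_vec l) = T i j k l" for i j k l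
    by (simp add: T_def)
  have sorted: "before k j \<Longrightarrow> T i j k l = - T i k j l" "before l k \<Longrightarrow> T i j k l = - T i j l k"
     "T i j j l = 0" "T i j k k = 0" "T i j k j = 0" for i j k l
    unfolding T_def by (rule swap rep)+
  note S = add sorted fold
  have tangent: "B v' a b c = 0" "B v a' b c = 0" "B v a b' c = 0" "B v a b c' = 0"
    if "base_point s = (v, a, b, c)" for s v a b c v' a' b' c'
    using tangents[of s "(v', 0, 0, 0)"] tangents[of s "(0, a', 0, 0)"] tangents[of s "(0, 0, b', 0)"] tangents[of s "(0, 0, 0, c')"]
    by (simp_all add: that B_def tensor_wedge_0)
  have e: "base_point 1 = (u3 D1 + u3 D2 + u3 D3, u6 D2 + u6 D4, u6 D1, u6 D3 + u6 D6)"
     "base_point 2 = (u3 D2, u6 D4, u6 D1 + u6 D5, u6 D3)"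
     "base_point 3 = (u3 D1 + 2 *s u3 D2 + 3 *s u3 D3, u6 D6, u6 D5, u6 D3)"
     "base_point 4 = (u3 D3, u6 D5, u6 D2, u6 D1)"
     "base_point 5 = (u3 D1, u6 D2, u6 D4, u6 D6)"
    by (simp_all add: base_point_def)
  note A1 = tangent(1)[OF e(1), of "unit_vec m" for m]
  note B1 = tangent(2)[OF e(1), of "unit_vec m" for m]
  note C1 = tangent(3)[OF e(1), of "unit_vec m" for m]
  note D1 = tangent(4)[OF e(1), of "unit_vec m" for m]
  note A2 = tangent(1)[OF e(2), of "unit_vec m" for m]
  note B2 = tangent(2)[OF e(2), of "unit_vec m" for m]
  note C2 = tangent(3)[OF e(2), of "unit_vec m" for m]
  note D2 = tangent(4)[OF e(2), of "unit_vec m" for m]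
  note A3 = tangent(1)[OF e(3), of "unit_vec m" for m]
  note B3 = tangent(2)[OF e(3), of "unit_vec m" for m]
  note C3 = tangent(3)[OF e(3), of "unit_vec m" for m]
  note D3 = tangent(4)[OF e(3), of "unit_vec m" for m]
  note A4 = tangent(1)[OF e(4), of "unit_vec m" for m]
  note B4 = tangent(2)[OF e(4), of "unit_vec m" for m]
  note C4 = tangent(3)[OF e(4), of "unit_vec m" for m]
  note D4 = tangent(4)[OF e(4), of "unit_vec m" for m]
  note A5 = tangent(1)[OF e(5), of "unit_vec m" for m]
  note B5 = tangent(2)[OF e(5), of "unit_vec m" for m]
  note C5 = tangent(3)[OF e(5), of "unit_vec m" for m]
  note D5 = tangent(4)[OF e(5), of "unit_vec m" for m]
  have Y: "T D1 D1 D2 D3 = 0"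
  proof -
    define t where "t = Abs_coord (1, 1, 2, 3)"
    have "Rep_coord t = (1, 1, 2, 3)" by (simp add: t_def Abs_coord_inverse)
    then have t: "coord_item t = (D1, D1, D2, D3)" by (simp add: coord_item_def to_digit_def)
    show ?thesis using first[OF t] by (simp add: T_def B_def tensor_wedge_unit[OF t] axis_def if_distrib cong: if_cong)
  qed
  have x2135: "T D2 D1 D3 D5 = 0" using B2[of D1] by (simp add: S)
  have x2134: "T D2 D1 D3 D4 = 0" using C2[of D1] by (simp add: S)
  have x2234: "T D2 D2 D3 D4 = 0" using C2[of D2] by (simp add: S)
  have x2345: "T D2 D3 D4 D5 = 0" using C2[of D5] by (simp add: S)
  have x2346: "T D2 D3 D4 D6 = 0" using C2[of D6] by (simp add: S)
  have x2145: "T D2 D1 D4 D5 = 0" using D2[of D1] by (simp add: S)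
  have x1356: "T D1 D3 D5 D6 = 0" using A3[of D1] by (simp add: S)
  have x2356: "T D2 D3 D5 D6 = 0" using A3[of D2] by (simp add: S)
  have x3356: "T D3 D3 D5 D6 = 0" using A3[of D3] by (simp add: S)
  have x1125: "T D1 D1 D2 D5 = 0" using A4[of D1] by (simp add: S)
  have x2125: "T D2 D1 D2 D5 = 0" using A4[of D2] by (simp add: S)
  have x3125: "T D3 D1 D2 D5 = 0" using A4[of D3] by (simp add: S)
  have x3123: "T D3 D1 D2 D3 = 0" using B4[of D3] by (simp add: S)
  have x3124: "T D3 D1 D2 D4 = 0" using B4[of D4] by (simp add: S)
  have x3126: "T D3 D1 D2 D6 = 0" using B4[of D6] by (simp add: S)
  have x3135: "T D3 D1 D3 D5 = 0" using C4[of D3] by (simp add: S)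
  have x3145: "T D3 D1 D4 D5 = 0" using C4[of D4] by (simp add: S)
  have x3156: "T D3 D1 D5 D6 = 0" using C4[of D6] by (simp add: S)
  have x3235: "T D3 D2 D3 D5 = 0" using D4[of D3] by (simp add: S)
  have x3245: "T D3 D2 D4 D5 = 0" using D4[of D4] by (simp add: S)
  have x3256: "T D3 D2 D5 D6 = 0" using D4[of D6] by (simp add: S)
  have x1246: "T D1 D2 D4 D6 = 0" using A5[of D1] by (simp add: S)
  have x2246: "T D2 D2 D4 D6 = 0" using A5[of D2] by (simp add: S)
  have x3246: "T D3 D2 D4 D6 = 0" using A5[of D3] by (simp add: S)
  have x1146: "T D1 D1 D4 D6 = 0" using B5[of D1] by (simp add: S)
  have x1346: "T D1 D3 D4 D6 = 0" using B5[of D3] by (simp add: S)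
  have x1456: "T D1 D4 D5 D6 = 0" using B5[of D5] by (simp add: S)
  have x1126: "T D1 D1 D2 D6 = 0" using C5[of D1] by (simp add: S)
  have x1236: "T D1 D2 D3 D6 = 0" using C5[of D3] by (simp add: S)
  have x1256: "T D1 D2 D5 D6 = 0" using C5[of D5] by (simp add: S)
  have x1124: "T D1 D1 D2 D4 = 0" using D5[of D1] by (simp add: S)
  have x1234: "T D1 D2 D3 D4 = 0" using D5[of D3] by (simp add: S)
  have x1245: "T D1 D2 D4 D5 = 0" using D5[of D5] by (simp add: S)
  note x1123 = Y
  have x1134: "T D1 D1 D3 D4 = 0" using A1[of D1] by (simp add: S x1123 x1126 x1146)
  have x3234: "T D3 D2 D3 D4 = 0" using C1[of D2] by (simp add: S x1234 x1246 x2234 x2246 x3246)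
  have x2124: "T D2 D1 D2 D4 = 0" using D1[of D2] by (simp add: S x1124 x3124)
  have x1145: "T D1 D1 D4 D5 = 0" using D1[of D5] by (simp add: S x1125 x2125 x2145 x3125 x3145)
  have x1345: "T D1 D3 D4 D5 = 0" using A2[of D1] by (simp add: S x1134)
  have x2136: "T D2 D1 D3 D6 = 0" using B2[of D6] by (simp add: S x2356)
  have x2245: "T D2 D2 D4 D5 = 0" using D2[of D2] by (simp add: S x2124)
  have x1135: "T D1 D1 D3 D5 = 0" using B3[of D1] by (simp add: S x2135 x3135)
  have x3345: "T D3 D3 D4 D5 = 0" using B3[of D4] by (simp add: S x1345 x2345)
  have x3346: "T D3 D3 D4 D6 = 0" using C3[of D4] by (simp add: S x1346 x2346)
  have x2256: "T D2 D2 D5 D6 = 0" using D3[of D2] by (simp add: S x1256 x3256)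
  have x3134: "T D3 D1 D3 D4 = 0" using A2[of D3] by (simp add: S x3345)
  have x3146: "T D3 D1 D4 D6 = 0" using A1[of D3] by (simp add: S x3123 x3126 x3134)
  have x2146: "T D2 D1 D4 D6 = 0" using B1[of D4] by (simp add: S x1134 x1146 x2134 x3134 x3146)
  have x2123: "T D2 D1 D2 D3 = 0" using D1[of D3] by (simp add: S x1123 x1134 x2134 x3123 x3134)
  have x2126: "T D2 D1 D2 D6 = 0" using D1[of D6] by (simp add: S x1126 x1146 x2146 x3126 x3146)
  have x2235: "T D2 D2 D3 D5 = 0" using B2[of D2] by (simp add: S x2123)
  have x2456: "T D2 D4 D5 D6 = 0" using D2[of D6] by (simp add: S x2146)
  have x1235: "T D1 D2 D3 D5 = 0" using B3[of D2] by (simp add: S x2235 x3235)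
  have x3456: "T D3 D4 D5 D6 = 0" using D3[of D4] by (simp add: S x1456 x2456)
  have x1136: "T D1 D1 D3 D6 = 0" and x3136: "T D3 D1 D3 D6 = 0"
  proof -
    have e0: "- 1 * T D1 D1 D3 D6 + - 1 * T D3 D1 D3 D6 = 0" using B1[of D3] by (simp add: S x2136 algebra_simps)
    have e1: "1 * T D1 D1 D3 D6 + 3 * T D3 D1 D3 D6 = 0" using C3[of D1] by (simp add: S x2136 algebra_simps)
    show "T D1 D1 D3 D6 = 0" "T D3 D1 D3 D6 = 0" by (rule linear_pair_zero[OF e0 e1], simp)+
  qed
  have x2236: "T D2 D2 D3 D6 = 0" and x3236: "T D3 D2 D3 D6 = 0"
  proof -
    have e0: "1 * T D2 D2 D3 D6 + 1 * T D3 D2 D3 D6 = 0" using C1[of D3] by (simp add: S x1236 x1346 x2346 x3346 algebra_simps)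
    have e1: "2 * T D2 D2 D3 D6 + 3 * T D3 D2 D3 D6 = 0" using C3[of D2] by (simp add: S x1236 x1346 x2346 x3346 algebra_simps)
    show "T D2 D2 D3 D6 = 0" "T D3 D2 D3 D6 = 0" by (rule linear_pair_zero[OF e0 e1], simp)+
  qed
  have x1156: "T D1 D1 D5 D6 = 0" and x2156: "T D2 D1 D5 D6 = 0"
  proof -
    have e0: "- 1 * T D1 D1 D5 D6 + - 1 * T D2 D1 D5 D6 = 0" using B1[of D5] by (simp add: S x1135 x2135 x3135 x3156 algebra_simps)
    have e1: "- 1 * T D1 D1 D5 D6 + - 2 * T D2 D1 D5 D6 = 0" using D3[of D1] by (simp add: S x1135 x2135 x3135 x3156 algebra_simps)
    show "T D1 D1 D5 D6 = 0" "T D2 D1 D5 D6 = 0" by (rule linear_pair_zero[OF e0 e1], simp)+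
  qed
  show ?thesis
  proof
    fix t
    obtain i j k l where t: "coord_item t = (i, j, k, l)" using prod_cases4 by blast
    have "f t = T i j k l" by (simp add: T_def B_def tensor_wedge_unit[OF t] axis_def if_distrib cong: if_cong)
    moreover have "i \<in> {D1, D2, D3}" "(j, k, l) \<in> set triples"
      using valid_coord_item[of t] coord_item_triples[of t] by (simp_all add: valid_item_def t)
    then have "T i j k l = 0"
      unfolding triples_def list.set by (elim insertE emptyE) (simp_all add: x1123 x1124 x1125 x1126 x1134 x1135 x1136 x1145 x1146 x1156 x1234 x1235 x1236 x1245 x1246 x1256 x1345 x1346 x1356 x1456 x2123 x2124 x2125 x2126 x2134 x2135 x2136 x2145 x2146 x2156 x2234 x2235 x2236 x2245 x2246 x2256 x2345 x2346 x2356 x2456 x3123 x3124 x3125 x3126 x3134 x3135 x3136 x3145 x3146 x3156 x3234 x3235 x3236 x3245 x3246 x3256 x3345 x3346 x3356 x3456)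
    ultimately show "f t = 0" by simp
  qed
qed

section \<open>The degree in the first coordinate\<close>

definition first_coord :: coord where
  "first_coord = Abs_coord (1, 1, 2, 3)"

lemma coord_item_Abs:
  assumes "1 \<le> i" "i \<le> 3" "1 \<le> j" "j < k" "k < l" "l \<le> 6"
  shows "coord_item (Abs_coord (i, j, k, l)) = (to_digit i, to_digit j, to_digit k, to_digit l)"
  using assms by (simp add: coord_item_def Abs_coord_inverse)

lemma coord_item_first: "coord_item first_coord = (D1, D1, D2, D3)"
  by (simp add: first_coord_def coord_item_Abs to_digit_def)

fun triple_mset :: "digit \<times> digit \<times> digit \<Rightarrow> digit multiset" where
  "triple_mset (p, q, r) = {#p, q, r#}"

lemma digits_of_triple: "digits_of y = triple_mset (snd y)"
  by (cases y) simp

text \<open>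
  A multiset of triples is built in the order of \<open>js\<close>: either \<open>j\<close>
  occurs and is used up first, or it can be dropped from the list.
\<close>
lemma pick_complete:
  "size N = n \<Longrightarrow> set_mset N \<subseteq> set js \<Longrightarrow> (\<Sum>j\<in>#N. triple_mset j) \<subseteq># mset u \<Longrightarrow>
    \<exists>ys\<in>set (pick n js u). mset ys = N"
proof (induction n arbitrary: N js u)
  case 0
  then show ?case by simp
next
  case (Suc n)
  show ?case using Suc.prems
  proof (induction js)
    case Nil
    then show ?case by auto
  next
    case (Cons j js)
    show ?case
    proof (cases "j \<in># N")
      case True
      then obtain N' where N: "N = add_mset j N'" by (metis multi_member_split)
      obtain p q r where j: "j = (p, q, r)" using prod_cases3 by blast
      have sub: "{#p, q, r#} + (\<Sum>j\<in>#N'. triple_mset j) \<subseteq># mset u"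
        using Cons.prems(3) by (simp add: N j)
      then have pqr: "{#p, q, r#} \<subseteq># mset u"
        by (metis mset_subset_eq_add_left subset_mset.order_trans)
      from set_mset_mono[OF this] have fits: "fits j u" by (simp add: j)
      have "mset (use_up j u) = mset u - {#p, q, r#}"
        by (rule multiset_eqI) (auto simp: j)
      then have "(\<Sum>j\<in>#N'. triple_mset j) \<subseteq># mset (use_up j u)"
        using sub pqr by (simp add: subset_mset.le_diff_conv2 add.commute)
      then obtain ys where ys: "ys \<in> set (pick n (j # js) (use_up j u))" "mset ys = N'"
        using Suc.IH[of N' "j # js" "use_up j u"] Cons.prems by (auto simp: N)
      then have "j # ys \<in> set (pick (Suc n) (j # js) u)" using fits by simp
      then show ?thesis using ys N by (metis mset.simps(2))
    next
      case False
      then have "set_mset N \<subseteq> set js" using Cons.prems(2) by auto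
      then show ?thesis using Cons.IH[OF Cons.prems(1) _ Cons.prems(3)] by auto
    qed
  qed
qed

lemma ex_map_reorder:
  "mset ys = image_mset f (mset xs) \<Longrightarrow> \<exists>xs'. mset xs' = mset xs \<and> map f xs' = ys"
proof (induction ys arbitrary: xs)
  case Nil
  then show ?case by simp
next
  case (Cons y ys)
  then have "y \<in># image_mset f (mset xs)" by (metis mset.simps(2) union_single_eq_member)
  then obtain x where x: "x \<in> set xs" "y = f x" by auto
  have xs: "mset xs = add_mset x (mset (remove1 x xs))" using x(1) by simp
  then have "add_mset y (mset ys) = add_mset (f x) (image_mset f (mset (remove1 x xs)))"
    using Cons.prems by (metis image_mset_add_mset mset.simps(2))
  then have "mset ys = image_mset f (mset (remove1 x xs))" by (simp add: x(2))
  then obtain xs' where xs': "mset xs' = mset (remove1 x xs)" "map f xs' = ys" using Cons.IH by blast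
  have "mset (x # xs') = mset xs" unfolding mset.simps xs'(1) xs[symmetric] by (rule refl)
  moreover have "map f (x # xs') = y # ys" by (simp add: xs'(2) x(2))
  ultimately show ?case by (intro exI[of _ "x # xs'"] conjI)
qed

lemma all_arrangement_sums_zeroD:
  "all_arrangement_sums_zero js iss \<Longrightarrow> fs \<in> set iss \<Longrightarrow>
    arrangement_sum ((D1, D1, D2, D3) # (D1, D1, D2, D3) # zip fs js) = 0"
  by (induction iss) auto

lemma all_zeroD: "all_zero jss \<Longrightarrow> js \<in> set jss \<Longrightarrow> all_arrangement_sums_zero js halves"
  by (induction jss) auto

lemma halves_complete:
  assumes "mset fs = {#D2, D2, D3, D3#}"
  shows "fs \<in> set halves"
proof -
  have "length fs = Suc (Suc (Suc (Suc 0)))" using arg_cong[OF assms, of size] by simp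
  then obtain a b c d where fs: "fs = [a, b, c, d]" by (auto simp: length_Suc_conv)
  have "set_mset (mset fs) = {D2, D3}" using assms by simp
  then have "a = D2 \<or> a = D3" "b = D2 \<or> b = D3" "c = D2 \<or> c = D3" "d = D2 \<or> d = D3"
    by (auto simp: fs)
  moreover have "count (mset fs) D2 = 2" using assms by simp
  ultimately show ?thesis
    by (elim disjE) (simp_all add: fs halves_def)
qed

lemma zip_fst_snd: "zip (map (fst \<circ> f) xs) (map (snd \<circ> f) xs) = map f xs"
  by (induction xs) simp_all

text \<open>
  Dividing a balanced monomial by the square of the first coordinate leaves four factors whose
  first indices are \<open>2, 2, 3, 3\<close> and whose other indices are \<open>1, 2, 3\<close>
  once and \<open>4, 5, 6\<close> three times. For each of these finitely many possibilities the
  coefficient is a computed sum, which is zero.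
\<close>
theorem degree_first_coord:
  assumes "m \<in> keys FF"
  shows "lookup m first_coord \<le> 1"
proof (rule ccontr)
  assume two: "\<not> ?thesis"
  obtain l where l: "m = list_mon l" "length l = 6" "placement_sum letters no_columns (map coord_item l) \<noteq> 0"
    by (rule keys_FF[OF assms])
  have "2 \<le> count (mset l) first_coord" using two by (simp add: l(1) lookup_list_mon)
  then have "replicate_mset 2 first_coord \<subseteq># mset l" by (simp add: count_le_replicate_mset_subset_eq)
  then obtain N where N: "mset l = {#first_coord, first_coord#} + N"
    by (auto simp: numeral_2_eq_2 subset_mset.le_iff_add)
  obtain n0 where n0: "mset n0 = N" using ex_mset by blast
  have size: "size N = 4" using arg_cong[OF N, of size] l(2) by simp
  note b = balanced[OF l(2,3), unfolded N]
  have "{#D1, D1#} + image_mset (fst \<circ> coord_item) N = {#D1, D1#} + {#D2, D2, D3, D3#}"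
    using b(1) by (simp add: coord_item_first add_mset_commute)
  then have fst: "image_mset (fst \<circ> coord_item) N = {#D2, D2, D3, D3#}" by (rule add_left_imp_eq)
  have "({#D1, D2, D3#} + {#D1, D2, D3#}) + (\<Sum>t\<in>#N. digits_of (coord_item t)) =
    ({#D1, D2, D3#} + {#D1, D2, D3#}) + mset [D1, D2, D3, D4, D4, D4, D5, D5, D5, D6, D6, D6]"
    using b(2) by (simp add: coord_item_first add_mset_commute)
  then have "(\<Sum>t\<in>#N. digits_of (coord_item t)) = mset [D1, D2, D3, D4, D4, D4, D5, D5, D5, D6, D6, D6]"
    by (rule add_left_imp_eq)
  then have "(\<Sum>j\<in>#image_mset (snd \<circ> coord_item) N. triple_mset j) = mset [D1, D2, D3, D4, D4, D4, D5, D5, D5, D6, D6, D6]"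
    by (simp add: digits_of_triple multiset.map_comp o_def)
  then have "\<exists>ys\<in>set (pick 4 triples [D1, D2, D3, D4, D4, D4, D5, D5, D5, D6, D6, D6]). mset ys = image_mset (snd \<circ> coord_item) N"
    using coord_item_triples size by (intro pick_complete) auto
  then obtain ys where ys: "ys \<in> set (pick 4 triples [D1, D2, D3, D4, D4, D4, D5, D5, D5, D6, D6, D6])"
    "mset ys = image_mset (snd \<circ> coord_item) (mset n0)" unfolding n0 by blast
  obtain n1 where n1: "mset n1 = mset n0" "map (snd \<circ> coord_item) n1 = ys"
    using ex_map_reorder[OF ys(2)] by blast
  have "map (fst \<circ> coord_item) n1 \<in> set halves"
    by (rule halves_complete) (simp only: mset_map n1 n0 fst)
  then have "arrangement_sum ((D1, D1, D2, D3) # (D1, D1, D2, D3) # zip (map (fst \<circ> coord_item) n1) ys) = 0"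
    by (rule all_arrangement_sums_zeroD[OF all_zeroD[OF arrangement_sums_zero ys(1)]])
  then have 0: "arrangement_sum (map coord_item (first_coord # first_coord # n1)) = 0"
    unfolding n1(2)[symmetric] zip_fst_snd by (simp add: coord_item_first)
  have m: "mset (first_coord # first_coord # n1) = mset l" by (simp add: N n0 n1)
  then have "length (first_coord # first_coord # n1) = 6" using l(2) by (metis mset_eq_length)
  from lookup_FF_arrangement[OF this] have "lookup FF (list_mon (first_coord # first_coord # n1)) = 0"
    unfolding 0 by simp
  then have "lookup FF m = 0"
    using m by (simp only: l(1) list_mon_eq_iff[THEN iffD2, OF m])
  then show False using assms by (simp add: in_keys_iff)
qed

definition slope :: xpoly where "slope = slope_in first_coord FF"
definition rest :: xpoly where "rest = rest_in first_coord FF"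

lemma FF_split: "FF = mvar first_coord * slope + rest"
  unfolding slope_def rest_def by (rule affine_split) (rule degree_first_coord)

lemma homogeneous_FF: "homogeneous 6 FF"
  unfolding homogeneous_def
proof
  fix m assume "m \<in> keys FF"
  then obtain l where l: "m = list_mon l" "length l = 6" by (rule keys_FF)
  have "keys m = set l" by (auto simp: l(1) in_keys_iff lookup_list_mon)
  then have "mdegree m = (\<Sum>v\<in>set_mset (mset l). count (mset l) v)"
    by (simp add: mdegree_def l(1) lookup_list_mon)
  then show "mdegree m = 6" using l(2) size_multiset_overloaded_eq[of "mset l"] by simp
qed

section \<open>Leading monomials\<close>

definition rest_coords :: "coord list" where
  "rest_coords = map Abs_coord [(1,1,2,4), (1,4,5,6), (2,1,3,5), (2,2,5,6), (3,1,2,3), (3,3,4,6)]"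

definition slope_coords :: "coord list" where
  "slope_coords = map Abs_coord [(1,3,5,6), (2,1,2,4), (2,3,4,6), (3,1,5,6), (3,2,4,5)]"

lemma coord_items_rest: "map coord_item rest_coords =
    [(D1,D1,D2,D4), (D1,D4,D5,D6), (D2,D1,D3,D5), (D2,D2,D5,D6), (D3,D1,D2,D3), (D3,D3,D4,D6)]"
  by (simp add: rest_coords_def coord_item_Abs to_digit_def)

lemma coord_items_slope: "map coord_item slope_coords =
    [(D1,D3,D5,D6), (D2,D1,D2,D4), (D2,D3,D4,D6), (D3,D1,D5,D6), (D3,D2,D4,D5)]"
  by (simp add: slope_coords_def coord_item_Abs to_digit_def)

definition leading_coords :: "coord list" where
  "leading_coords = slope_coords @ rest_coords"

lemma distinct_leading: "distinct (first_coord # leading_coords)"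
proof -
  have "distinct (map coord_item (first_coord # leading_coords))"
    unfolding leading_coords_def list.map map_append coord_items_rest coord_items_slope coord_item_first
    by simp
  then show ?thesis by (metis distinct_map)
qed

text \<open>
  Exponents count only at the eleven variables of the two leading monomials, so a monomial of
  maximal weight is supported on these variables.
\<close>
definition weight :: "(coord \<Rightarrow>\<^sub>0 nat) \<Rightarrow> nat" where
  "weight m = (\<Sum>c\<in>set leading_coords. lookup m c)"

lemma weight_add: "weight (m + n) = weight m + weight n"
  by (simp add: weight_def lookup_add sum.distrib)

lemma weight_list_mon: "weight (list_mon l) = length (filter (\<lambda>c. c \<in> set leading_coords) l)"
proof (induction l)
  case (Cons x l)
  have "weight (single x 1) = (if x \<in> set leading_coords then 1 else 0)"
    by (simp add: weight_def lookup_single when_def)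
  moreover have "list_mon (x # l) = single x 1 + list_mon l" by (simp add: list_mon_def)
  ultimately show ?case using Cons.IH by (simp add: weight_add)
qed (simp add: weight_def list_mon_def)

lemma sum_over_support:
  fixes h :: "'a \<Rightarrow> nat"
  assumes "set l \<subseteq> set ys" "distinct ys"
  shows "(\<Sum>t\<leftarrow>l. h t) = (\<Sum>c\<leftarrow>ys. count (mset l) c * h c)"
proof -
  have "(\<Sum>t\<leftarrow>l. h t) = (\<Sum>c\<in>set ys. count (mset l) c * h c)" using assms(1)
  proof (induction l)
    case (Cons x l)
    have "(\<Sum>c\<in>set ys. count (mset (x # l)) c * h c) = (\<Sum>c\<in>set ys. (if c = x then h c else 0) + count (mset l) c * h c)"
      by (intro sum.cong) auto
    then show ?case using Cons by (simp add: sum.distrib)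
  qed simp
  then show ?thesis using assms(2) by (simp add: sum_list_distinct_conv_sum_set)
qed

text \<open>
  The equations say that a monomial is balanced if its exponents are \<open>n0\<close> at the
  first coordinate, \<open>s1, \<dots>, s5\<close> at \<open>slope_coords\<close> and \<open>r1,
  \<dots>, r6\<close> at \<open>rest_coords\<close>. There are further real solutions, but
  \<open>s1\<close>, \<open>s2\<close> and \<open>s4\<close> determine the other values
  integrally and are at most two, so a case distinction suffices.
\<close>
lemma leading_multiplicities:
  fixes n0 s1 s2 s3 s4 s5 r1 r2 r3 r4 r5 r6 :: nat
  assumes "n0 + s1 + r1 + r2 = 2"
    "s2 + s3 + r3 + r4 = 2"
    "s4 + s5 + r5 + r6 = 2"
    "n0 + s2 + s4 + r1 + r3 + r5 = 3"
    "n0 + s2 + s5 + r1 + r4 + r5 = 3"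
    "n0 + s1 + s3 + r3 + r5 + r6 = 3"
    "s2 + s3 + s5 + r1 + r2 + r6 = 3"
    "s1 + s4 + s5 + r2 + r3 + r4 = 3"
    "s1 + s3 + s4 + r2 + r4 + r6 = 3"
  shows "n0 = 0 \<Longrightarrow> s1 = 0 \<and> s2 = 0 \<and> s3 = 0 \<and> s4 = 0 \<and> s5 = 0 \<and> r1 = 1 \<and> r2 = 1 \<and> r3 = 1 \<and> r4 = 1 \<and> r5 = 1 \<and> r6 = 1"
    and "n0 = 1 \<Longrightarrow> s1 = 1 \<and> s2 = 1 \<and> s3 = 1 \<and> s4 = 1 \<and> s5 = 1 \<and> r1 = 0 \<and> r2 = 0 \<and> r3 = 0 \<and> r4 = 0 \<and> r5 = 0 \<and> r6 = 0"
proof -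
  have "s1 \<le> 2" "s2 \<le> 2" "s4 \<le> 2" using assms(1-3) by linarith+
  then have "s1 = 0 \<or> s1 = 1 \<or> s1 = 2" "s2 = 0 \<or> s2 = 1 \<or> s2 = 2" "s4 = 0 \<or> s4 = 1 \<or> s4 = 2" by linarith+
  note cases = this
  have f: "s3 + 2 * s1 + 2 * n0 = s2 + 4 * s4" "s5 = s4" "r1 + 2 * s2 + 2 * s4 = 1 + 2 * s1 + n0"
    "r2 + 3 * s1 + 2 * n0 = 1 + 2 * s2 + 2 * s4" "r3 + s2 + 2 * s4 = 1 + s1 + n0" "r4 = r3"
    "r5 + 3 * s1 + 3 * n0 = 1 + 2 * s2 + 3 * s4" "r6 + 2 * s2 + 5 * s4 = 1 + 3 * s1 + 3 * n0"
    using assms by linarith+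
  show "s1 = 0 \<and> s2 = 0 \<and> s3 = 0 \<and> s4 = 0 \<and> s5 = 0 \<and> r1 = 1 \<and> r2 = 1 \<and> r3 = 1 \<and> r4 = 1 \<and> r5 = 1 \<and> r6 = 1" if "n0 = 0"
    using cases f that by (elim disjE) simp_all
  show "s1 = 1 \<and> s2 = 1 \<and> s3 = 1 \<and> s4 = 1 \<and> s5 = 1 \<and> r1 = 0 \<and> r2 = 0 \<and> r3 = 0 \<and> r4 = 0 \<and> r5 = 0 \<and> r6 = 0" if "n0 = 1"
    using cases f unfolding that by presburger
qed

lemma leading_monomials_unique:
  assumes l: "length l = 6" "placement_sum letters no_columns (map coord_item l) \<noteq> 0"
    and sub: "set l \<subseteq> set (first_coord # leading_coords)"
  shows "first_coord \<notin> set l \<Longrightarrow> mset l = mset rest_coords"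
    and "count (mset l) first_coord = 1 \<Longrightarrow> mset l = mset (first_coord # slope_coords)"
proof -
  note One_nat_def [simp del]
  define n where "n = (\<lambda>x. count (mset l) (Abs_coord x))"
  define n0 where "n0 = count (mset l) first_coord"
  have count_fst: "count (image_mset (fst \<circ> coord_item) (mset l)) d = (\<Sum>t\<leftarrow>l. if fst (coord_item t) = d then 1 else 0)" for d
    by (induction l) auto
  have count_snd: "count (\<Sum>t\<in>#mset l. digits_of (coord_item t)) d = (\<Sum>t\<leftarrow>l. count (digits_of (coord_item t)) d)" for d
    by (induction l) auto
  have expand: "(\<Sum>t\<leftarrow>l. h (coord_item t)) = n0 * h (D1,D1,D2,D3) +
      (n (1,3,5,6) * h (D1,D3,D5,D6) + n (2,1,2,4) * h (D2,D1,D2,D4) + n (2,3,4,6) * h (D2,D3,D4,D6) +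
       n (3,1,5,6) * h (D3,D1,D5,D6) + n (3,2,4,5) * h (D3,D2,D4,D5)) +
      (n (1,1,2,4) * h (D1,D1,D2,D4) + n (1,4,5,6) * h (D1,D4,D5,D6) + n (2,1,3,5) * h (D2,D1,D3,D5) +
       n (2,2,5,6) * h (D2,D2,D5,D6) + n (3,1,2,3) * h (D3,D1,D2,D3) + n (3,3,4,6) * h (D3,D3,D4,D6))" for h :: "item \<Rightarrow> nat"
    unfolding sum_over_support[OF sub distinct_leading] leading_coords_def slope_coords_def rest_coords_def
    by (simp add: coord_item_Abs to_digit_def coord_item_first n_def n0_def)
  have F: "(\<Sum>t\<leftarrow>l. if fst (coord_item t) = d then 1 else 0) = count {#D1, D2, D3, D1, D2, D3#} d" for d
    unfolding count_fst[symmetric] balanced(1)[OF l] by (rule refl)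
  have G: "(\<Sum>t\<leftarrow>l. count (digits_of (coord_item t)) d) = count (mset [D1, D1, D1, D2, D2, D2, D3, D3, D3, D4, D4, D4, D5, D5, D5, D6, D6, D6]) d" for d
    unfolding count_snd[symmetric] balanced(2)[OF l] by (rule refl)
  note eqs = F[of D1, unfolded expand[of "\<lambda>y. if fst y = D1 then 1 else 0"], simplified]
    F[of D2, unfolded expand[of "\<lambda>y. if fst y = D2 then 1 else 0"], simplified]
    F[of D3, unfolded expand[of "\<lambda>y. if fst y = D3 then 1 else 0"], simplified]
    G[of D1, unfolded expand[of "\<lambda>y. count (digits_of y) D1"], simplified]
    G[of D2, unfolded expand[of "\<lambda>y. count (digits_of y) D2"], simplified]
    G[of D3, unfolded expand[of "\<lambda>y. count (digits_of y) D3"], simplified]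
    G[of D4, unfolded expand[of "\<lambda>y. count (digits_of y) D4"], simplified]
    G[of D5, unfolded expand[of "\<lambda>y. count (digits_of y) D5"], simplified]
    G[of D6, unfolded expand[of "\<lambda>y. count (digits_of y) D6"], simplified]
  have e1: "n0 + n (1,3,5,6) + n (1,1,2,4) + n (1,4,5,6) = 2" using eqs(1) by linarith
  have e2: "n (2,1,2,4) + n (2,3,4,6) + n (2,1,3,5) + n (2,2,5,6) = 2" using eqs(2) by linarith
  have e3: "n (3,1,5,6) + n (3,2,4,5) + n (3,1,2,3) + n (3,3,4,6) = 2" using eqs(3) by linarith
  have e4: "n0 + n (2,1,2,4) + n (3,1,5,6) + n (1,1,2,4) + n (2,1,3,5) + n (3,1,2,3) = 3" using eqs(4) by linarith
  have e5: "n0 + n (2,1,2,4) + n (3,2,4,5) + n (1,1,2,4) + n (2,2,5,6) + n (3,1,2,3) = 3" using eqs(5) by linarith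
  have e6: "n0 + n (1,3,5,6) + n (2,3,4,6) + n (2,1,3,5) + n (3,1,2,3) + n (3,3,4,6) = 3" using eqs(6) by linarith
  have e7: "n (2,1,2,4) + n (2,3,4,6) + n (3,2,4,5) + n (1,1,2,4) + n (1,4,5,6) + n (3,3,4,6) = 3" using eqs(7) by linarith
  have e8: "n (1,3,5,6) + n (3,1,5,6) + n (3,2,4,5) + n (1,4,5,6) + n (2,1,3,5) + n (2,2,5,6) = 3" using eqs(8) by linarith
  have e9: "n (1,3,5,6) + n (2,3,4,6) + n (3,1,5,6) + n (1,4,5,6) + n (2,2,5,6) + n (3,3,4,6) = 3" using eqs(9) by linarith
  have mult: "n0 = 0 \<Longrightarrow> (\<forall>x\<in>set [(1,3,5,6), (2,1,2,4), (2,3,4,6), (3,1,5,6), (3,2,4,5)]. n x = 0) \<and>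
       (\<forall>x\<in>set [(1,1,2,4), (1,4,5,6), (2,1,3,5), (2,2,5,6), (3,1,2,3), (3,3,4,6)]. n x = 1)"
    "n0 = 1 \<Longrightarrow> (\<forall>x\<in>set [(1,3,5,6), (2,1,2,4), (2,3,4,6), (3,1,5,6), (3,2,4,5)]. n x = 1) \<and>
       (\<forall>x\<in>set [(1,1,2,4), (1,4,5,6), (2,1,3,5), (2,2,5,6), (3,1,2,3), (3,3,4,6)]. n x = 0)"
    using leading_multiplicities[OF e1 e2 e3 e4 e5 e6 e7 e8 e9] unfolding list.set ball_simps by blast+
  have count: "count (mset xs) c = (if c \<in> set xs then 1 else 0)" if "distinct xs" for xs :: "coord list" and c
    using that by (simp add: distinct_count_atmost_1)
  have outside: "count (mset l) c = 0" if "c \<notin> set (first_coord # leading_coords)" for c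
    using sub that by (auto simp: count_eq_zero_iff)
  have vals: "count (mset l) c = v" if "c \<in> set (map Abs_coord xs)" "\<forall>x\<in>set xs. n x = v" for c xs v
    using that by (auto simp: n_def)
  have disj: "set slope_coords \<inter> set rest_coords = {}" "distinct slope_coords" "distinct rest_coords"
      "first_coord \<notin> set slope_coords" "first_coord \<notin> set rest_coords"
    using distinct_leading by (auto simp: leading_coords_def)
  show "mset l = mset rest_coords" if "first_coord \<notin> set l"
  proof (rule multiset_eqI)
    fix c
    have 0: "n0 = 0" using that by (simp add: n0_def count_eq_zero_iff)
    note zs = mult(1)[OF 0, THEN conjunct1] and os = mult(1)[OF 0, THEN conjunct2]
    show "count (mset l) c = count (mset rest_coords) c"
      using vals[OF _ zs, of c] vals[OF _ os, of c] outside[of c] disj 0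
      by (auto simp: count n0_def leading_coords_def slope_coords_def[symmetric] rest_coords_def[symmetric] simp del: list.map)
  qed
  show "mset l = mset (first_coord # slope_coords)" if "count (mset l) first_coord = 1"
  proof (rule multiset_eqI)
    fix c
    have 0: "n0 = 1" using that by (simp add: n0_def)
    note zs = mult(2)[OF 0, THEN conjunct1] and os = mult(2)[OF 0, THEN conjunct2]
    show "count (mset l) c = count (mset (first_coord # slope_coords)) c"
      using vals[OF _ zs, of c] vals[OF _ os, of c] outside[of c] disj that
      by (auto simp: count leading_coords_def slope_coords_def[symmetric] rest_coords_def[symmetric] simp del: list.map)
  qed
qed

text \<open>
  With respect to \<open>weight\<close> the polynomials \<open>FF\<close> and
  \<open>slope\<close> have as leading monomials the products over \<open>rest_coords\<close>
  and over \<open>slope_coords\<close>.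
\<close>
theorem regular_slope:
  assumes "FF * R = slope * S"
  shows "\<exists>T. R = slope * T"
proof (rule leading_monomials_coprime_imp_regular[where wt = weight and a = "list_mon rest_coords" and b = "list_mon slope_coords"])
  have len: "length rest_coords = 6" "length (first_coord # slope_coords) = 6"
    by (simp_all add: rest_coords_def slope_coords_def)
  have filter_all: "filter (\<lambda>c. c \<in> set leading_coords) rest_coords = rest_coords"
     "filter (\<lambda>c. c \<in> set leading_coords) slope_coords = slope_coords"
    by (auto simp: filter_id_conv leading_coords_def)
  show "list_mon rest_coords \<in> keys FF"
    unfolding in_keys_iff lookup_FF_arrangement[OF len(1)] coord_items_rest arrangement_sum_Q by simp
  have "list_mon (first_coord # slope_coords) = single first_coord 1 + list_mon slope_coords"
    by (simp add: list_mon_def)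
  note first = this
  have "lookup FF (list_mon (first_coord # slope_coords)) \<noteq> 0"
    unfolding lookup_FF_arrangement[OF len(2)] list.map coord_items_slope coord_item_first arrangement_sum_P by simp
  moreover have "first_coord \<notin> set slope_coords" using distinct_leading by (simp add: leading_coords_def)
  ultimately show "list_mon slope_coords \<in> keys slope"
    by (simp add: in_keys_iff slope_def lookup_slope_in first lookup_list_mon count_eq_zero_iff)
  fix m
  show "weight m < weight (list_mon rest_coords)" if m: "m \<in> keys FF" "m \<noteq> list_mon rest_coords"
  proof -
    obtain l where l: "m = list_mon l" "length l = 6" "placement_sum letters no_columns (map coord_item l) \<noteq> 0"
      by (rule keys_FF[OF m(1)])
    have "\<not> set l \<subseteq> set leading_coords"
    proof
      assume sub: "set l \<subseteq> set leading_coords"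
      then have "first_coord \<notin> set l" using distinct_leading by auto
      then have "mset l = mset rest_coords" using leading_monomials_unique(1)[OF l(2,3)] sub by auto
      then show False using m(2) l(1) by (simp add: list_mon_eq_iff)
    qed
    then obtain x where x: "x \<in> set l" "x \<notin> set leading_coords" by blast
    have "length (filter (\<lambda>c. c \<in> set leading_coords) l) < length l"
      by (rule length_filter_less[where x = x]) (use x in auto)
    then show ?thesis by (simp only: l weight_list_mon filter_all len)
  qed
  show "weight m < weight (list_mon slope_coords)" if m: "m \<in> keys slope" "m \<noteq> list_mon slope_coords"
  proof (rule ccontr)
    assume heavy: "\<not> ?thesis"
    have k: "lookup m first_coord = 0" "single first_coord 1 + m \<in> keys FF"
      using m(1) by (auto simp: in_keys_iff slope_def lookup_slope_in split: if_splits)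
    obtain l where l: "single first_coord 1 + m = list_mon l" "length l = 6" "placement_sum letters no_columns (map coord_item l) \<noteq> 0"
      by (rule keys_FF[OF k(2)])
    have "count (mset l) first_coord = lookup (single first_coord 1 + m) first_coord"
      unfolding l(1) lookup_list_mon by (rule refl)
    then have one: "count (mset l) first_coord = 1" using k(1) by (simp add: lookup_add)
    then have mem: "first_coord \<in> set l" by (metis count_mset_0_iff zero_neq_one)
    have "weight m \<le> weight (list_mon l)" by (simp add: l(1)[symmetric] weight_add)
    then have "5 \<le> length (filter (\<lambda>c. c \<in> set leading_coords) l)"
      using heavy len(2) by (simp add: weight_list_mon filter_all)
    then have "length (filter (\<lambda>c. c \<notin> set leading_coords) l) \<le> 1"
      using sum_length_filter_compl[of "\<lambda>c. c \<in> set leading_coords" l] l(2) by simp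
    moreover have "first_coord \<in> set (filter (\<lambda>c. c \<notin> set leading_coords) l)"
      using mem distinct_leading by simp
    ultimately have "filter (\<lambda>c. c \<notin> set leading_coords) l = [first_coord]"
      by (cases "filter (\<lambda>c. c \<notin> set leading_coords) l") auto
    then have "{c \<in> set l. c \<notin> set leading_coords} = {first_coord}"
      by (metis list.simps(15) empty_set set_filter)
    then have "set l \<subseteq> set (first_coord # leading_coords)" by auto
    then have "mset l = mset (first_coord # slope_coords)"
      using leading_monomials_unique(2)[OF l(2,3)] one by blast
    then have "single first_coord 1 + m = list_mon (first_coord # slope_coords)"
      unfolding l(1) list_mon_eq_iff .
    then have "m = list_mon slope_coords" unfolding first by (rule add_left_imp_eq)
    then show False using m(2) by simp
  qed
  show "lookup (list_mon rest_coords) v = 0 \<or> lookup (list_mon slope_coords) v = 0" for v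
    using distinct_leading by (auto simp: lookup_list_mon count_eq_zero_iff leading_coords_def)
qed (rule weight_add, rule assms)

lemma slope_nonzero: "slope \<noteq> 0"
proof
  assume "slope = 0"
  have "length (first_coord # slope_coords) = 6" by (simp add: slope_coords_def)
  from lookup_FF_arrangement[OF this] have "lookup FF (list_mon (first_coord # slope_coords)) \<noteq> 0"
    unfolding list.map coord_items_slope coord_item_first arrangement_sum_P by simp
  moreover have "list_mon (first_coord # slope_coords) = single first_coord 1 + list_mon slope_coords"
    by (simp add: list_mon_def)
  moreover have "first_coord \<notin> set slope_coords" using distinct_leading by (simp add: leading_coords_def)
  ultimately have "lookup slope (list_mon slope_coords) \<noteq> 0"
    by (simp add: slope_def lookup_slope_in lookup_list_mon count_eq_zero_iff)
  then show False using \<open>slope = 0\<close> by simp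
qed

section \<open>Vanishing on sums of five points\<close>

text \<open>
  Complete the vectors to a basis and invert the matrix of that basis.
\<close>
lemma invertible_matrix_extending:
  fixes f :: "'n::finite \<Rightarrow> complex ^ 'n"
  assumes inj: "inj_on f I" and indep: "vec.independent (f ` I)"
  obtains h :: "complex ^ 'n ^ 'n" where "det h \<noteq> 0" "\<And>i. i \<in> I \<Longrightarrow> h *v f i = axis i 1"
proof -
  let ?C = "vec.extend_basis (f ` I)"
  have sup: "f ` I \<subseteq> ?C" and ind: "vec.independent ?C" and span: "vec.span ?C = UNIV"
    using vec.extend_basis_superset[OF indep] vec.independent_extend_basis[OF indep] vec.span_extend_basis[OF indep] by auto
  have fin: "finite ?C" by (rule vec.finiteI_independent[OF ind])
  have "card ?C = vec.dim (UNIV :: (complex ^ 'n) set)"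
    using vec.dim_span_eq_card_independent[OF ind] span by simp
  then have "card ?C = CARD('n)" by (simp only: vec_dim_card)
  moreover have "card (?C - f ` I) = card ?C - card I"
    using sup fin inj by (simp add: card_Diff_subset finite_subset card_image)
  moreover have "card (- I) = CARD('n) - card I" by (simp add: Compl_eq_Diff_UNIV card_Diff_subset)
  ultimately have "card (- I) = card (?C - f ` I)" by simp
  then obtain g where g: "bij_betw g (- I) (?C - f ` I)"
    using fin by (metis finite_same_card_bij finite_Diff finite)
  define F where "F = (\<lambda>i. if i \<in> I then f i else g i)"
  define A :: "complex ^ 'n ^ 'n" where "A = (\<chi> i. F i)"
  have rowA: "row i A = F i" for i by (simp add: row_def A_def vec_eq_iff)
  have "bij_betw F (I \<union> - I) (f ` I \<union> (?C - f ` I))"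
  proof (rule bij_betw_combine)
    show "bij_betw F I (f ` I)" unfolding F_def by (rule bij_betw_imageI) (use inj in \<open>auto simp: inj_on_def\<close>)
    show "bij_betw F (- I) (?C - f ` I)" using g by (rule bij_betw_cong[THEN iffD1, rotated]) (simp add: F_def)
  qed auto
  then have F: "inj F" "range F = ?C" using sup by (auto simp: bij_betw_def Un_absorb1)
  have "invertible A"
    unfolding invertible_right_inverse matrix_right_invertible_independent_rows
  proof (intro allI impI)
    fix c i assume "(\<Sum>i\<in>UNIV. c i *s row i A) = 0"
    then have "(\<Sum>i\<in>UNIV. c (inv_into UNIV F (F i)) *s F i) = 0" using F(1) by (simp add: rowA)
    then have "(\<Sum>x\<in>?C. c (inv_into UNIV F x) *s x) = 0"
      using sum.reindex[OF F(1), of "\<lambda>x. c (inv_into UNIV F x) *s x"] F(2) by (simp add: o_def)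
    moreover have "\<forall>u. \<not> ((\<exists>x\<in>?C. u x \<noteq> 0) \<and> (\<Sum>x\<in>?C. u x *s x) = 0)"
      using ind unfolding vec.dependent_finite[OF fin] not_ex .
    note this[THEN spec, of "\<lambda>x. c (inv_into UNIV F x)"]
    ultimately have "c (inv_into UNIV F (F i)) = 0" using F(2) by auto
    then show "c i = 0" using F(1) by simp
  qed
  then obtain B where B: "A ** B = mat 1" "B ** A = mat 1" unfolding invertible_def by blast
  show ?thesis
  proof
    have "det B * det A = 1" using B(2) by (metis det_I det_mul)
    then show "det (transpose B) \<noteq> 0" by (auto simp: det_transpose)
    fix i assume i: "i \<in> I"
    have "f i = transpose A *v axis i 1"
      using i by (simp add: vec_eq_iff transpose_def matrix_vector_mult_def A_def F_def axis_def if_distrib cong: if_cong del: transpose_matrix_vector)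
    then have "transpose B *v f i = (transpose B ** transpose A) *v axis i 1" by (simp only: matrix_vector_mul_assoc)
    also have "transpose B ** transpose A = mat 1" by (metis B(1) matrix_transpose_mul transpose_mat)
    finally show "transpose B *v f i = axis i 1" by simp
  qed
qed

lemma tensor_wedge_nonzero_imp:
  assumes "tensor_wedge v a b c \<noteq> 0"
  shows "v \<noteq> 0" "distinct [a, b, c]" "vec.independent {a, b, c}"
proof -
  show "v \<noteq> 0" using assms tensor_wedge_0 by auto
  show d: "distinct [a, b, c]" using assms tensor_wedge_repeated by auto
  have comb: "tensor_wedge v x y z = 0" if span: "x \<in> vec.span {y, z}" for x y z
  proof -
    obtain k where "x - k *s y \<in> vec.span {z}" using span vec.span_breakdown_eq[of x y "{z}"] by blast
    then obtain l where "x - k *s y = l *s z" unfolding vec.span_singleton by blast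
    then have "x = k *s y + l *s z" by (simp add: algebra_simps)
    then show ?thesis by (simp add: tensor_wedge_add tensor_wedge_scale tensor_wedge_repeated)
  qed
  show "vec.independent {a, b, c}"
    unfolding vec.dependent_def
  proof
    assume "\<exists>x\<in>{a, b, c}. x \<in> vec.span ({a, b, c} - {x})"
    then consider "a \<in> vec.span {b, c}" | "b \<in> vec.span {a, c}" | "c \<in> vec.span {a, b}"
      using d by (auto simp: insert_Diff_if split: if_splits)
    then show False
    proof cases
      case 1
      then show False using comb assms by blast
    next
      case 2
      then show False using comb[of b a c] assms tensor_wedge_swap(1)[of v b a c] by simp
    next
      case 3
      then show False using comb[of c a b] assms tensor_wedge_swap(2)[of v a c b] tensor_wedge_swap(1)[of v c a b] by simp
    qed
  qed
qed

abbreviation FF_at :: "complex ^ coord \<Rightarrow> complex" where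
  "FF_at x \<equiv> meval FF (\<lambda>t. x $ t)"

lemma FF_at_axis:
  "FF_at (x + r *s axis first_coord 1) = FF_at x + r * meval slope (\<lambda>t. x $ t)"
proof -
  have upd: "(\<lambda>t. (x + r *s axis first_coord 1) $ t) = (\<lambda>t. x $ t)(first_coord := x $ first_coord + r)"
    by (auto simp: axis_def)
  have free: "free_of first_coord slope" "free_of first_coord rest"
    by (simp_all add: slope_def rest_def free_of_slope_in free_of_rest_in)
  show ?thesis
    unfolding upd by (subst (1 2) FF_split) (simp add: meval_add meval_mult free_of_meval[OF free(1)] free_of_meval[OF free(2)] algebra_simps)
qed

text \<open>
  Along the first coordinate axis this is \<open>degree_first_coord\<close>. A nonzero
  decomposable tensor is moved to that axis by invertible matrices \<open>g\<close> and
  \<open>h\<close>, which only multiply the values by a nonzero constant.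
\<close>
theorem FF_affine_along_points:
  "FF_at (x + r *s tw y) = (1 - r) * FF_at x + r * FF_at (x + tw y)"
proof -
  obtain v a b c where y: "y = (v, a, b, c)" using prod_cases4 by blast
  show ?thesis
  proof (cases "tw y = 0")
    case True
    then show ?thesis by (simp add: algebra_simps)
  next
    case False
    then have nz: "v \<noteq> 0" "distinct [a, b, c]" "vec.independent {a, b, c}"
      using tensor_wedge_nonzero_imp by (auto simp: y)
    obtain g :: "complex ^ 3 ^ 3" where g: "det g \<noteq> 0" "g *v v = axis 1 1"
      using invertible_matrix_extending[of "\<lambda>i. v" "{1::3}"] nz(1) by auto
    define f :: "6 \<Rightarrow> complex ^ 6" where "f = (\<lambda>i. if i = 1 then a else if i = 2 then b else c)"
    have "f ` {1, 2, 3} = {a, b, c}" "inj_on f {1, 2, 3}" using nz(2) by (auto simp: f_def)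
    then obtain h :: "complex ^ 6 ^ 6" where h: "det h \<noteq> 0" "\<And>i. i \<in> {1, 2, 3} \<Longrightarrow> h *v f i = axis i 1"
      using invertible_matrix_extending[of f "{1, 2, 3}"] nz(3) by auto
    then have habc: "h *v a = axis 1 1" "h *v b = axis 2 1" "h *v c = axis 3 1"
      using h(2)[of 1] h(2)[of 2] h(2)[of 3] by (simp_all add: f_def)
    let ?k = "det g ^ 2 * det h ^ 3"
    define P :: "complex \<Rightarrow> coord option \<Rightarrow> point" where
      "P = (\<lambda>r s. case s of None \<Rightarrow> (r *s v, a, b, c) | Some t \<Rightarrow> item_point (x $ t) (coord_item t))"
    define x' where "x' = (\<Sum>t\<in>UNIV. tw (transform g h (item_point (x $ t) (coord_item t))))"
    have sum_option: "(\<Sum>s\<in>UNIV. q s) = q None + (\<Sum>t\<in>UNIV. q (Some t))" for q :: "coord option \<Rightarrow> complex ^ coord"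
      by (simp add: UNIV_option_conv sum.reindex)
    have "(\<Sum>t\<in>UNIV. tw (item_point (x $ t) (coord_item t))) = x"
      by (simp add: tw_item_point basis_expansion)
    then have s1: "(\<Sum>s\<in>UNIV. tw (P r s)) = x + r *s tw y" for r
      by (simp add: sum_option P_def y tensor_wedge_scale add.commute)
    have "tensor_wedge (axis 1 1) (axis 1 1) (axis 2 1) (axis 3 1) = axis first_coord 1"
      using tensor_wedge_unit[OF coord_item_first] by (simp add: unit_vec_def)
    then have s2: "(\<Sum>s\<in>UNIV. tw (transform g h (P r s))) = x' + r *s axis first_coord 1" for r
      by (simp add: sum_option P_def x'_def g(2) habc tensor_wedge_scale matrix_vector_mult_scaleR vector_scalar_commute add.commute)
    have eq: "FF_at (x' + r *s axis first_coord 1) = ?k * FF_at (x + r *s tw y)" for r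
      using meval_FF_transform[where P = "P r" and g = g and h = h and S = UNIV] unfolding s1 s2 .
    have "?k * FF_at (x + r *s tw y) = FF_at x' + r * meval slope (\<lambda>t. x' $ t)" for r
      unfolding eq[symmetric] by (rule FF_at_axis)
    note line = this
    have "?k * FF_at (x + r *s tw y) = ?k * ((1 - r) * FF_at x + r * FF_at (x + tw y))"
      using line[of r] line[of 0] line[of 1] by (simp add: algebra_simps)
    moreover have "?k \<noteq> 0" using g h by simp
    ultimately show ?thesis by (metis mult_left_cancel)
  qed
qed

lemma FF_along_sum:
  fixes P :: "nat \<Rightarrow> point"
  shows "\<exists>q. Polynomial.degree q \<le> n \<and> (\<forall>r. FF_at (x + r *s (\<Sum>s<n. tw (P s))) = poly q r)"
proof (induction n arbitrary: x)
  case 0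
  show ?case by (intro exI[of _ "[:FF_at x:]"]) simp
next
  case (Suc n)
  obtain q0 where q0: "Polynomial.degree q0 \<le> n" "\<And>r. FF_at (x + r *s (\<Sum>s<n. tw (P s))) = poly q0 r"
    using Suc.IH by blast
  obtain q1 where q1: "Polynomial.degree q1 \<le> n" "\<And>r. FF_at ((x + tw (P n)) + r *s (\<Sum>s<n. tw (P s))) = poly q1 r"
    using Suc.IH by blast
  have "FF_at (x + r *s (\<Sum>s<Suc n. tw (P s))) = poly ([:1, -1:] * q0 + [:0, 1:] * q1) r" for r
  proof -
    have "FF_at (x + r *s (\<Sum>s<Suc n. tw (P s))) = FF_at ((x + r *s (\<Sum>s<n. tw (P s))) + r *s tw (P n))"
      by (simp add: vector_add_ldistrib add.assoc)
    also have "\<dots> = (1 - r) * poly q0 r + r * FF_at ((x + r *s (\<Sum>s<n. tw (P s))) + tw (P n))"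
      unfolding FF_affine_along_points q0(2) ..
    also have "(x + r *s (\<Sum>s<n. tw (P s))) + tw (P n) = (x + tw (P n)) + r *s (\<Sum>s<n. tw (P s))"
      by (simp add: add_ac)
    finally show ?thesis unfolding q1(2) by (simp add: algebra_simps)
  qed
  moreover have "Polynomial.degree ([:1, -1:] * q0 + [:0, 1:] * q1) \<le> Suc n"
  proof (rule degree_add_le)
    show "Polynomial.degree ([:1, -1:] * q0) \<le> Suc n" "Polynomial.degree ([:0, 1:] * q1) \<le> Suc n"
      using degree_mult_le[of "[:1, -1:]" q0] degree_mult_le[of "[:0, 1:]" q1] q0(1) q1(1) by auto
  qed
  ultimately show ?case by blast
qed

lemma homogeneous_meval_scale:
  assumes "homogeneous d G"
  shows "meval G (\<lambda>t. r * p t) = r ^ d * meval G p"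
  unfolding meval_monval sum_distrib_left
proof (intro sum.cong refl)
  fix m assume "m \<in> keys G"
  then have "(\<Sum>t\<in>keys m. lookup m t) = d"
    using assms by (auto simp: homogeneous_def mdegree_def)
  then show "lookup G m * monval (\<lambda>t. r * p t) m = r ^ d * (lookup G m * monval p m)"
    by (simp add: monval_def power_mult_distrib prod.distrib flip: power_sum)
qed

text \<open>
  At \<open>r\<close> times a sum of \<open>n\<close> decomposable tensors the value is a
  polynomial in \<open>r\<close> of degree at most \<open>n\<close>, and on the other hand a
  multiple of \<open>r ^ 6\<close>.
\<close>
theorem FF_vanishes:
  fixes P :: "nat \<Rightarrow> point"
  assumes "n \<le> 5"
  shows "FF_at (\<Sum>s<n. tw (P s)) = 0"
proof -
  obtain q where q: "Polynomial.degree q \<le> n" "\<And>r. FF_at (0 + r *s (\<Sum>s<n. tw (P s))) = poly q r"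
    using FF_along_sum by blast
  define w where "w = FF_at (\<Sum>s<n. tw (P s))"
  have "poly q r = poly (Polynomial.monom w 6) r" for r
  proof -
    have "poly q r = meval FF (\<lambda>t. r * (\<Sum>s<n. tw (P s)) $ t)" unfolding q(2)[symmetric]
      by (rule arg_cong[of _ _ "meval FF"]) (simp add: fun_eq_iff)
    also have "\<dots> = r ^ 6 * w" unfolding w_def by (rule homogeneous_meval_scale[OF homogeneous_FF])
    finally show ?thesis by (simp add: poly_monom)
  qed
  then have "q = Polynomial.monom w 6" by (simp add: poly_eq_poly_eq_iff[symmetric] fun_eq_iff)
  then have "w = 0" using q(1) assms by (cases "w = 0") (auto simp: degree_monom_eq)
  then show ?thesis by (simp add: w_def)
qed

text \<open>
  The value of \<open>slope\<close> at \<open>p\<close> is the difference of the values of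
  \<open>FF\<close> at \<open>p\<close> and at the sum of \<open>p\<close> and the first axis
  vector, which is decomposable.
\<close>
lemma slope_vanishes:
  fixes P :: "nat \<Rightarrow> point"
  assumes "n \<le> 4"
  shows "meval slope (\<lambda>t. (\<Sum>s<n. tw (P s)) $ t) = 0"
proof -
  define P' where "P' = (\<lambda>s. if s = n then item_point 1 (coord_item first_coord) else P s)"
  have "(\<Sum>s<Suc n. tw (P' s)) = (\<Sum>s<n. tw (P s)) + 1 *s axis first_coord 1"
    unfolding tw_item_point[symmetric] by (simp add: P'_def)
  then have "FF_at ((\<Sum>s<n. tw (P s)) + 1 *s axis first_coord 1) = 0"
    using FF_vanishes[of "Suc n" P'] assms by simp
  moreover have "FF_at (\<Sum>s<n. tw (P s)) = 0" using FF_vanishes[of n P] assms by simp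
  ultimately show ?thesis using FF_at_axis[of "\<Sum>s<n. tw (P s)" 1] by (metis add_0 mult_1)
qed

section \<open>Sums of five points fill a cone over an open set\<close>

lemma sum_UNIV_5: "(\<Sum>s\<in>UNIV. q (s :: 5)) = (\<Sum>s<5. q (of_nat s))"
proof -
  have 5: "(UNIV :: 5 set) = {0, 1, 2, 3, 4}"
  proof -
    have "card {0, 1, 2, 3, 4 :: 5} = CARD(5)" by simp
    then show ?thesis by (metis card_subset_eq finite subset_UNIV)
  qed
  have "{..<5::nat} = {0, 1, 2, 3, 4}" by auto
  then show ?thesis unfolding 5 by simp
qed

text \<open>
  Sums of five decomposable tensors plus multiples of the first axis vector depend on their
  parameters by a map with surjective derivative at \<open>base_point\<close>, so they fill an
  open set. A polynomial without the first coordinate has the same value with and without the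
  added multiple.
\<close>
theorem sums_of_points_dominant:
  assumes free: "free_of first_coord H"
    and vanish: "\<And>P. meval H (\<lambda>t. (\<Sum>s<5::nat. tw (P s)) $ t) = 0"
  shows "H = 0"
proof -
  define family :: "(point ^ 5) \<times> complex \<Rightarrow> complex ^ coord" where
    "family = (\<lambda>\<theta>. (\<Sum>s\<in>UNIV. tw (fst \<theta> $ s)) + snd \<theta> *s axis first_coord 1)"
  define derivative :: "(point ^ 5) \<times> complex \<Rightarrow> (point ^ 5) \<times> complex \<Rightarrow> complex ^ coord" where
    "derivative = (\<lambda>\<theta> h. (\<Sum>s\<in>UNIV. tangent (fst \<theta> $ s) (fst h $ s)) + snd h *s axis first_coord 1)"
  have deriv: "(family has_derivative derivative \<theta>) (at \<theta>)" for \<theta>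
  proof -
    have proj: "((\<lambda>\<theta>::(point ^ 5) \<times> complex. fst \<theta> $ s) has_derivative (\<lambda>h. fst h $ s)) (at \<theta>)" for s
      by (intro bounded_linear_imp_has_derivative bounded_linear_compose[OF bounded_linear_vec_nth] bounded_linear_fst)
    have "((\<lambda>\<theta>. tw (fst \<theta> $ s)) has_derivative (\<lambda>h. tangent (fst \<theta> $ s) (fst h $ s))) (at \<theta>)" for s
      by (rule has_derivative_compose[OF proj has_derivative_tw])
    then show ?thesis
      unfolding family_def derivative_def
      by (intro has_derivative_add has_derivative_sum bounded_linear.has_derivative[OF bounded_linear_scale_axis] has_derivative_snd has_derivative_ident)
  qed
  define \<theta>0 :: "(point ^ 5) \<times> complex" where "\<theta>0 = ((\<chi> s. base_point s), 0)"
  have single: "\<exists>h. derivative \<theta>0 h = tangent (base_point s) y" for s y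
  proof -
    have "(\<Sum>u\<in>UNIV. tangent (base_point u) (if u = s then y else 0)) = (\<Sum>u\<in>UNIV. if u = s then tangent (base_point s) y else 0)"
      by (intro sum.cong refl) (auto simp: tangent_0)
    then show ?thesis by (intro exI[of _ "((\<chi> u. if u = s then y else 0), 0)"]) (simp add: derivative_def \<theta>0_def)
  qed
  have lin: "linear (derivative \<theta>0)" using deriv by (rule has_derivative_linear)
  have "range (derivative \<theta>0) = UNIV"
  proof (rule complex_subspace_UNIV)
    show "0 \<in> range (derivative \<theta>0)" unfolding linear_0[OF lin, symmetric] by (rule rangeI)
    show "x + y \<in> range (derivative \<theta>0)" if xy: "x \<in> range (derivative \<theta>0)" "y \<in> range (derivative \<theta>0)" for x y
    proof -
      obtain h h' where "x = derivative \<theta>0 h" "y = derivative \<theta>0 h'" using xy by blast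
      then have "x + y = derivative \<theta>0 (h + h')" by (simp only: linear_add[OF lin])
      then show ?thesis by (simp only: rangeI)
    qed
    show "r *s x \<in> range (derivative \<theta>0)" if x: "x \<in> range (derivative \<theta>0)" for r x
    proof -
      obtain h where "x = derivative \<theta>0 h" using x by blast
      then have "r *s x = derivative \<theta>0 ((\<chi> s. scale_point r (fst h $ s)), r * snd h)"
        by (simp add: derivative_def tangent_scale vector_add_ldistrib vec.scale_sum_right)
      then show ?thesis by simp
    qed
    fix f assume f: "\<And>x. x \<in> range (derivative \<theta>0) \<Longrightarrow> (\<Sum>t\<in>UNIV. f t * x $ t) = 0"
    show "f = (\<lambda>t. 0)"
    proof (rule tangents_dual_trivial)
      show "(\<Sum>t\<in>UNIV. f t * tangent (base_point s) h $ t) = 0" for s h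
        using f single[of s h] by (metis rangeI)
      fix t assume "coord_item t = (D1, D1, D2, D3)"
      then have t: "t = first_coord" using inj_coord_item coord_item_first by (metis injD)
      have "derivative \<theta>0 (0, 1) = axis first_coord 1" by (simp add: derivative_def tangent_0)
      then have "(\<Sum>t\<in>UNIV. f t * axis first_coord 1 $ t) = 0" using f by (metis rangeI)
      then show "f t = 0" by (simp add: t axis_def if_distrib cong: if_cong)
    qed
  qed
  then obtain g where g: "linear g" "derivative \<theta>0 \<circ> g = id"
    using linear_surjective_right_inverse[OF lin] by blast
  have "family \<theta>0 \<in> interior (range family)"
  proof (rule sussmann_open_mapping[of UNIV family \<theta>0 "derivative \<theta>0" g UNIV])
    show "continuous_on UNIV family"
      by (intro continuous_at_imp_continuous_on ballI has_derivative_continuous[OF deriv])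
    show "(family has_derivative derivative \<theta>0) (at \<theta>0)" by (rule deriv)
    show "bounded_linear g" using g(1) by (simp add: linear_conv_bounded_linear)
    show "derivative \<theta>0 \<circ> g = id" by (rule g(2))
  qed simp_all
  then have ne: "interior (range family) \<noteq> {}" by blast
  show "H = 0"
  proof (rule meval_open_0[OF open_interior ne])
    fix x assume "x \<in> interior (range family)"
    then have "x \<in> range family" using interior_subset by blast
    then obtain \<theta> where "x = family \<theta>" by blast
    then have x: "x = family (fst \<theta>, snd \<theta>)" by simp
    define z where "z = (\<Sum>s<5. tw (fst \<theta> $ of_nat s))"
    have "x = z + snd \<theta> *s axis first_coord 1" by (simp add: x family_def z_def sum_UNIV_5)
    then have "(\<lambda>t. x $ t) = (\<lambda>t. z $ t)(first_coord := z $ first_coord + snd \<theta>)" by (auto simp: axis_def)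
    then have "meval H (\<lambda>t. x $ t) = meval H (\<lambda>t. z $ t)" by (simp only: free_of_meval[OF free])
    then show "meval H (\<lambda>t. x $ t) = 0"
      unfolding z_def using vanish[of "\<lambda>s. fst \<theta> $ of_nat s"] by simp
  qed
qed

section \<open>The equation of the secant variety\<close>

definition five_sums :: "(coord \<Rightarrow> complex) set" where
  "five_sums = {(\<lambda>t. (\<Sum>s<5::nat. tw (P s)) $ t) | P. True}"

interpretation secant: affine_equation first_coord FF slope rest five_sums
proof
  show "FF = mvar first_coord * slope + rest" by (rule FF_split)
  show "free_of first_coord slope" "free_of first_coord rest"
    by (simp_all add: slope_def rest_def free_of_slope_in free_of_rest_in)
  show "slope \<noteq> 0" by (rule slope_nonzero)
  show "\<And>R S. FF * R = slope * S \<Longrightarrow> \<exists>T. R = slope * T" by (rule regular_slope)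
  show "meval FF z = 0" if z: "z \<in> five_sums" for z
  proof -
    obtain P where "z = (\<lambda>t. (\<Sum>s<5::nat. tw (P s)) $ t)" using z unfolding five_sums_def by blast
    then show ?thesis using FF_vanishes[of 5 P] by simp
  qed
  show "H = 0" if "free_of first_coord H" "\<And>z. z \<in> five_sums \<Longrightarrow> meval H z = 0" for H
    using that(1)
  proof (rule sums_of_points_dominant)
    fix P
    have "(\<lambda>t. (\<Sum>s<5::nat. tw (P s)) $ t) \<in> five_sums"
      unfolding five_sums_def by (intro CollectI exI[of _ P] conjI refl TrueI)
    then show "meval H (\<lambda>t. (\<Sum>s<5::nat. tw (P s)) $ t) = 0" by (rule that(2))
  qed
qed

lemma proj_point_self: "p \<in> proj_point p"
  unfolding proj_point_def by (metis (mono_tags, lifting) mem_Collect_eq vector_smult_lid)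

lemma proj_point_in_zero_locus:
  assumes "homogeneous d G" "p \<noteq> 0"
  shows "proj_point p \<in> zero_locus G \<longleftrightarrow> meval G (\<lambda>i. p $ i) = 0"
proof
  assume "proj_point p \<in> zero_locus G"
  then obtain q where q: "proj_point p = proj_point q" "meval G (\<lambda>i. q $ i) = 0"
    by (auto simp: zero_locus_def)
  then obtain r where "p = r *s q" using proj_point_self[of p] by (auto simp: proj_point_def)
  then have "(\<lambda>i. p $ i) = (\<lambda>i. r * q $ i)" by simp
  then show "meval G (\<lambda>i. p $ i) = 0"
    using homogeneous_meval_scale[OF assms(1), of r "\<lambda>i. q $ i"] q(2) by simp
qed (use assms(2) in \<open>auto simp: zero_locus_def\<close>)

lemma segre_grassmann_point:
  assumes "proj_point x \<in> segre_grassmann"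
  shows "\<exists>y. x = tw y"
proof -
  obtain v a b c where "proj_point x = proj_point (tensor_wedge v a b c)"
    using assms by (auto simp: segre_grassmann_def)
  then obtain r where "x = r *s tensor_wedge v a b c"
    using proj_point_self[of x] by (auto simp: proj_point_def)
  then have "x = tw (r *s v, a, b, c)" by (simp add: tensor_wedge_scale)
  then show ?thesis by blast
qed

lemma tw_in_segre_grassmann:
  assumes "tw y \<noteq> 0"
  shows "proj_point (tw y) \<in> segre_grassmann"
proof -
  obtain v a b c where y: "y = (v, a, b, c)" using prod_cases4 by blast
  show ?thesis
    using tensor_wedge_nonzero_imp[of v a b c] assms unfolding segre_grassmann_def y tw.simps by blast
qed

lemma sum_of_points_tw:
  assumes "sum_of_points segre_grassmann n p"
  shows "\<exists>P. p = (\<Sum>s<n. tw (P s))"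
proof -
  obtain x where x: "\<And>i. i < n \<Longrightarrow> proj_point (x i) \<in> segre_grassmann" "p = (\<Sum>i<n. x i)"
    using assms by (auto simp: sum_of_points_def)
  then have "\<forall>i. \<exists>y. i < n \<longrightarrow> x i = tw y" using segre_grassmann_point by blast
  then obtain P where "\<And>i. i < n \<Longrightarrow> x i = tw (P i)" by metis
  then show ?thesis using x(2) by (intro exI[of _ P]) simp
qed

lemma sum_tw_sum_of_points:
  "\<exists>r\<le>n. sum_of_points segre_grassmann r (\<Sum>s<n. tw (P s))"
proof (induction n)
  case 0
  show ?case by (intro exI[of _ 0]) (simp add: sum_of_points_def)
next
  case (Suc n)
  then obtain r where r: "r \<le> n" "sum_of_points segre_grassmann r (\<Sum>s<n. tw (P s))" by blast
  show ?case
  proof (cases "tw (P n) = 0")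
    case True
    then show ?thesis using r by (intro exI[of _ r]) simp
  next
    case False
    obtain x where x: "\<And>i. i < r \<Longrightarrow> x i \<noteq> 0 \<and> proj_point (x i) \<in> segre_grassmann" "(\<Sum>s<n. tw (P s)) = (\<Sum>i<r. x i)"
      using r(2) by (auto simp: sum_of_points_def)
    have "(\<Sum>s<Suc n. tw (P s)) = (\<Sum>i<Suc r. (x(r := tw (P n))) i)" by (simp add: x(2))
    moreover have "\<forall>i<Suc r. (x(r := tw (P n))) i \<noteq> 0 \<and> proj_point ((x(r := tw (P n))) i) \<in> segre_grassmann"
      using x(1) False tw_in_segre_grassmann by (auto simp: less_Suc_eq)
    ultimately have "sum_of_points segre_grassmann (Suc r) (\<Sum>s<Suc n. tw (P s))"
      unfolding sum_of_points_def by blast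
    then show ?thesis using r(1) by (intro exI[of _ "Suc r"]) simp
  qed
qed

definition rank_five :: "(complex ^ coord) set set" where
  "rank_five = {proj_point p | p. p \<noteq> 0 \<and> has_rank segre_grassmann 5 p}"

text \<open>
  A sum of five points that does not have rank five is a sum of at most four points, where
  \<open>slope\<close> vanishes. So \<open>slope * G\<close> vanishes at all sums of five
  points, and the factor \<open>slope\<close> can be cancelled.
\<close>
theorem vanishes_on_rank_five_iff:
  assumes G: "homogeneous d G"
  shows "rank_five \<subseteq> zero_locus G \<longleftrightarrow> FF dvd G"
proof
  assume "FF dvd G"
  show "rank_five \<subseteq> zero_locus G"
  proof
    fix L assume "L \<in> rank_five"
    then obtain p where p: "L = proj_point p" "p \<noteq> 0" "sum_of_points segre_grassmann 5 p"
      by (auto simp: rank_five_def has_rank_def)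
    have "(\<lambda>t. p $ t) \<in> five_sums" using sum_of_points_tw[OF p(3)] unfolding five_sums_def by blast
    then have "meval G (\<lambda>t. p $ t) = 0" using \<open>FF dvd G\<close> secant.vanishes_iff_dvd by blast
    then show "L \<in> zero_locus G" using p(1,2) by (auto simp: zero_locus_def)
  qed
next
  assume sub: "rank_five \<subseteq> zero_locus G"
  have "\<forall>z\<in>five_sums. meval (slope * G) z = 0"
  proof
    fix z assume "z \<in> five_sums"
    then obtain P where z: "z = (\<lambda>t. (\<Sum>s<5::nat. tw (P s)) $ t)" unfolding five_sums_def by blast
    define p where "p = (\<Sum>s<5::nat. tw (P s))"
    obtain r where r: "r \<le> 5" "sum_of_points segre_grassmann r p"
      using sum_tw_sum_of_points[of 5 P] by (auto simp: p_def)
    define r0 where "r0 = (LEAST r. sum_of_points segre_grassmann r p)"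
    have r0: "sum_of_points segre_grassmann r0 p" "r0 \<le> 5"
      using LeastI[of "\<lambda>r. sum_of_points segre_grassmann r p", OF r(2)]
        Least_le[of "\<lambda>r. sum_of_points segre_grassmann r p", OF r(2)] r(1) by (simp_all add: r0_def)
    have rank: "has_rank segre_grassmann r0 p"
      using r0(1) not_less_Least by (auto simp: has_rank_def r0_def)
    show "meval (slope * G) z = 0"
    proof (cases "r0 = 5")
      case True
      have "sum_of_points segre_grassmann 0 (0 :: complex ^ coord)" by (simp add: sum_of_points_def)
      then have "p \<noteq> 0" using rank True by (auto simp: has_rank_def)
      then have "proj_point p \<in> zero_locus G" using sub rank True by (auto simp: rank_five_def)
      then have "meval G (\<lambda>t. p $ t) = 0" using proj_point_in_zero_locus[OF G \<open>p \<noteq> 0\<close>] by simp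
      then show ?thesis unfolding z meval_mult p_def[symmetric] by simp
    next
      case False
      obtain P' where "p = (\<Sum>s<r0. tw (P' s))" using sum_of_points_tw[OF r0(1)] by blast
      then have "meval slope (\<lambda>t. p $ t) = 0" using slope_vanishes[of r0 P'] r0(2) False by simp
      then show ?thesis unfolding z meval_mult p_def[symmetric] by simp
    qed
  qed
  then have "FF dvd slope * G" using secant.vanishes_iff_dvd by blast
  then show "FF dvd G" using secant.cancel_slope[of 1 G] by simp
qed

lemma zero_locus_mono: "A dvd B \<Longrightarrow> zero_locus A \<subseteq> zero_locus B"
  by (auto simp: zero_locus_def dvd_def meval_mult)

theorem secant_variety_eq: "secant_variety 5 segre_grassmann = zero_locus FF"
proof -
  have "zariski_closure rank_five = zero_locus FF"
  proof
    show "zariski_closure rank_five \<subseteq> zero_locus FF"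
      using vanishes_on_rank_five_iff[OF homogeneous_FF] homogeneous_FF by (auto simp: zariski_closure_def)
    show "zero_locus FF \<subseteq> zariski_closure rank_five"
    proof
      fix L assume L: "L \<in> zero_locus FF"
      then have "L \<in> proj_space" by (auto simp: zero_locus_def proj_space_def)
      moreover have "L \<in> zero_locus G" if "homogeneous d G" "rank_five \<subseteq> zero_locus G" for d G
        using that vanishes_on_rank_five_iff zero_locus_mono L by blast
      ultimately show "L \<in> zariski_closure rank_five" by (auto simp: zariski_closure_def)
    qed
  qed
  then show ?thesis by (simp add: secant_variety_def rank_five_def)
qed

lemma genideal_singleton:
  fixes F :: "'a::comm_ring_1"
  shows "genideal ring_of_type_algebra {F} = {G. F dvd G}"
proof -
  interpret cring "ring_of_type_algebra :: 'a ring" by (rule cring_from_type_algebra)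
  have "genideal ring_of_type_algebra {F} = cgenideal ring_of_type_algebra F"
    by (rule cgenideal_eq_genideal[symmetric]) (simp add: ring_of_type_algebra_def)
  then show ?thesis
    by (auto simp: cgenideal_def ring_of_type_algebra_def dvd_def mult.commute)
qed

theorem vanishing_ideal_secant_variety:
  "vanishing_ideal (secant_variety 5 segre_grassmann) = genideal ring_of_type_algebra {FF}"
proof -
  interpret cring "ring_of_type_algebra :: xpoly ring" by (rule cring_from_type_algebra)
  let ?R = "ring_of_type_algebra :: xpoly ring"
  let ?H = "{G. \<exists>d. homogeneous d G \<and> zero_locus FF \<subseteq> zero_locus G}"
  have carrier: "A \<subseteq> carrier ?R" for A by (simp add: ring_of_type_algebra_def)
  have "rank_five \<subseteq> zero_locus FF" using vanishes_on_rank_five_iff[OF homogeneous_FF] by simp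
  then have "?H \<subseteq> genideal ?R {FF}"
    using vanishes_on_rank_five_iff unfolding genideal_singleton by blast
  then have "genideal ?R ?H \<subseteq> genideal ?R {FF}"
    by (intro genideal_minimal genideal_ideal carrier)
  moreover have "{FF} \<subseteq> genideal ?R ?H"
    using genideal_self[OF carrier, of ?H] homogeneous_FF by blast
  then have "genideal ?R {FF} \<subseteq> genideal ?R ?H"
    by (intro genideal_minimal genideal_ideal carrier)
  ultimately show ?thesis unfolding vanishing_ideal_def secant_variety_eq by blast
qed

text \<open>
  On every line through the origin the restriction of \<open>A\<close> is a unit among
  univariate polynomials.
\<close>
lemma mpoly_unit_constant:
  fixes A B :: "('v::finite, complex) mpoly"
  assumes "A * B = 1"
  shows "\<exists>c. c \<noteq> 0 \<and> A = mconst c"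
proof -
  have const: "meval A p = meval A (\<lambda>v. 0)" for p
  proof -
    obtain a where a: "\<And>t. meval A (\<lambda>v. 0 + t * p v) = poly a t" using meval_line[of A "\<lambda>v. 0" p] by auto
    obtain b where b: "\<And>t. meval B (\<lambda>v. 0 + t * p v) = poly b t" using meval_line[of B "\<lambda>v. 0" p] by auto
    have "poly (a * b) t = poly 1 t" for t
      using arg_cong[OF assms, of "\<lambda>G. meval G (\<lambda>v. 0 + t * p v)"] by (simp add: meval_mult flip: a b)
    then have "a * b = 1" by (simp add: poly_eq_poly_eq_iff[symmetric] fun_eq_iff)
    then have "is_unit a" by (metis dvd_triv_left)
    then obtain k where "a = [:k:]" using is_unit_polyE by blast
    then show ?thesis using a[of 0] a[of 1] by simp
  qed
  then have "A = mconst (meval A (\<lambda>v. 0))" by (intro meval_inject) simp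
  moreover have "meval A (\<lambda>v. 0) \<noteq> 0"
    using arg_cong[OF assms, of "\<lambda>G. meval G (\<lambda>v. 0)"] by (auto simp: meval_mult)
  ultimately show ?thesis by blast
qed

lemma FF_nonzero: "FF \<noteq> 0"
  using slope_nonzero by (auto simp: slope_def slope_in_def)

lemma FF_not_unit: "\<not> FF dvd 1"
proof
  assume "FF dvd 1"
  then obtain K where "1 = FF * K" by (auto simp: dvd_def)
  from arg_cong[OF this, of "\<lambda>G. meval G (\<lambda>t. (\<Sum>s<0::nat. tw (undefined s)) $ t)"]
  show False using FF_vanishes[of 0 undefined] by (simp add: meval_mult)
qed

lemma primeideal_FF: "primeideal (genideal ring_of_type_algebra {FF}) ring_of_type_algebra"
proof -
  interpret cring "ring_of_type_algebra :: xpoly ring" by (rule cring_from_type_algebra)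
  show ?thesis
  proof (rule primeidealI)
    show "ideal (genideal ring_of_type_algebra {FF}) ring_of_type_algebra"
      by (rule genideal_ideal) (simp add: ring_of_type_algebra_def)
    show "cring (ring_of_type_algebra :: xpoly ring)" by (rule is_cring)
    show "carrier ring_of_type_algebra \<noteq> genideal ring_of_type_algebra {FF}"
      using FF_not_unit unfolding genideal_singleton by (auto simp: ring_of_type_algebra_def)
    fix A B :: xpoly
    assume "A \<otimes>\<^bsub>ring_of_type_algebra\<^esub> B \<in> genideal ring_of_type_algebra {FF}"
    moreover have "A \<otimes>\<^bsub>ring_of_type_algebra\<^esub> B = A * B" by (simp add: ring_of_type_algebra_def)
    ultimately show "A \<in> genideal ring_of_type_algebra {FF} \<or> B \<in> genideal ring_of_type_algebra {FF}"
      using secant.prime_equation[of A B] unfolding genideal_singleton by simp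
  qed
qed

theorem theorem4p1:
  shows "hypersurface (secant_variety 5 segre_grassmann)
    \<and> primeideal (vanishing_ideal (secant_variety 5 segre_grassmann)) ring_of_type_algebra
    \<and> FF \<noteq> 0 \<and> homogeneous 6 FF
    \<and> vanishing_ideal (secant_variety 5 segre_grassmann) = genideal ring_of_type_algebra {FF}
    \<and> (\<forall>G. vanishing_ideal (secant_variety 5 segre_grassmann) = genideal ring_of_type_algebra {G}
          \<longrightarrow> (\<exists>c. c \<noteq> 0 \<and> G = mconst c * FF))"
proof (intro conjI allI impI)
  show "hypersurface (secant_variety 5 segre_grassmann)"
    unfolding hypersurface_def secant_variety_eq using FF_nonzero homogeneous_FF
    by (intro exI[of _ 6] exI[of _ FF]) simp
  show "primeideal (vanishing_ideal (secant_variety 5 segre_grassmann)) ring_of_type_algebra"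
    unfolding vanishing_ideal_secant_variety by (rule primeideal_FF)
  fix G assume "vanishing_ideal (secant_variety 5 segre_grassmann) = genideal ring_of_type_algebra {G}"
  then have "{K. FF dvd K} = {K. G dvd K}"
    unfolding vanishing_ideal_secant_variety genideal_singleton .
  then have same: "FF dvd K \<longleftrightarrow> G dvd K" for K
    unfolding set_eq_iff mem_Collect_eq by (rule spec)
  have "FF dvd G" "G dvd FF" using same[of G] same[of FF] by simp_all
  obtain A where A: "G = FF * A" using \<open>FF dvd G\<close> by (rule dvdE)
  obtain B where B: "FF = G * B" using \<open>G dvd FF\<close> by (rule dvdE)
  have "FF * (A * B) = G * B" by (simp only: A mult.assoc)
  also have "\<dots> = FF * 1" unfolding mult_1_right by (rule B[symmetric])
  finally have "A * B = 1" using FF_nonzero by (rule mpoly_mult_cancel)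
  then obtain c where c: "c \<noteq> 0" "A = mconst c" using mpoly_unit_constant by blast
  have "G = mconst c * FF" unfolding A c(2) by (rule mult.commute)
  with c(1) show "\<exists>c. c \<noteq> 0 \<and> G = mconst c * FF" by blast
qed (fact FF_nonzero homogeneous_FF vanishing_ideal_secant_variety)+

end
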